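(* Let $(G_\nu)_{\nu\ge1}$ be a sequence of graphs with $|G_\nu|\to\infty$, and suppose that $(G_\nu)$ is convergent, i.e., $G_\nu\to\Gamma$ for some graph limit $\Gamma$. Then $\Gamma\in\mathcal U_\uparrow$ (i.e., $\Gamma$ is a monotone graph limit) if and only if $\Omega_0(G_\nu)\to0$ as $\nu\to\infty$.
   Context: Graphs are finite and simple; $|G|$ is the number of vertices of $G$. The functional $\Omega_0$. Let $G$ be a graph with vertex set $V$ and $n=|V|$. For $v\in V$ and $A\subseteq V$ let $e(v,A)$ be the number of neighbours of $v$ in $A$. Write $x_+=\max\{x,0\}$. For a linear order $\prec$ on $V$ and $A\subseteq V$ set $$\Omega_0(G,\prec,A)=\frac1{n^3}\sum_{v\prec w}\bigl(e(v,A\setminus\{v,w\})-e(w,A\setminus\{v,w\})\bigr)_+,$$ the sum being over all pairs $(v,w)\in V^2$ with $v\prec w$. Set $\Omega_0(G,\prec)=\max_{A\subseteq V}\Omega_0(G,\prec,A)$ and $\Omega_0(G)=\min_{\prec}\Omega_0(G,\prec)$, the minimum being over all linear orders on $V$. Kernels and graph limits. A kernel on a probability space $(S,\mu)$ is a symmetric measurable function $W:S^2\to[0,1]$. For $W\in L^1(S^2)$ the cut norm is $\|W\|_{\square}=\sup\bigl|\int_{S^2}W(x,y)f(x)g(y)\,d\mu(x)\,d\mu(y)\bigr|$, the supremum being over measurable $f,g:S\to[-1,1]$. For kernels $W_1$ on $S_1$ and $W_2$ on $S_2$, $\delta_\square(W_1,W_2)=\inf\|W_1^{\varphi_1}-W_2^{\varphi_2}\|_\square$,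 the infimum being over all pairs of measure-preserving maps $\varphi_1:S_3\to S_1$, $\varphi_2:S_3\to S_2$ from a common probability space $S_3$, where $W^\varphi(x,y)=W(\varphi(x),\varphi(y))$. Kernels with $\delta_\square(W_1,W_2)=0$ are called equivalent. Graph limits are identified with equivalence classes of kernels, $\Gamma_W$ denoting the class of $W$ (every class contains a kernel on $[0,1]$ with Lebesgue measure). For a graph $G$ with vertices labelled $1,\dots,n$, $W_G$ is the kernel on $(0,1]$ (equivalently $[0,1]$) with $W_G(x,y)=1$ if $\lceil nx\rceil$ and $\lceil ny\rceil$ are adjacent in $G$, and $0$ otherwise. A sequence of graphs $G_\nu$ with $|G_\nu|\to\infty$ converges to $\Gamma_W$ if $\delta_\square(W_{G_\nu},W)\to0$ (this does not depend on the labellings). A kernel $W$ on $[0,1]$ is monotone if $W(x_1,y_1)\le W(x_2,y_2)$ whenever $0\le x_1\le x_2\le1$ and $0\le y_1\le y_2\le 1$. The set $\mathcal U_\uparrow$ of monotone graph limits is the set of graph limits of the form $\Gamma_W$ with $W$ a monotone kernel on $[0,1]$. *)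

theory Defs
  imports "HOL-Probability.Probability" "Graph_Theory.Graph_Theory"
begin

section \<open>The functional \<open>\<Omega>\<^sub>0\<close>\<close>

text \<open>Finite simple graphs are the instances of the locale \<^locale>\<open>pair_graph\<close>: finite vertex set,
  arc set symmetric and irreflexive; an edge is a pair of opposite arcs.\<close>

definition nbrs_in :: "'a pair_pre_digraph \<Rightarrow> 'a \<Rightarrow> 'a set \<Rightarrow> nat" where
  "nbrs_in G v A = card {u \<in> A. (v, u) \<in> parcs G}"

text \<open>The relation \<open>r\<close> is the reflexive version of the linear order, as in \<^const>\<open>linear_order_on\<close>.\<close>

definition Omega0_order_set :: "'a pair_pre_digraph \<Rightarrow> 'a rel \<Rightarrow> 'a set \<Rightarrow> real" where
  "Omega0_order_set G r A =
     (\<Sum>(v, w) \<in> {(v, w) \<in> pverts G \<times> pverts G. (v, w) \<in> r \<and> v \<noteq> w}.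
        max (real (nbrs_in G v (A - {v, w})) - real (nbrs_in G w (A - {v, w}))) 0)
     / real (card (pverts G)) ^ 3"

definition Omega0_order :: "'a pair_pre_digraph \<Rightarrow> 'a rel \<Rightarrow> real" where
  "Omega0_order G r = Max {Omega0_order_set G r A | A. A \<subseteq> pverts G}"

definition Omega0 :: "'a pair_pre_digraph \<Rightarrow> real" where
  "Omega0 G = Min {Omega0_order G r | r. linear_order_on (pverts G) r}"

section \<open>Kernels and the cut distance\<close>

definition is_kernel :: "'a measure \<Rightarrow> ('a \<Rightarrow> 'a \<Rightarrow> real) \<Rightarrow> bool" where
  "is_kernel M W \<longleftrightarrow>
     (\<lambda>(x, y). W x y) \<in> borel_measurable (M \<Otimes>\<^sub>M M) \<and>
     (\<forall>x \<in> space M. \<forall>y \<in> space M. W x y = W y x \<and> 0 \<le> W x y \<and> W x y \<le> 1)"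

definition cut_norm :: "'a measure \<Rightarrow> ('a \<Rightarrow> 'a \<Rightarrow> real) \<Rightarrow> real" where
  "cut_norm M W =
     Sup {\<bar>\<integral>(x, y). W x y * f x * g y \<partial>(M \<Otimes>\<^sub>M M)\<bar> | f g.
            f \<in> borel_measurable M \<and> g \<in> borel_measurable M \<and>
            (\<forall>x \<in> space M. \<bar>f x\<bar> \<le> 1) \<and> (\<forall>x \<in> space M. \<bar>g x\<bar> \<le> 1)}"

definition measure_preserving_map :: "'a measure \<Rightarrow> 'b measure \<Rightarrow> ('a \<Rightarrow> 'b) \<Rightarrow> bool" where
  "measure_preserving_map N M \<phi> \<longleftrightarrow>
     \<phi> \<in> measurable N M \<and> (\<forall>A \<in> sets M. emeasure N (\<phi> -` A \<inter> space N) = emeasure M A)"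

text \<open>The common probability space ranges over all probability spaces whose points have type
  \<^typ>\<open>'a \<times> 'b\<close>. Spaces of other types would not change the infimum: given
  \<open>\<phi>\<^sub>1 : S\<^sub>3 \<rightarrow> S\<^sub>1\<close> and \<open>\<phi>\<^sub>2 : S\<^sub>3 \<rightarrow> S\<^sub>2\<close>, the image measure under
  \<open>(\<phi>\<^sub>1, \<phi>\<^sub>2)\<close> with the two projections gives the same cut norm, because a test function on \<open>S\<^sub>3\<close>
  may be replaced by its conditional expectation given \<open>(\<phi>\<^sub>1, \<phi>\<^sub>2)\<close>.\<close>

definition cut_dist ::
  "'a measure \<Rightarrow> ('a \<Rightarrow> 'a \<Rightarrow> real) \<Rightarrow> 'b measure \<Rightarrow> ('b \<Rightarrow> 'b \<Rightarrow> real) \<Rightarrow> real" where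
  "cut_dist M1 W1 M2 W2 =
     Inf {cut_norm N (\<lambda>x y. W1 (\<phi>1 x) (\<phi>1 y) - W2 (\<phi>2 x) (\<phi>2 y)) |
            (N :: ('a \<times> 'b) measure) \<phi>1 \<phi>2.
            prob_space N \<and> measure_preserving_map N M1 \<phi>1 \<and> measure_preserving_map N M2 \<phi>2}"

section \<open>Graph limits\<close>

definition unit_interval :: "real measure" where
  "unit_interval = restrict_space lborel {0..1}"

text \<open>The equivalence class of a kernel on an arbitrary probability space is represented by its
  members on the unit interval; every class has such members.\<close>

definition graph_limit_of :: "'a measure \<Rightarrow> ('a \<Rightarrow> 'a \<Rightarrow> real) \<Rightarrow> (real \<Rightarrow> real \<Rightarrow> real) set" where
  "graph_limit_of M W = {W'. is_kernel unit_interval W' \<and> cut_dist M W unit_interval W' = 0}"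

definition monotone_kernel :: "(real \<Rightarrow> real \<Rightarrow> real) \<Rightarrow> bool" where
  "monotone_kernel W \<longleftrightarrow> is_kernel unit_interval W \<and>
     (\<forall>x1 x2 y1 y2. 0 \<le> x1 \<and> x1 \<le> x2 \<and> x2 \<le> 1 \<and> 0 \<le> y1 \<and> y1 \<le> y2 \<and> y2 \<le> 1
        \<longrightarrow> W x1 y1 \<le> W x2 y2)"

definition monotone_graph_limits :: "(real \<Rightarrow> real \<Rightarrow> real) set set" where
  "monotone_graph_limits = {graph_limit_of unit_interval W | W. monotone_kernel W}"

definition labelling :: "'a pair_pre_digraph \<Rightarrow> (nat \<Rightarrow> 'a) \<Rightarrow> bool" where
  "labelling G l \<longleftrightarrow> bij_betw l {1..card (pverts G)} (pverts G)"

text \<open>At the point \<open>0\<close>, which carries no label, the kernel is set to \<open>0\<close>.\<close>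

definition graph_kernel :: "'a pair_pre_digraph \<Rightarrow> (nat \<Rightarrow> 'a) \<Rightarrow> real \<Rightarrow> real \<Rightarrow> real" where
  "graph_kernel G l x y =
     (if 0 < x \<and> 0 < y \<and>
         (l (nat \<lceil>real (card (pverts G)) * x\<rceil>), l (nat \<lceil>real (card (pverts G)) * y\<rceil>)) \<in> parcs G
      then 1 else 0)"

text \<open>Convergence to the graph limit of \<open>W\<close>. It does not depend on the choice of the labellings.\<close>

definition graphs_converge_to ::
  "(nat \<Rightarrow> 'a pair_pre_digraph) \<Rightarrow> 'b measure \<Rightarrow> ('b \<Rightarrow> 'b \<Rightarrow> real) \<Rightarrow> bool" where
  "graphs_converge_to G M W \<longleftrightarrow>
     (\<exists>l. (\<forall>\<nu>. labelling (G \<nu>) (l \<nu>)) \<and>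
          (\<lambda>\<nu>. cut_dist unit_interval (graph_kernel (G \<nu>) (l \<nu>)) M W) \<longlonglongrightarrow> 0)"

end

theory Submission
  imports Defs
begin

text \<open>
  If \<open>V\<close> is a monotone kernel, order the vertices of \<open>G\<close> by degree. For a vertex set \<open>A\<close> the functions
  \<open>D\<^sub>A x = \<integral> V x y 1\<^sub>A(y) dy\<close> and \<open>D\<^sub>1 - D\<^sub>A\<close> are both increasing, hence
  \<open>0 \<le> D\<^sub>A x' - D\<^sub>A x \<le> D\<^sub>1 x' - D\<^sub>1 x\<close> for \<open>x \<le> x'\<close>: a pair of vertices that the degree order puts
  the wrong way round with respect to \<open>V\<close> has nearly equal degrees and therefore nearly equal degrees
  into \<open>A\<close>. So \<open>\<Omega>\<^sub>0\<close> is at most four times the cut distance to \<open>V\<close>, up to \<open>O(1/n)\<close>.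

  Conversely, lay out the vertices on the unit interval along an optimal order. All degree functions
  \<open>d\<close> into weighted vertex sets are then almost increasing, and for such functions the integral of
  \<open>\<bar>d x - d y\<bar>\<close> over \<open>\<bar>x - y\<bar> \<le> h\<close> is \<open>O(\<Omega>\<^sub>0 + h\<^sup>2)\<close>, since the signed integral of \<open>d y - d x\<close> over
  \<open>0 < y - x \<le> h\<close> is at most \<open>h\<^sup>2\<close> for every \<open>d\<close> with values in the unit interval. Hence the kernel is
  close in cut norm to the step function of its averages over \<open>k \<times> k\<close> blocks. Along a diagonal
  subsequence all averages converge; the limits are monotone across all pairs of comparable blocks, and
  their supremum over the blocks below \<open>(x, y)\<close> is a monotone kernel to which the subsequence converges.

  Both directions need the triangle inequality for the cut distance on arbitrary probability spaces.
  It is obtained by approximating the middle kernel by a step function and gluing the two couplings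
  along the finitely many steps.
\<close>

section \<open>The cut norm and the cut distance\<close>

text \<open>Averaging over blocks brings in a factor k, so bounding the strip
  \<open>\<bar>x - y\<bar> \<le> 1/k\<close> by its area would leave an error of constant order. The
  bound h^2 of the signed integral improves this to O(k e + 1/k), with e the defect of monotonicity.
  Hence k stays fixed while the graphs grow, and only afterwards becomes large. The functional
  speaks of vertex sets, whereas a test function on the interval yields fractional vertex weights.
  Positive parts of linear forms are convex, so their sum is largest at 0-1 weights and nothing is
  lost. The limit kernel must be monotone at every point, not merely almost everywhere. A supremum
  over blocks is so by construction, and comparing averages across all scales at once keeps it close
  to each of the step kernels. Graphs enter as kernels on the uniform measure of their vertices. The
  given labelling and an optimal order are then two pull-backs of one unlabelled kernel. Gluing two
  couplings over their common space calls for a disintegration, which general probability spaces do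
  not provide; a finite label makes the density explicit.\<close>

definition test_function :: "'a measure \<Rightarrow> ('a \<Rightarrow> real) \<Rightarrow> bool" where
  "test_function M f \<longleftrightarrow> f \<in> borel_measurable M \<and> (\<forall>x \<in> space M. \<bar>f x\<bar> \<le> 1)"

text \<open>Unlike \<open>is_kernel\<close>, this class is closed under differences, which is where
  the cut norm is evaluated.\<close>

definition bounded_kernel :: "'a measure \<Rightarrow> ('a \<Rightarrow> 'a \<Rightarrow> real) \<Rightarrow> bool" where
  "bounded_kernel M D \<longleftrightarrow> (\<lambda>(x, y). D x y) \<in> borel_measurable (M \<Otimes>\<^sub>M M) \<and>
     (\<exists>C. \<forall>x \<in> space M. \<forall>y \<in> space M. \<bar>D x y\<bar> \<le> C)"

definition cut_form :: "'a measure \<Rightarrow> ('a \<Rightarrow> 'a \<Rightarrow> real) \<Rightarrow> ('a \<Rightarrow> real) \<Rightarrow> ('a \<Rightarrow> real) \<Rightarrow> real" where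
  "cut_form M D f g = (\<integral>(x, y). D x y * f x * g y \<partial>(M \<Otimes>\<^sub>M M))"

lemma cut_norm_eq:
  "cut_norm M D = Sup {\<bar>cut_form M D f g\<bar> | f g. test_function M f \<and> test_function M g}"
  unfolding cut_norm_def cut_form_def test_function_def
  by (rule arg_cong[where f = Sup]) blast

lemma test_function_const: "\<bar>c\<bar> \<le> 1 \<Longrightarrow> test_function M (\<lambda>_. c)"
  by (simp add: test_function_def)

lemma test_function_measurable: "test_function M f \<Longrightarrow> f \<in> borel_measurable M"
  by (simp add: test_function_def)

lemma test_function_comp:
  "test_function M f \<Longrightarrow> \<phi> \<in> measurable N M \<Longrightarrow> test_function N (\<lambda>x. f (\<phi> x))"
  by (auto simp: test_function_def dest: measurable_space intro: measurable_compose)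

lemma bounded_kernelE:
  assumes "bounded_kernel M D"
  obtains C where "C \<ge> 0" "\<And>x y. x \<in> space M \<Longrightarrow> y \<in> space M \<Longrightarrow> \<bar>D x y\<bar> \<le> C"
    "(\<lambda>(x, y). D x y) \<in> borel_measurable (M \<Otimes>\<^sub>M M)"
proof -
  obtain C where C: "\<And>x y. x \<in> space M \<Longrightarrow> y \<in> space M \<Longrightarrow> \<bar>D x y\<bar> \<le> C"
    using assms by (auto simp: bounded_kernel_def)
  show thesis
  proof (rule that[of "max C 0"])
    show "\<bar>D x y\<bar> \<le> max C 0" if "x \<in> space M" "y \<in> space M" for x y
      using C[OF that] by simp
  qed (use assms in \<open>auto simp: bounded_kernel_def\<close>)
qed

lemma is_kernel_bounded: "is_kernel M W \<Longrightarrow> bounded_kernel M W"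
  unfolding is_kernel_def bounded_kernel_def by (intro conjI exI[of _ 1]) auto

lemma bounded_kernel_diff:
  assumes "bounded_kernel M D" "bounded_kernel M E"
  shows "bounded_kernel M (\<lambda>x y. D x y - E x y)"
proof -
  obtain C where C: "\<And>x y. x \<in> space M \<Longrightarrow> y \<in> space M \<Longrightarrow> \<bar>D x y\<bar> \<le> C"
    and [measurable]: "(\<lambda>(x, y). D x y) \<in> borel_measurable (M \<Otimes>\<^sub>M M)"
    using bounded_kernelE[OF assms(1)] by metis
  obtain C' where C': "\<And>x y. x \<in> space M \<Longrightarrow> y \<in> space M \<Longrightarrow> \<bar>E x y\<bar> \<le> C'"
    and [measurable]: "(\<lambda>(x, y). E x y) \<in> borel_measurable (M \<Otimes>\<^sub>M M)"
    using bounded_kernelE[OF assms(2)] by metis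
  have "\<bar>D x y - E x y\<bar> \<le> C + C'" if "x \<in> space M" "y \<in> space M" for x y
    using C[OF that] C'[OF that] by linarith
  moreover have "(\<lambda>(x, y). D x y - E x y) \<in> borel_measurable (M \<Otimes>\<^sub>M M)"
    by measurable
  ultimately show ?thesis unfolding bounded_kernel_def by blast
qed

lemma bounded_kernel_comp:
  assumes "bounded_kernel M D" and [measurable]: "\<phi> \<in> measurable N M"
  shows "bounded_kernel N (\<lambda>x y. D (\<phi> x) (\<phi> y))"
proof -
  obtain C where C: "\<And>x y. x \<in> space M \<Longrightarrow> y \<in> space M \<Longrightarrow> \<bar>D x y\<bar> \<le> C"
    and [measurable]: "(\<lambda>(x, y). D x y) \<in> borel_measurable (M \<Otimes>\<^sub>M M)"
    using bounded_kernelE[OF assms(1)] by metis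
  have "(\<lambda>p. (\<lambda>(x, y). D x y) (\<phi> (fst p), \<phi> (snd p))) \<in> borel_measurable (N \<Otimes>\<^sub>M N)"
    by measurable
  then show ?thesis unfolding bounded_kernel_def
    using C assms(2)[THEN measurable_space] by (auto simp: case_prod_beta intro!: exI[of _ C])
qed

context prob_space
begin

lemma pair_prob: "prob_space (M \<Otimes>\<^sub>M M)"
proof -
  interpret pair_prob_space M M ..
  show ?thesis by unfold_locales
qed

lemma integrable_bounded:
  fixes f :: "'a \<Rightarrow> real"
  assumes "f \<in> borel_measurable M" "\<And>x. x \<in> space M \<Longrightarrow> \<bar>f x\<bar> \<le> C"
  shows "integrable M f"
  by (rule integrable_const_bound[where B = C]) (use assms in auto)

text \<open>A non-integrable function has integral 0 by convention; the assumption
  \<open>0 \<le> C\<close> takes care of that case.\<close>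

lemma integral_bounded_le:
  fixes f :: "'a \<Rightarrow> real"
  assumes "\<And>x. x \<in> space M \<Longrightarrow> f x \<le> C" "0 \<le> C"
  shows "integral\<^sup>L M f \<le> C"
proof (cases "integrable M f")
  case True
  then have "integral\<^sup>L M f \<le> integral\<^sup>L M (\<lambda>_. C)"
    using assms by (intro integral_mono) auto
  then show ?thesis by (simp add: prob_space)
next
  case False
  then show ?thesis using assms by (simp add: not_integrable_integral_eq)
qed

lemma abs_integral_bounded_le:
  fixes f :: "'a \<Rightarrow> real"
  assumes "\<And>x. x \<in> space M \<Longrightarrow> \<bar>f x\<bar> \<le> C" "0 \<le> C"
  shows "\<bar>integral\<^sup>L M f\<bar> \<le> C"
proof -
  have "\<bar>integral\<^sup>L M f\<bar> \<le> (\<integral>x. \<bar>f x\<bar> \<partial>M)"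
    using integral_norm_bound[of M f] by simp
  also have "\<dots> \<le> C" using assms by (intro integral_bounded_le) auto
  finally show ?thesis .
qed

lemma kernel_integrable:
  assumes D: "bounded_kernel M D" and f: "test_function M f" and g: "test_function M g"
  shows "integrable (M \<Otimes>\<^sub>M M) (\<lambda>(x, y). D x y * f x * g y)"
proof -
  obtain C where C: "C \<ge> 0" "\<And>x y. x \<in> space M \<Longrightarrow> y \<in> space M \<Longrightarrow> \<bar>D x y\<bar> \<le> C"
    and [measurable]: "(\<lambda>(x, y). D x y) \<in> borel_measurable (M \<Otimes>\<^sub>M M)"
    using bounded_kernelE[OF D] by metis
  have [measurable]: "f \<in> borel_measurable M" "g \<in> borel_measurable M"
    using f g by (auto simp: test_function_def)
  have "\<bar>D x y * f x * g y\<bar> \<le> C" if "x \<in> space M" "y \<in> space M" for x y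
  proof -
    have "\<bar>D x y * f x * g y\<bar> = \<bar>D x y\<bar> * (\<bar>f x\<bar> * \<bar>g y\<bar>)" by (simp add: abs_mult)
    also have "\<dots> \<le> C * (1 * 1)"
      using that f g C by (intro mult_mono) (auto simp: test_function_def)
    finally show ?thesis by simp
  qed
  then show ?thesis
    by (intro prob_space.integrable_bounded[OF pair_prob, where C = C])
       (auto simp: space_pair_measure)
qed

lemma cut_form_iterated:
  assumes "bounded_kernel M D" "test_function M f" "test_function M g"
  shows "cut_form M D f g = (\<integral>x. (\<integral>y. D x y * g y \<partial>M) * f x \<partial>M)"
proof -
  interpret P: pair_sigma_finite M M ..
  have "cut_form M D f g = (\<integral>x. (\<integral>y. D x y * f x * g y \<partial>M) \<partial>M)"
    unfolding cut_form_def
    using P.integral_fst'[OF kernel_integrable[OF assms]] by simp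
  also have "\<dots> = (\<integral>x. (\<integral>y. D x y * g y \<partial>M) * f x \<partial>M)"
  proof (rule Bochner_Integration.integral_cong)
    fix x
    have "(\<integral>y. D x y * f x * g y \<partial>M) = (\<integral>y. D x y * g y * f x \<partial>M)" by (simp add: ac_simps)
    then show "(\<integral>y. D x y * f x * g y \<partial>M) = (\<integral>y. D x y * g y \<partial>M) * f x"
      by simp
  qed simp
  finally show ?thesis .
qed

lemma abs_cut_form_le_integral:
  assumes D: "bounded_kernel M D" and f: "test_function M f" and g: "test_function M g"
  shows "\<bar>cut_form M D f g\<bar> \<le> (\<integral>(x, y). \<bar>D x y\<bar> \<partial>(M \<Otimes>\<^sub>M M))"
proof -
  have "\<bar>cut_form M D f g\<bar> \<le> (\<integral>p. \<bar>case p of (x, y) \<Rightarrow> D x y * f x * g y\<bar> \<partial>(M \<Otimes>\<^sub>M M))"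
    using integral_norm_bound[of "M \<Otimes>\<^sub>M M" "\<lambda>(x, y). D x y * f x * g y"] by (simp add: cut_form_def)
  also have "\<dots> \<le> (\<integral>(x, y). \<bar>D x y\<bar> \<partial>(M \<Otimes>\<^sub>M M))"
  proof (rule integral_mono)
    show "integrable (M \<Otimes>\<^sub>M M) (\<lambda>p. \<bar>case p of (x, y) \<Rightarrow> D x y * f x * g y\<bar>)"
      using kernel_integrable[OF assms] by simp
    have "integrable (M \<Otimes>\<^sub>M M) (\<lambda>(x, y). D x y * 1 * 1)"
      by (rule kernel_integrable[OF D]) (simp_all add: test_function_const)
    then have "integrable (M \<Otimes>\<^sub>M M) (\<lambda>p. \<bar>case p of (x, y) \<Rightarrow> D x y\<bar>)" by simp
    then show "integrable (M \<Otimes>\<^sub>M M) (\<lambda>(x, y). \<bar>D x y\<bar>)" by (simp add: case_prod_beta')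
    fix p assume "p \<in> space (M \<Otimes>\<^sub>M M)"
    then have p: "fst p \<in> space M" "snd p \<in> space M" by (auto simp: space_pair_measure)
    have "\<bar>D (fst p) (snd p)\<bar> * (\<bar>f (fst p)\<bar> * \<bar>g (snd p)\<bar>) \<le> \<bar>D (fst p) (snd p)\<bar> * (1 * 1)"
      using p f g by (intro mult_mono) (auto simp: test_function_def)
    then show "\<bar>case p of (x, y) \<Rightarrow> D x y * f x * g y\<bar> \<le> (case p of (x, y) \<Rightarrow> \<bar>D x y\<bar>)"
      by (simp add: case_prod_beta abs_mult mult.assoc)
  qed
  finally show ?thesis .
qed

lemma cut_norm_upper:
  assumes D: "bounded_kernel M D" and f: "test_function M f" and g: "test_function M g"
  shows "\<bar>cut_form M D f g\<bar> \<le> cut_norm M D"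
  unfolding cut_norm_eq
proof (rule cSup_upper)
  show "bdd_above {\<bar>cut_form M D f g\<bar> | f g. test_function M f \<and> test_function M g}"
    using abs_cut_form_le_integral[OF D] by (intro bdd_aboveI[of _ "(\<integral>(x, y). \<bar>D x y\<bar> \<partial>(M \<Otimes>\<^sub>M M))"]) auto
qed (use assms in auto)

lemma cut_norm_nonneg: "bounded_kernel M D \<Longrightarrow> 0 \<le> cut_norm M D"
  using cut_norm_upper[of D "\<lambda>_. 0" "\<lambda>_. 0"] by (simp add: test_function_const) 

end

lemma cut_norm_least:
  assumes "\<And>f g. test_function M f \<Longrightarrow> test_function M g \<Longrightarrow> \<bar>cut_form M D f g\<bar> \<le> c"
  shows "cut_norm M D \<le> c"
  unfolding cut_norm_eq
  by (rule cSup_least) (use assms test_function_const[of 0 M] in auto)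

lemma cut_norm_uminus: "cut_norm M (\<lambda>x y. - D x y) = cut_norm M D"
proof -
  have "cut_form M (\<lambda>x y. - D x y) f g = - cut_form M D f g" for f g
    unfolding cut_form_def by (subst Bochner_Integration.integral_minus[symmetric])
      (rule Bochner_Integration.integral_cong, auto)
  then show ?thesis unfolding cut_norm_eq by simp
qed

context prob_space
begin

lemma cut_norm_le_integral:
  "bounded_kernel M D \<Longrightarrow> cut_norm M D \<le> (\<integral>(x, y). \<bar>D x y\<bar> \<partial>(M \<Otimes>\<^sub>M M))"
  using abs_cut_form_le_integral by (intro cut_norm_least)

lemma cut_form_diff:
  assumes "bounded_kernel M D" "bounded_kernel M E" "test_function M f" "test_function M g"
  shows "cut_form M (\<lambda>x y. D x y - E x y) f g = cut_form M D f g - cut_form M E f g"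
proof -
  have "cut_form M D f g - cut_form M E f g
      = (\<integral>p. (case p of (x, y) \<Rightarrow> D x y * f x * g y) - (case p of (x, y) \<Rightarrow> E x y * f x * g y) \<partial>(M \<Otimes>\<^sub>M M))"
    unfolding cut_form_def using assms
    by (intro Bochner_Integration.integral_diff[symmetric] kernel_integrable)
  also have "\<dots> = cut_form M (\<lambda>x y. D x y - E x y) f g"
    unfolding cut_form_def by (rule Bochner_Integration.integral_cong) (auto simp: algebra_simps)
  finally show ?thesis by simp
qed

lemma cut_norm_triangle:
  assumes "bounded_kernel M D" "bounded_kernel M E" "bounded_kernel M F"
  shows "cut_norm M (\<lambda>x y. D x y - F x y)
    \<le> cut_norm M (\<lambda>x y. D x y - E x y) + cut_norm M (\<lambda>x y. E x y - F x y)"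
proof (rule cut_norm_least)
  fix f g assume fg: "test_function M f" "test_function M g"
  have "cut_form M (\<lambda>x y. D x y - F x y) f g
      = cut_form M (\<lambda>x y. D x y - E x y) f g + cut_form M (\<lambda>x y. E x y - F x y) f g"
    using assms fg by (simp add: cut_form_diff)
  moreover have "\<bar>cut_form M (\<lambda>x y. D x y - E x y) f g\<bar> \<le> cut_norm M (\<lambda>x y. D x y - E x y)"
      "\<bar>cut_form M (\<lambda>x y. E x y - F x y) f g\<bar> \<le> cut_norm M (\<lambda>x y. E x y - F x y)"
    using assms fg by (auto intro!: cut_norm_upper bounded_kernel_diff)
  ultimately show "\<bar>cut_form M (\<lambda>x y. D x y - F x y) f g\<bar>
    \<le> cut_norm M (\<lambda>x y. D x y - E x y) + cut_norm M (\<lambda>x y. E x y - F x y)" by linarith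
qed

end

section \<open>Measure-preserving maps and couplings\<close>

lemma measure_preserving_map_iff_distr:
  "measure_preserving_map N M \<phi> \<longleftrightarrow> \<phi> \<in> measurable N M \<and> distr N M \<phi> = M"
proof
  assume "measure_preserving_map N M \<phi>"
  then show "\<phi> \<in> measurable N M \<and> distr N M \<phi> = M"
    by (auto simp: measure_preserving_map_def emeasure_distr intro!: measure_eqI)
next
  assume h: "\<phi> \<in> measurable N M \<and> distr N M \<phi> = M"
  then have "emeasure N (\<phi> -` A \<inter> space N) = emeasure M A" if "A \<in> sets M" for A
    using emeasure_distr[of \<phi> N M A] that by simp
  then show "measure_preserving_map N M \<phi>"
    using h by (simp add: measure_preserving_map_def)
qed

lemma measure_preserving_comp:
  assumes "measure_preserving_map N M \<phi>" "measure_preserving_map L N \<psi>"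
  shows "measure_preserving_map L M (\<lambda>x. \<phi> (\<psi> x))"
proof -
  have m: "\<phi> \<in> measurable N M" "\<psi> \<in> measurable L N" "distr N M \<phi> = M" "distr L N \<psi> = N"
    using assms by (auto simp: measure_preserving_map_iff_distr)
  have "distr L M (\<phi> \<circ> \<psi>) = M"
    using distr_distr[OF m(1,2)] m by simp
  then show ?thesis using m by (auto simp: measure_preserving_map_iff_distr comp_def)
qed

lemma measure_preserving_integral:
  fixes f :: "'b \<Rightarrow> real"
  assumes "measure_preserving_map N M \<phi>" "f \<in> borel_measurable M"
  shows "(\<integral>x. f (\<phi> x) \<partial>N) = integral\<^sup>L M f"
  using integral_distr[of \<phi> N M f] assms by (simp add: measure_preserving_map_iff_distr)

lemma measure_preserving_pair:
  assumes "prob_space M" "measure_preserving_map N M \<phi>"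
  shows "measure_preserving_map (N \<Otimes>\<^sub>M N) (M \<Otimes>\<^sub>M M) (\<lambda>(x, y). (\<phi> x, \<phi> y))"
proof -
  have m: "\<phi> \<in> measurable N M" "distr N M \<phi> = M"
    using assms by (auto simp: measure_preserving_map_iff_distr)
  interpret prob_space M by fact
  have "distr N M \<phi> \<Otimes>\<^sub>M distr N M \<phi> = distr (N \<Otimes>\<^sub>M N) (M \<Otimes>\<^sub>M M) (\<lambda>(x, y). (\<phi> x, \<phi> y))"
    using m sigma_finite_measure_axioms by (intro pair_measure_distr) auto
  then show ?thesis using m by (simp add: measure_preserving_map_iff_distr)
qed

lemma measure_preserving_id: "measure_preserving_map M M (\<lambda>x. x)"
  by (auto simp: measure_preserving_map_iff_distr distr_id2)

lemma bounded_kernel_coupling: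
  assumes "bounded_kernel M1 W1" "bounded_kernel M2 W2"
    and "measure_preserving_map N M1 \<phi>1" "measure_preserving_map N M2 \<phi>2"
  shows "bounded_kernel N (\<lambda>x y. W1 (\<phi>1 x) (\<phi>1 y) - W2 (\<phi>2 x) (\<phi>2 y))"
proof (rule bounded_kernel_diff)
  show "bounded_kernel N (\<lambda>x y. W1 (\<phi>1 x) (\<phi>1 y))"
    by (rule bounded_kernel_comp[OF assms(1)]) (use assms in \<open>simp add: measure_preserving_map_def\<close>)
  show "bounded_kernel N (\<lambda>x y. W2 (\<phi>2 x) (\<phi>2 y))"
    by (rule bounded_kernel_comp[OF assms(2)]) (use assms in \<open>simp add: measure_preserving_map_def\<close>)
qed

text \<open>The infimum in \<open>cut_dist\<close> runs over measures on the product type only. Any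
  other coupling is pushed forward along the pair of its maps, and test functions on the image pull
  back to test functions on \<open>S\<close>, so the norm does not increase.\<close>

lemma cut_dist_le:
  fixes M1 :: "'a measure" and M2 :: "'b measure" and S :: "'c measure"
  assumes S: "prob_space S" and \<phi>1: "measure_preserving_map S M1 \<phi>1" and \<phi>2: "measure_preserving_map S M2 \<phi>2"
    and M: "prob_space M1" "prob_space M2"
    and W1: "bounded_kernel M1 W1" and W2: "bounded_kernel M2 W2"
  shows "cut_dist M1 W1 M2 W2 \<le> cut_norm S (\<lambda>x y. W1 (\<phi>1 x) (\<phi>1 y) - W2 (\<phi>2 x) (\<phi>2 y))"
proof -
  interpret S: prob_space S by fact
  define \<phi> where "\<phi> x = (\<phi>1 x, \<phi>2 x)" for x
  define N where "N = distr S (M1 \<Otimes>\<^sub>M M2) \<phi>"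
  have [measurable]: "\<phi>1 \<in> measurable S M1" "\<phi>2 \<in> measurable S M2"
    using \<phi>1 \<phi>2 by (auto simp: measure_preserving_map_def)
  have [measurable]: "\<phi> \<in> measurable S (M1 \<Otimes>\<^sub>M M2)" unfolding \<phi>_def by measurable
  have N: "prob_space N" unfolding N_def by (rule S.prob_space_distr) measurable
  interpret N: prob_space N by fact
  have [measurable]: "fst \<in> measurable N M1" "snd \<in> measurable N M2" by (auto simp: N_def)
  have \<phi>N: "measure_preserving_map S N \<phi>"
    unfolding measure_preserving_map_iff_distr N_def
    by (auto intro!: measure_eqI simp: emeasure_distr)
  have 1: "measure_preserving_map N M1 fst"
    using \<phi>1 distr_distr[of fst "M1 \<Otimes>\<^sub>M M2" M1 \<phi> S]
    by (simp add: measure_preserving_map_iff_distr N_def comp_def \<phi>_def)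
  have 2: "measure_preserving_map N M2 snd"
    using \<phi>2 distr_distr[of snd "M1 \<Otimes>\<^sub>M M2" M2 \<phi> S]
    by (simp add: measure_preserving_map_iff_distr N_def comp_def \<phi>_def)
  let ?D = "\<lambda>x y. W1 (fst x) (fst y) - W2 (snd x) (snd y)"
  let ?D' = "\<lambda>x y. W1 (\<phi>1 x) (\<phi>1 y) - W2 (\<phi>2 x) (\<phi>2 y)"
  have D: "bounded_kernel N ?D"
    by (rule bounded_kernel_coupling[OF W1 W2 1 2])
  have D': "bounded_kernel S ?D'"
    by (rule bounded_kernel_coupling[OF W1 W2 \<phi>1 \<phi>2])
  have le: "cut_norm N ?D \<le> cut_norm S ?D'"
  proof (rule cut_norm_least)
    fix f g assume f: "test_function N f" and g: "test_function N g"
    have \<phi>': "\<phi> \<in> measurable S N" using \<phi>N by (simp add: measure_preserving_map_def)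
    have "cut_form N ?D f g = (\<integral>p. (\<lambda>(x, y). ?D x y * f x * g y) ((\<lambda>(x, y). (\<phi> x, \<phi> y)) p) \<partial>(S \<Otimes>\<^sub>M S))"
      unfolding cut_form_def
      using N.kernel_integrable[OF D f g]
      by (intro measure_preserving_integral[symmetric] measure_preserving_pair N \<phi>N) auto
    also have "\<dots> = cut_form S ?D' (\<lambda>x. f (\<phi> x)) (\<lambda>x. g (\<phi> x))"
      unfolding cut_form_def \<phi>_def by (rule Bochner_Integration.integral_cong) auto
    finally show "\<bar>cut_form N ?D f g\<bar> \<le> cut_norm S ?D'"
      using S.cut_norm_upper[OF D' test_function_comp[OF f \<phi>'] test_function_comp[OF g \<phi>']] by simp
  qed
  have "cut_dist M1 W1 M2 W2 \<le> cut_norm N ?D"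
    unfolding cut_dist_def
  proof (rule cInf_lower)
    show "bdd_below {cut_norm N (\<lambda>x y. W1 (\<phi>1 x) (\<phi>1 y) - W2 (\<phi>2 x) (\<phi>2 y)) | (N :: ('a \<times> 'b) measure) \<phi>1 \<phi>2.
            prob_space N \<and> measure_preserving_map N M1 \<phi>1 \<and> measure_preserving_map N M2 \<phi>2}"
      using prob_space.cut_norm_nonneg[OF _ bounded_kernel_coupling[OF W1 W2]]
      by (intro bdd_belowI[of _ 0]) auto
  qed (use N 1 2 in blast)
  then show ?thesis using le by simp
qed

text \<open>The product measure with its two projections is a coupling. The infimum is therefore
  over a nonempty set and can be approached.\<close>

lemma cut_dist_ex:
  fixes M1 :: "'a measure" and M2 :: "'b measure"
  assumes "prob_space M1" "prob_space M2" "cut_dist M1 W1 M2 W2 < c"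
  obtains N :: "('a \<times> 'b) measure" and \<phi>1 \<phi>2 where "prob_space N" "measure_preserving_map N M1 \<phi>1"
    "measure_preserving_map N M2 \<phi>2" "cut_norm N (\<lambda>x y. W1 (\<phi>1 x) (\<phi>1 y) - W2 (\<phi>2 x) (\<phi>2 y)) < c"
proof -
  interpret M1: prob_space M1 by fact
  interpret M2: prob_space M2 by fact
  interpret P: pair_prob_space M1 M2 ..
  have "prob_space (M1 \<Otimes>\<^sub>M M2)" by unfold_locales
  moreover have "measure_preserving_map (M1 \<Otimes>\<^sub>M M2) M1 fst"
    by (auto simp: measure_preserving_map_iff_distr M2.distr_pair_fst)
  moreover have "measure_preserving_map (M1 \<Otimes>\<^sub>M M2) M2 snd"
    unfolding measure_preserving_map_def
  proof (intro conjI ballI measurable_snd)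
    fix A assume A: "A \<in> sets M2"
    have "snd -` A \<inter> space (M1 \<Otimes>\<^sub>M M2) = space M1 \<times> A"
      using sets.sets_into_space[OF A] by (auto simp: space_pair_measure)
    then show "emeasure (M1 \<Otimes>\<^sub>M M2) (snd -` A \<inter> space (M1 \<Otimes>\<^sub>M M2)) = emeasure M2 A"
      using A by (simp add: M2.emeasure_pair_measure_Times M1.emeasure_space_1)
  qed
  ultimately have ne: "{cut_norm N (\<lambda>x y. W1 (\<phi>1 x) (\<phi>1 y) - W2 (\<phi>2 x) (\<phi>2 y)) | (N :: ('a \<times> 'b) measure) \<phi>1 \<phi>2.
            prob_space N \<and> measure_preserving_map N M1 \<phi>1 \<and> measure_preserving_map N M2 \<phi>2} \<noteq> {}" by blast
  from cInf_lessD[OF ne assms(3)[unfolded cut_dist_def]] show thesis using that by blast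
qed

lemma cut_dist_nonneg:
  fixes M1 :: "'a measure" and M2 :: "'b measure"
  assumes "prob_space M1" "prob_space M2" "bounded_kernel M1 W1" "bounded_kernel M2 W2"
  shows "0 \<le> cut_dist M1 W1 M2 W2"
proof (rule ccontr)
  assume "\<not> 0 \<le> cut_dist M1 W1 M2 W2"
  then have lt: "cut_dist M1 W1 M2 W2 < 0" by simp
  obtain N :: "('a \<times> 'b) measure" and \<phi>1 \<phi>2 where N: "prob_space N" "measure_preserving_map N M1 \<phi>1"
    "measure_preserving_map N M2 \<phi>2" "cut_norm N (\<lambda>x y. W1 (\<phi>1 x) (\<phi>1 y) - W2 (\<phi>2 x) (\<phi>2 y)) < 0"
    by (rule cut_dist_ex[OF assms(1,2) lt])
  have "bounded_kernel N (\<lambda>x y. W1 (\<phi>1 x) (\<phi>1 y) - W2 (\<phi>2 x) (\<phi>2 y))"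
    by (rule bounded_kernel_coupling[OF assms(3,4) N(2,3)])
  then show False using prob_space.cut_norm_nonneg[OF N(1)] N(4) by fastforce
qed

lemma cut_dist_commute_le:
  fixes M1 :: "'a measure" and M2 :: "'b measure"
  assumes "prob_space M1" "prob_space M2" "bounded_kernel M1 W1" "bounded_kernel M2 W2"
  shows "cut_dist M2 W2 M1 W1 \<le> cut_dist M1 W1 M2 W2"
proof (rule ccontr)
  assume "\<not> ?thesis"
  then have lt: "cut_dist M1 W1 M2 W2 < cut_dist M2 W2 M1 W1" by simp
  obtain N :: "('a \<times> 'b) measure" and \<phi>1 \<phi>2 where N: "prob_space N" "measure_preserving_map N M1 \<phi>1"
    "measure_preserving_map N M2 \<phi>2"
    "cut_norm N (\<lambda>x y. W1 (\<phi>1 x) (\<phi>1 y) - W2 (\<phi>2 x) (\<phi>2 y)) < cut_dist M2 W2 M1 W1"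
    by (rule cut_dist_ex[OF assms(1,2) lt])
  have "cut_dist M2 W2 M1 W1 \<le> cut_norm N (\<lambda>x y. W2 (\<phi>2 x) (\<phi>2 y) - W1 (\<phi>1 x) (\<phi>1 y))"
    using N assms by (intro cut_dist_le)
  also have "\<dots> = cut_norm N (\<lambda>x y. W1 (\<phi>1 x) (\<phi>1 y) - W2 (\<phi>2 x) (\<phi>2 y))"
    by (subst cut_norm_uminus[symmetric]) simp
  finally show False using N(4) by simp
qed

lemma cut_dist_commute:
  assumes "prob_space M1" "prob_space M2" "bounded_kernel M1 W1" "bounded_kernel M2 W2"
  shows "cut_dist M2 W2 M1 W1 = cut_dist M1 W1 M2 W2"
  using cut_dist_commute_le[OF assms] cut_dist_commute_le[of M2 M1 W2 W1] assms by fastforce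

section \<open>The triangle inequality for the cut distance\<close>

text \<open>Approximation in L1 by functions constant on the rectangles of a finite partition. The
  partition is encoded by a label with values in \<open>nat\<close>, the same one in both
  coordinates, because couplings are later glued along such a label.\<close>

definition step_approximable :: "'a measure \<Rightarrow> ('a \<times> 'a \<Rightarrow> real) \<Rightarrow> bool" where
  "step_approximable M f \<longleftrightarrow> (\<forall>e>0. \<exists>(\<pi> :: 'a \<Rightarrow> nat) w. \<pi> \<in> measurable M (count_space UNIV) \<and> finite (\<pi> ` space M) \<and>
     (\<integral>p. \<bar>f p - w (\<pi> (fst p)) (\<pi> (snd p))\<bar> \<partial>(M \<Otimes>\<^sub>M M)) < e)"

lemma bounded_kernel_step:
  fixes \<pi> :: "'a \<Rightarrow> nat" and w :: "nat \<Rightarrow> nat \<Rightarrow> real"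
  assumes \<pi>: "\<pi> \<in> measurable M (count_space UNIV)" "finite (\<pi> ` space M)"
  shows "bounded_kernel M (\<lambda>x y. w (\<pi> x) (\<pi> y))"
proof -
  have [measurable]: "\<pi> \<in> measurable M (count_space UNIV)" by fact
  have "(\<lambda>p. w (\<pi> (fst p)) (\<pi> (snd p))) \<in> borel_measurable (M \<Otimes>\<^sub>M M)"
    by (rule measurable_compose_countable[where g = "\<lambda>p. \<pi> (fst p)"],
        rule measurable_compose_countable[where g = "\<lambda>p. \<pi> (snd p)"]) measurable
  moreover define S where "S = (\<lambda>(i, j). \<bar>w i j\<bar>) ` ((\<pi> ` space M) \<times> (\<pi> ` space M))"
  have "\<bar>w (\<pi> x) (\<pi> y)\<bar> \<le> Max S" if "x \<in> space M" "y \<in> space M" for x y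
    using \<pi> that by (intro Max_ge) (auto simp: S_def)
  ultimately show ?thesis unfolding bounded_kernel_def by (auto simp: case_prod_beta')
qed

context prob_space
begin

lemma bounded_kernel_integrable:
  assumes "bounded_kernel M D"
  shows "integrable (M \<Otimes>\<^sub>M M) (\<lambda>p. D (fst p) (snd p))"
  using kernel_integrable[OF assms test_function_const[of 1] test_function_const[of 1]]
  by (simp add: case_prod_beta')

lemma step_approximable_lincomb:
  assumes f: "integrable (M \<Otimes>\<^sub>M M) f" "step_approximable M f"
    and g: "integrable (M \<Otimes>\<^sub>M M) g" "step_approximable M g"
  shows "step_approximable M (\<lambda>p. f p + c * g p)"
  unfolding step_approximable_def
proof (intro allI impI)
  fix e :: real assume e: "e > 0"
  \<comment> \<open>Chosen so that \<open>d + \<bar>c\<bar> * d\<close> equals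
    \<open>e / 2\<close>.\<close>
  define d where "d = e / (2 * (1 + \<bar>c\<bar>))"
  have d: "d > 0" "d \<le> e / 2" "\<bar>c\<bar> * d \<le> e / 2" using e by (auto simp: d_def field_simps)
  obtain \<pi>1 :: "'a \<Rightarrow> nat" and w1 where 1: "\<pi>1 \<in> measurable M (count_space UNIV)" "finite (\<pi>1 ` space M)"
     "(\<integral>p. \<bar>f p - w1 (\<pi>1 (fst p)) (\<pi>1 (snd p))\<bar> \<partial>(M \<Otimes>\<^sub>M M)) < d"
    using f(2) d(1) unfolding step_approximable_def by blast
  obtain \<pi>2 :: "'a \<Rightarrow> nat" and w2 where 2: "\<pi>2 \<in> measurable M (count_space UNIV)" "finite (\<pi>2 ` space M)"
     "(\<integral>p. \<bar>g p - w2 (\<pi>2 (fst p)) (\<pi>2 (snd p))\<bar> \<partial>(M \<Otimes>\<^sub>M M)) < d"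
    using g(2) d(1) unfolding step_approximable_def by blast
  \<comment> \<open>The common refinement of both partitions: the pair of labels, coded as one
    number.\<close>
  define \<pi> where "\<pi> x = prod_encode (\<pi>1 x, \<pi>2 x)" for x
  define w where "w i j = w1 (fst (prod_decode i)) (fst (prod_decode j))
      + c * w2 (snd (prod_decode i)) (snd (prod_decode j))" for i j
  have [measurable]: "\<pi>1 \<in> measurable M (count_space UNIV)" "\<pi>2 \<in> measurable M (count_space UNIV)"
    using 1 2 by auto
  have "\<pi> \<in> measurable M (count_space UNIV)" unfolding \<pi>_def by measurable
  moreover have "finite (\<pi> ` space M)"
    by (rule finite_subset[of _ "prod_encode ` ((\<pi>1 ` space M) \<times> (\<pi>2 ` space M))"])
       (use 1 2 in \<open>auto simp: \<pi>_def\<close>)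
  moreover have "(\<integral>p. \<bar>f p + c * g p - w (\<pi> (fst p)) (\<pi> (snd p))\<bar> \<partial>(M \<Otimes>\<^sub>M M)) < e"
  proof -
    let ?F = "\<lambda>p. f p - w1 (\<pi>1 (fst p)) (\<pi>1 (snd p))"
    let ?G = "\<lambda>p. g p - w2 (\<pi>2 (fst p)) (\<pi>2 (snd p))"
    have F: "integrable (M \<Otimes>\<^sub>M M) ?F"
      using f 1 by (intro Bochner_Integration.integrable_diff bounded_kernel_integrable bounded_kernel_step)
    have G: "integrable (M \<Otimes>\<^sub>M M) ?G"
      using g 2 by (intro Bochner_Integration.integrable_diff bounded_kernel_integrable bounded_kernel_step)
    have "(\<integral>p. \<bar>f p + c * g p - w (\<pi> (fst p)) (\<pi> (snd p))\<bar> \<partial>(M \<Otimes>\<^sub>M M))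
        = (\<integral>p. \<bar>?F p + c * ?G p\<bar> \<partial>(M \<Otimes>\<^sub>M M))"
      by (rule Bochner_Integration.integral_cong) (auto simp: w_def \<pi>_def algebra_simps)
    also have "\<dots> \<le> (\<integral>p. \<bar>?F p\<bar> + \<bar>c\<bar> * \<bar>?G p\<bar> \<partial>(M \<Otimes>\<^sub>M M))"
      using F G by (intro integral_mono) (auto intro: order_trans[OF abs_triangle_ineq] simp: abs_mult)
    also have "\<dots> = (\<integral>p. \<bar>?F p\<bar> \<partial>(M \<Otimes>\<^sub>M M)) + \<bar>c\<bar> * (\<integral>p. \<bar>?G p\<bar> \<partial>(M \<Otimes>\<^sub>M M))"
      using F G by (subst Bochner_Integration.integral_add) auto
    also have "\<dots> < d + \<bar>c\<bar> * d"
      using 1(3) 2(3) by (intro add_less_le_mono mult_left_mono) auto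
    also have "\<dots> \<le> e" using d by linarith
    finally show ?thesis .
  qed
  ultimately show "\<exists>(\<pi> :: 'a \<Rightarrow> nat) w. \<pi> \<in> measurable M (count_space UNIV) \<and> finite (\<pi> ` space M) \<and>
     (\<integral>p. \<bar>f p + c * g p - w (\<pi> (fst p)) (\<pi> (snd p))\<bar> \<partial>(M \<Otimes>\<^sub>M M)) < e" by blast
qed

lemma step_approximable_limit:
  assumes f: "integrable (M \<Otimes>\<^sub>M M) f" and s: "\<And>i. integrable (M \<Otimes>\<^sub>M M) (s i)" "\<And>i. step_approximable M (s i)"
    and lim: "\<And>p. p \<in> space (M \<Otimes>\<^sub>M M) \<Longrightarrow> (\<lambda>i. s i p) \<longlonglongrightarrow> f p"
    and bound: "\<And>i p. p \<in> space (M \<Otimes>\<^sub>M M) \<Longrightarrow> \<bar>s i p\<bar> \<le> h p" and h: "integrable (M \<Otimes>\<^sub>M M) h"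
  shows "step_approximable M f"
  unfolding step_approximable_def
proof (intro allI impI)
  fix e :: real assume e: "e > 0"
  have "(\<lambda>i. \<integral>p. \<bar>f p - s i p\<bar> \<partial>(M \<Otimes>\<^sub>M M)) \<longlonglongrightarrow> (\<integral>p. 0 \<partial>(M \<Otimes>\<^sub>M M))"
  proof (rule integral_dominated_convergence[where w = "\<lambda>p. \<bar>f p\<bar> + h p"])
    show "AE p in M \<Otimes>\<^sub>M M. (\<lambda>i. \<bar>f p - s i p\<bar>) \<longlonglongrightarrow> 0"
    proof (rule AE_I2)
      fix p assume "p \<in> space (M \<Otimes>\<^sub>M M)"
      from tendsto_rabs[OF tendsto_diff[OF tendsto_const lim[OF this], of "f p"]]
      show "(\<lambda>i. \<bar>f p - s i p\<bar>) \<longlonglongrightarrow> 0" by simp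
    qed
    show "AE p in M \<Otimes>\<^sub>M M. norm \<bar>f p - s i p\<bar> \<le> \<bar>f p\<bar> + h p" for i
      using bound[of _ i] by (intro AE_I2) (auto intro: order_trans[OF abs_triangle_ineq4])
  qed (use f s(1) h in auto)
  then have "eventually (\<lambda>i. (\<integral>p. \<bar>f p - s i p\<bar> \<partial>(M \<Otimes>\<^sub>M M)) < e / 2) sequentially"
    using e by (intro order_tendstoD(2)[where y = 0]) auto
  then obtain i where i: "(\<integral>p. \<bar>f p - s i p\<bar> \<partial>(M \<Otimes>\<^sub>M M)) < e / 2"
    by (auto simp: eventually_sequentially)
  obtain \<pi> :: "'a \<Rightarrow> nat" and w where 1: "\<pi> \<in> measurable M (count_space UNIV)" "finite (\<pi> ` space M)"
     "(\<integral>p. \<bar>s i p - w (\<pi> (fst p)) (\<pi> (snd p))\<bar> \<partial>(M \<Otimes>\<^sub>M M)) < e / 2"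
    using s(2)[of i] e unfolding step_approximable_def by (meson half_gt_zero)
  have I: "integrable (M \<Otimes>\<^sub>M M) (\<lambda>p. w (\<pi> (fst p)) (\<pi> (snd p)))"
    using 1 by (intro bounded_kernel_integrable bounded_kernel_step)
  have "(\<integral>p. \<bar>f p - w (\<pi> (fst p)) (\<pi> (snd p))\<bar> \<partial>(M \<Otimes>\<^sub>M M))
     \<le> (\<integral>p. \<bar>f p - s i p\<bar> + \<bar>s i p - w (\<pi> (fst p)) (\<pi> (snd p))\<bar> \<partial>(M \<Otimes>\<^sub>M M))"
    using f s(1) I by (intro integral_mono) auto
  also have "\<dots> = (\<integral>p. \<bar>f p - s i p\<bar> \<partial>(M \<Otimes>\<^sub>M M))
      + (\<integral>p. \<bar>s i p - w (\<pi> (fst p)) (\<pi> (snd p))\<bar> \<partial>(M \<Otimes>\<^sub>M M))"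
    using f s(1) I by (intro Bochner_Integration.integral_add) auto
  also have "\<dots> < e" using i 1(3) by simp
  finally show "\<exists>(\<pi> :: 'a \<Rightarrow> nat) w. \<pi> \<in> measurable M (count_space UNIV) \<and> finite (\<pi> ` space M) \<and>
     (\<integral>p. \<bar>f p - w (\<pi> (fst p)) (\<pi> (snd p))\<bar> \<partial>(M \<Otimes>\<^sub>M M)) < e" using 1 by blast
qed

lemma step_approximable_cong:
  assumes "step_approximable M f" "\<And>p. p \<in> space (M \<Otimes>\<^sub>M M) \<Longrightarrow> f p = g p"
  shows "step_approximable M g"
proof -
  have "(\<integral>p. \<bar>g p - w (\<pi> (fst p)) (\<pi> (snd p))\<bar> \<partial>(M \<Otimes>\<^sub>M M)) = (\<integral>p. \<bar>f p - w (\<pi> (fst p)) (\<pi> (snd p))\<bar> \<partial>(M \<Otimes>\<^sub>M M))"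
    for w and \<pi> :: "'a \<Rightarrow> nat"
    using assms(2) by (intro Bochner_Integration.integral_cong) auto
  then show ?thesis using assms(1) by (simp add: step_approximable_def)
qed

lemma step_approximable_step:
  fixes \<pi> :: "'a \<Rightarrow> nat"
  assumes "\<pi> \<in> measurable M (count_space UNIV)" "finite (\<pi> ` space M)"
  shows "step_approximable M (\<lambda>p. w (\<pi> (fst p)) (\<pi> (snd p)))"
  unfolding step_approximable_def
  using assms by (auto intro!: exI[of _ \<pi>] exI[of _ w])

text \<open>Induction from the rectangles, an intersection-stable generator of the product
  sigma-algebra. Complements are linear combinations, and countable disjoint unions are dominated
  limits of finite sums.\<close>

lemma step_approximable_indicator:
  assumes "A \<in> sets (M \<Otimes>\<^sub>M M)"
  shows "step_approximable M (indicator A)"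
proof -
  interpret P: prob_space "M \<Otimes>\<^sub>M M" by (rule pair_prob)
  have 1: "step_approximable M (\<lambda>p. c)" for c
    using step_approximable_step[of "\<lambda>_. 0" "\<lambda>_ _. c"] by (simp add: image_constant_conv)
  have int: "integrable (M \<Otimes>\<^sub>M M) (indicator A :: _ \<Rightarrow> real)" if "A \<in> sets (M \<Otimes>\<^sub>M M)" for A
    using that by (simp add: P.emeasure_eq_measure)
  have "A \<in> sigma_sets (space M \<times> space M) {a \<times> b | a b. a \<in> sets M \<and> b \<in> sets M}"
    using assms by (simp add: sets_pair_measure)
  with Int_stable_pair_measure_generator pair_measure_closed show ?thesis
  proof (induct rule: sigma_sets_induct_disjoint)
    case (basic A)
    then obtain a b where ab: "A = a \<times> b" and [measurable]: "a \<in> sets M" "b \<in> sets M" by blast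
    \<comment> \<open>Two binary digits: the label is odd exactly on \<open>a\<close> and at least 2
      exactly on \<open>b\<close>.\<close>
    define \<pi> :: "'a \<Rightarrow> nat" where "\<pi> x = (if x \<in> a then 1 else 0) + (if x \<in> b then 2 else 0)" for x
    have m: "\<pi> \<in> measurable M (count_space UNIV)" unfolding \<pi>_def by measurable
    have fin: "finite (\<pi> ` space M)"
      by (rule finite_subset[of _ "{0, 1, 2, 3}"]) (auto simp: \<pi>_def split: if_splits)
    have "indicator A p = (if odd (\<pi> (fst p)) \<and> 2 \<le> \<pi> (snd p) then 1 else 0 :: real)" for p
      by (cases p) (auto simp: ab \<pi>_def indicator_def)
    then show ?case
      using step_approximable_step[OF m fin, of "\<lambda>i j. if odd i \<and> 2 \<le> j then 1 else 0"]
      by (rule_tac step_approximable_cong) auto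
  next
    case empty
    then show ?case using 1[of 0] by (simp add: indicator_def[abs_def])
  next
    case (compl A)
    then have A: "A \<in> sets (M \<Otimes>\<^sub>M M)" by (simp add: sets_pair_measure)
    have "step_approximable M (\<lambda>p. 1 + (- 1) * indicator A p)"
      using compl A by (intro step_approximable_lincomb int 1) auto
    then show ?case
      by (rule step_approximable_cong) (auto simp: indicator_def space_pair_measure)
  next
    case (union A)
    then have A[measurable]: "A i \<in> sets (M \<Otimes>\<^sub>M M)" for i by (auto simp: sets_pair_measure)
    define s where "s n p = (indicator (\<Union>i<n. A i) p :: real)" for n p
    have s: "s (Suc n) p = s n p + 1 * indicator (A n) p" for n p
      using \<open>disjoint_family A\<close>
      by (auto simp: s_def indicator_def lessThan_Suc disjoint_family_on_def) (metis IntI empty_iff nat_neq_iff)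
    have si: "integrable (M \<Otimes>\<^sub>M M) (s n)" for n
      unfolding s_def[abs_def] by (intro int[of "\<Union>i<n. A i", unfolded indicator_def[abs_def]] int) auto
    have sa: "step_approximable M (s n)" for n
    proof (induction n)
      case 0
      then show ?case using 1[of 0] by (simp add: s_def[abs_def])
    next
      case (Suc n)
      have "step_approximable M (\<lambda>p. s n p + 1 * indicator (A n) p)"
        using Suc si union(3) A by (intro step_approximable_lincomb int) auto
      then show ?case by (simp add: s[abs_def])
    qed
    show ?case
    proof (rule step_approximable_limit[where s = s and h = "\<lambda>_. 1"])
      show "integrable (M \<Otimes>\<^sub>M M) (indicator (\<Union> (range A)) :: _ \<Rightarrow> real)" by (rule int) auto
      show "(\<lambda>n. s n p) \<longlonglongrightarrow> indicator (\<Union> (range A)) p" for p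
        unfolding s_def by (rule LIMSEQ_indicator_UN)
    qed (use si sa in \<open>auto simp: s_def indicator_def\<close>)
  qed
qed

lemma step_approximable_integrable:
  assumes "integrable (M \<Otimes>\<^sub>M M) f"
  shows "step_approximable M f"
  using assms
proof (induct rule: integrable_induct)
  case (base A c)
  have 1: "step_approximable M (\<lambda>p. 0)"
    using step_approximable_step[of "\<lambda>_. 0" "\<lambda>_ _. 0"] by (simp add: image_constant_conv)
  have "step_approximable M (\<lambda>p. 0 + c * indicator A p)"
    using base 1 by (intro step_approximable_lincomb step_approximable_indicator) auto
  then show ?case by (simp add: mult.commute)
next
  case (add f g)
  then show ?case using step_approximable_lincomb[of f g 1] by simp
next
  case (lim f s)
  then show ?case
    by (intro step_approximable_limit[of f s "\<lambda>p. 2 * \<bar>f p\<bar>"]) auto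
qed

end

text \<open>\<open>F\<close> plays the part of the conditional expectation of \<open>f\<close> given
  \<rho>, described by its integrals against bounded functions of \<rho>. Being a test function
  again, it respects the bound 1.\<close>

definition transfers_test_functions :: "'a measure \<Rightarrow> ('a \<Rightarrow> 'b) \<Rightarrow> 'b measure \<Rightarrow> bool" where
  "transfers_test_functions N \<rho> M \<longleftrightarrow> (\<forall>f. test_function N f \<longrightarrow> (\<exists>F. test_function M F \<and>
     (\<forall>h C. h \<in> borel_measurable M \<longrightarrow> (\<forall>x\<in>space M. \<bar>h x\<bar> \<le> C) \<longrightarrow>
        (\<integral>s. h (\<rho> s) * f s \<partial>N) = (\<integral>x. h x * F x \<partial>M))))"

text \<open>A pull-back has more test functions than the original, so its norm could be larger.
  Integrating one variable at a time, each test function on \<open>N\<close> only meets functions of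
  \<rho> and can be replaced by its counterpart on \<open>M\<close>.\<close>

lemma cut_norm_transfer_le:
  assumes N: "prob_space N" and M: "prob_space M" and \<rho>: "\<rho> \<in> measurable N M"
    and t: "transfers_test_functions N \<rho> M" and D: "bounded_kernel M D"
  shows "cut_norm N (\<lambda>x y. D (\<rho> x) (\<rho> y)) \<le> cut_norm M D"
proof (rule cut_norm_least)
  interpret N: prob_space N by fact
  interpret M: prob_space M by fact
  fix f g assume f: "test_function N f" and g: "test_function N g"
  obtain F where F: "test_function M F" "\<And>h C. h \<in> borel_measurable M \<Longrightarrow> (\<And>x. x \<in> space M \<Longrightarrow> \<bar>h x\<bar> \<le> C) \<Longrightarrow>
        (\<integral>s. h (\<rho> s) * f s \<partial>N) = (\<integral>x. h x * F x \<partial>M)"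
    using t f unfolding transfers_test_functions_def by metis
  obtain G where G: "test_function M G" "\<And>h C. h \<in> borel_measurable M \<Longrightarrow> (\<And>x. x \<in> space M \<Longrightarrow> \<bar>h x\<bar> \<le> C) \<Longrightarrow>
        (\<integral>s. h (\<rho> s) * g s \<partial>N) = (\<integral>x. h x * G x \<partial>M)"
    using t g unfolding transfers_test_functions_def by metis
  obtain C where C: "C \<ge> 0" "\<And>x y. x \<in> space M \<Longrightarrow> y \<in> space M \<Longrightarrow> \<bar>D x y\<bar> \<le> C"
    and [measurable]: "(\<lambda>(x, y). D x y) \<in> borel_measurable (M \<Otimes>\<^sub>M M)"
    using bounded_kernelE[OF D] by metis
  have [measurable]: "G \<in> borel_measurable M" using G by (simp add: test_function_def)
  have h: "(\<lambda>x. \<integral>y. D x y * G y \<partial>M) \<in> borel_measurable M" by measurable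
  have hC: "\<bar>\<integral>y. D x y * G y \<partial>M\<bar> \<le> C" if "x \<in> space M" for x
  proof (rule M.abs_integral_bounded_le[OF _ C(1)])
    fix y assume "y \<in> space M"
    then have "\<bar>D x y\<bar> * \<bar>G y\<bar> \<le> C * 1"
      using that C G(1) by (intro mult_mono) (auto simp: test_function_def)
    then show "\<bar>D x y * G y\<bar> \<le> C" by (simp add: abs_mult)
  qed
  have "cut_form N (\<lambda>x y. D (\<rho> x) (\<rho> y)) f g = (\<integral>s. (\<integral>t. D (\<rho> s) (\<rho> t) * g t \<partial>N) * f s \<partial>N)"
    using f g by (intro N.cut_form_iterated bounded_kernel_comp[OF D \<rho>])
  also have "\<dots> = (\<integral>s. (\<integral>y. D (\<rho> s) y * G y \<partial>M) * f s \<partial>N)"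
  proof (rule Bochner_Integration.integral_cong)
    fix s assume "s \<in> space N"
    then have s: "\<rho> s \<in> space M" using \<rho> by (rule_tac measurable_space)
    have [measurable]: "(\<lambda>y. D (\<rho> s) y) \<in> borel_measurable M"
      using measurable_compose[OF measurable_Pair1'[OF s] \<open>(\<lambda>(x, y). D x y) \<in> borel_measurable (M \<Otimes>\<^sub>M M)\<close>]
      by simp
    show "(\<integral>t. D (\<rho> s) (\<rho> t) * g t \<partial>N) * f s = (\<integral>y. D (\<rho> s) y * G y \<partial>M) * f s"
      using G(2)[of "\<lambda>y. D (\<rho> s) y" C] C(2)[OF s] by simp
  qed simp
  also have "\<dots> = (\<integral>x. (\<integral>y. D x y * G y \<partial>M) * F x \<partial>M)"
    by (rule F(2)[OF h hC])
  also have "\<dots> = cut_form M D F G"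
    using F G by (intro M.cut_form_iterated[symmetric] D)
  finally show "\<bar>cut_form N (\<lambda>x y. D (\<rho> x) (\<rho> y)) f g\<bar> \<le> cut_norm M D"
    using M.cut_norm_upper[OF D F(1) G(1)] by simp
qed

text \<open>With a density the conditional expectation is the explicit integral of
  \<open>q * f\<close> over the second coordinate, and the bound \<open>q1\<close> on the rows keeps
  it within 1. The statement integrates against \<open>q\<close> over the product instead of naming
  the density measure, so that it also serves the second projection after a swap.\<close>

lemma density_integral_fst:
  fixes q f :: "'a \<times> 'b \<Rightarrow> real"
  assumes N: "prob_space N1" "prob_space N2"
    and q[measurable]: "q \<in> borel_measurable (N1 \<Otimes>\<^sub>M N2)"
    and q0: "\<And>p. 0 \<le> q p" and qB: "\<And>p. p \<in> space (N1 \<Otimes>\<^sub>M N2) \<Longrightarrow> q p \<le> B"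
    and q1: "\<And>x. x \<in> space N1 \<Longrightarrow> (\<integral>t. q (x, t) \<partial>N2) \<le> 1"
    and f[measurable]: "f \<in> borel_measurable (N1 \<Otimes>\<^sub>M N2)" and f1: "\<And>p. p \<in> space (N1 \<Otimes>\<^sub>M N2) \<Longrightarrow> \<bar>f p\<bar> \<le> 1"
  shows "\<exists>F. test_function N1 F \<and>
     (\<forall>h C. h \<in> borel_measurable N1 \<longrightarrow> (\<forall>x\<in>space N1. \<bar>h x\<bar> \<le> C) \<longrightarrow>
        (\<integral>p. q p * (h (fst p) * f p) \<partial>(N1 \<Otimes>\<^sub>M N2)) = (\<integral>x. h x * F x \<partial>N1))"
proof (intro exI conjI allI impI)
  interpret N1: prob_space N1 by fact
  interpret N2: prob_space N2 by fact
  interpret P: pair_prob_space N1 N2 ..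
  interpret P: prob_space "N1 \<Otimes>\<^sub>M N2" by unfold_locales
  define F where "F x = (\<integral>t. q (x, t) * f (x, t) \<partial>N2)" for x
  have "\<bar>F x\<bar> \<le> 1" if x: "x \<in> space N1" for x
  proof -
    have [measurable]: "(\<lambda>t. q (x, t)) \<in> borel_measurable N2" "(\<lambda>t. f (x, t)) \<in> borel_measurable N2"
      using measurable_compose[OF measurable_Pair1'[OF x] q] measurable_compose[OF measurable_Pair1'[OF x] f] by auto
    have le: "\<bar>q (x, t) * f (x, t)\<bar> \<le> q (x, t)" if "t \<in> space N2" for t
      using f1[of "(x, t)"] q0[of "(x, t)"] x that
      by (simp add: space_pair_measure abs_mult mult_left_le)
    have i: "integrable N2 (\<lambda>t. q (x, t))"
      using qB q0 x by (intro N2.integrable_bounded[where C = B]) (auto simp: space_pair_measure)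
    have "\<bar>F x\<bar> \<le> (\<integral>t. \<bar>q (x, t) * f (x, t)\<bar> \<partial>N2)"
      unfolding F_def using integral_norm_bound[of N2 "\<lambda>t. q (x, t) * f (x, t)"] by simp
    also have "\<dots> \<le> (\<integral>t. q (x, t) \<partial>N2)"
      by (rule integral_mono_AE'[OF i]) (use le q0 in auto)
    finally show ?thesis using q1[OF x] by simp
  qed
  moreover have "F \<in> borel_measurable N1" unfolding F_def[abs_def] by measurable
  ultimately show "test_function N1 F" unfolding test_function_def by blast
  fix h :: "'a \<Rightarrow> real" and C assume h[measurable]: "h \<in> borel_measurable N1" and C: "\<forall>x\<in>space N1. \<bar>h x\<bar> \<le> C"
  have "\<bar>q p * (h (fst p) * f p)\<bar> \<le> B * (C * 1)" if p: "p \<in> space (N1 \<Otimes>\<^sub>M N2)" for p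
  proof -
    have C': "\<bar>h (fst p)\<bar> \<le> C" using C p by (auto simp: space_pair_measure)
    then have "\<bar>q p\<bar> * (\<bar>h (fst p)\<bar> * \<bar>f p\<bar>) \<le> B * (C * 1)"
      using qB[OF p] q0[of p] f1[OF p]
      by (intro mult_mono) (auto intro: order_trans[OF abs_ge_zero])
    then show ?thesis by (simp add: abs_mult)
  qed
  then have "integrable (N1 \<Otimes>\<^sub>M N2) (\<lambda>p. q p * (h (fst p) * f p))"
    by (intro P.integrable_bounded[where C = "B * (C * 1)"]) auto
  from P.integral_fst'[OF this]
  have "(\<integral>p. q p * (h (fst p) * f p) \<partial>(N1 \<Otimes>\<^sub>M N2)) = (\<integral>x. (\<integral>t. h x * (q (x, t) * f (x, t)) \<partial>N2) \<partial>N1)"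
    by (simp add: ac_simps)
  also have "\<dots> = (\<integral>x. h x * F x \<partial>N1)" by (simp add: F_def)
  finally show "(\<integral>p. q p * (h (fst p) * f p) \<partial>(N1 \<Otimes>\<^sub>M N2)) = (\<integral>x. h x * F x \<partial>N1)" .
qed

lemma density_transfers_fst:
  fixes q :: "'a \<times> 'b \<Rightarrow> real"
  assumes N: "prob_space N1" "prob_space N2"
    and q[measurable]: "q \<in> borel_measurable (N1 \<Otimes>\<^sub>M N2)"
    and q0: "\<And>p. 0 \<le> q p" and qB: "\<And>p. p \<in> space (N1 \<Otimes>\<^sub>M N2) \<Longrightarrow> q p \<le> B"
    and q1: "\<And>x. x \<in> space N1 \<Longrightarrow> (\<integral>t. q (x, t) \<partial>N2) \<le> 1"
  shows "transfers_test_functions (density (N1 \<Otimes>\<^sub>M N2) q) fst N1"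
  unfolding transfers_test_functions_def
proof (intro allI impI)
  fix f assume "test_function (density (N1 \<Otimes>\<^sub>M N2) q) f"
  then have f[measurable]: "f \<in> borel_measurable (N1 \<Otimes>\<^sub>M N2)" and f1: "\<And>p. p \<in> space (N1 \<Otimes>\<^sub>M N2) \<Longrightarrow> \<bar>f p\<bar> \<le> 1"
    by (auto simp: test_function_def)
  have eq: "(\<integral>s. h (fst s) * f s \<partial>(density (N1 \<Otimes>\<^sub>M N2) q)) = (\<integral>p. q p * (h (fst p) * f p) \<partial>(N1 \<Otimes>\<^sub>M N2))"
    if [measurable]: "h \<in> borel_measurable N1" for h
    by (subst integral_density) (auto simp: q0)
  obtain F where "test_function N1 F" "\<forall>h C. h \<in> borel_measurable N1 \<longrightarrow> (\<forall>x\<in>space N1. \<bar>h x\<bar> \<le> C) \<longrightarrow>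
        (\<integral>p. q p * (h (fst p) * f p) \<partial>(N1 \<Otimes>\<^sub>M N2)) = (\<integral>x. h x * F x \<partial>N1)"
    using density_integral_fst[OF assms f f1] by blast
  then show "\<exists>F. test_function N1 F \<and>
     (\<forall>h C. h \<in> borel_measurable N1 \<longrightarrow> (\<forall>x\<in>space N1. \<bar>h x\<bar> \<le> C) \<longrightarrow>
        (\<integral>s. h (fst s) * f s \<partial>(density (N1 \<Otimes>\<^sub>M N2) q)) = (\<integral>x. h x * F x \<partial>N1))"
    using eq by (intro exI[of _ F]) simp
qed

lemma density_transfers_snd:
  fixes q :: "'a \<times> 'b \<Rightarrow> real"
  assumes N: "prob_space N1" "prob_space N2"
    and q[measurable]: "q \<in> borel_measurable (N1 \<Otimes>\<^sub>M N2)"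
    and q0: "\<And>p. 0 \<le> q p" and qB: "\<And>p. p \<in> space (N1 \<Otimes>\<^sub>M N2) \<Longrightarrow> q p \<le> B"
    and q1: "\<And>t. t \<in> space N2 \<Longrightarrow> (\<integral>x. q (x, t) \<partial>N1) \<le> 1"
  shows "transfers_test_functions (density (N1 \<Otimes>\<^sub>M N2) q) snd N2"
  unfolding transfers_test_functions_def
proof (intro allI impI)
  interpret N1: prob_space N1 by fact
  interpret N2: prob_space N2 by fact
  interpret P: pair_sigma_finite N1 N2 ..
  fix f assume "test_function (density (N1 \<Otimes>\<^sub>M N2) q) f"
  then have f[measurable]: "f \<in> borel_measurable (N1 \<Otimes>\<^sub>M N2)" and f1: "\<And>p. p \<in> space (N1 \<Otimes>\<^sub>M N2) \<Longrightarrow> \<bar>f p\<bar> \<le> 1"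
    by (auto simp: test_function_def)
  define q' f' where "q' p = q (snd p, fst p)" and "f' p = f (snd p, fst p)" for p
  have [measurable]: "q' \<in> borel_measurable (N2 \<Otimes>\<^sub>M N1)" "f' \<in> borel_measurable (N2 \<Otimes>\<^sub>M N1)"
    unfolding q'_def f'_def by measurable
  have eq: "(\<integral>s. h (snd s) * f s \<partial>(density (N1 \<Otimes>\<^sub>M N2) q)) = (\<integral>p. q' p * (h (fst p) * f' p) \<partial>(N2 \<Otimes>\<^sub>M N1))"
    if [measurable]: "h \<in> borel_measurable N2" for h
  proof -
    have "(\<integral>s. h (snd s) * f s \<partial>(density (N1 \<Otimes>\<^sub>M N2) q)) = (\<integral>p. q p * (h (snd p) * f p) \<partial>(N1 \<Otimes>\<^sub>M N2))"
      by (subst integral_density) (auto simp: q0)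
    also have "\<dots> = (\<integral>p. q' p * (h (fst p) * f' p) \<partial>(N2 \<Otimes>\<^sub>M N1))"
      by (subst P.integral_product_swap[symmetric]) (auto simp: q'_def f'_def case_prod_beta')
    finally show ?thesis .
  qed
  have "\<exists>F. test_function N2 F \<and>
     (\<forall>h C. h \<in> borel_measurable N2 \<longrightarrow> (\<forall>x\<in>space N2. \<bar>h x\<bar> \<le> C) \<longrightarrow>
        (\<integral>p. q' p * (h (fst p) * f' p) \<partial>(N2 \<Otimes>\<^sub>M N1)) = (\<integral>x. h x * F x \<partial>N2))"
    by (rule density_integral_fst[where B = B])
       (use N q0 qB q1 f1 in \<open>auto simp: q'_def f'_def space_pair_measure\<close>)
  then obtain F where "test_function N2 F" "\<forall>h C. h \<in> borel_measurable N2 \<longrightarrow> (\<forall>x\<in>space N2. \<bar>h x\<bar> \<le> C) \<longrightarrow>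
        (\<integral>p. q' p * (h (fst p) * f' p) \<partial>(N2 \<Otimes>\<^sub>M N1)) = (\<integral>x. h x * F x \<partial>N2)"
    by blast
  then show "\<exists>F. test_function N2 F \<and>
     (\<forall>h C. h \<in> borel_measurable N2 \<longrightarrow> (\<forall>x\<in>space N2. \<bar>h x\<bar> \<le> C) \<longrightarrow>
        (\<integral>s. h (snd s) * f s \<partial>(density (N1 \<Otimes>\<^sub>M N2) q)) = (\<integral>x. h x * F x \<partial>N2))"
    using eq by (intro exI[of _ F]) simp
qed


text \<open>The marginal is demanded only almost everywhere because the gluing density is 0 on label
  classes of measure zero.\<close>

lemma density_preserving_fst:
  fixes q :: "'a \<times> 'b \<Rightarrow> ennreal"
  assumes N: "prob_space N1" "prob_space N2"
    and q[measurable]: "q \<in> borel_measurable (N1 \<Otimes>\<^sub>M N2)"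
    and q1: "AE x in N1. (\<integral>\<^sup>+t. q (x, t) \<partial>N2) = 1"
  shows "measure_preserving_map (density (N1 \<Otimes>\<^sub>M N2) q) N1 fst"
  unfolding measure_preserving_map_def
proof (intro conjI ballI)
  interpret N1: prob_space N1 by fact
  interpret N2: prob_space N2 by fact
  interpret P: pair_sigma_finite N1 N2 ..
  show "fst \<in> measurable (density (N1 \<Otimes>\<^sub>M N2) q) N1" by simp
  fix A assume A[measurable]: "A \<in> sets N1"
  have "emeasure (density (N1 \<Otimes>\<^sub>M N2) q) (fst -` A \<inter> space (density (N1 \<Otimes>\<^sub>M N2) q))
     = (\<integral>\<^sup>+p. q p * indicator A (fst p) \<partial>(N1 \<Otimes>\<^sub>M N2))"
    by (subst emeasure_density) (auto intro!: nn_integral_cong simp: indicator_def)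
  also have "\<dots> = (\<integral>\<^sup>+x. (\<integral>\<^sup>+t. q (x, t) * indicator A x \<partial>N2) \<partial>N1)"
    by (subst N2.nn_integral_fst[symmetric]) auto
  also have "\<dots> = (\<integral>\<^sup>+x. indicator A x \<partial>N1)"
    using q1 by (intro nn_integral_cong_AE) (auto simp: nn_integral_multc)
  finally show "emeasure (density (N1 \<Otimes>\<^sub>M N2) q) (fst -` A \<inter> space (density (N1 \<Otimes>\<^sub>M N2) q)) = emeasure N1 A"
    by simp
qed

lemma density_preserving_snd:
  fixes q :: "'a \<times> 'b \<Rightarrow> ennreal"
  assumes N: "prob_space N1" "prob_space N2"
    and q[measurable]: "q \<in> borel_measurable (N1 \<Otimes>\<^sub>M N2)"
    and q1: "AE t in N2. (\<integral>\<^sup>+x. q (x, t) \<partial>N1) = 1"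
  shows "measure_preserving_map (density (N1 \<Otimes>\<^sub>M N2) q) N2 snd"
  unfolding measure_preserving_map_def
proof (intro conjI ballI)
  interpret N1: prob_space N1 by fact
  interpret N2: prob_space N2 by fact
  interpret P: pair_sigma_finite N1 N2 ..
  show "snd \<in> measurable (density (N1 \<Otimes>\<^sub>M N2) q) N2" by simp
  fix A assume A[measurable]: "A \<in> sets N2"
  have "emeasure (density (N1 \<Otimes>\<^sub>M N2) q) (snd -` A \<inter> space (density (N1 \<Otimes>\<^sub>M N2) q))
     = (\<integral>\<^sup>+p. q p * indicator A (snd p) \<partial>(N1 \<Otimes>\<^sub>M N2))"
    by (subst emeasure_density) (auto intro!: nn_integral_cong simp: indicator_def)
  also have "\<dots> = (\<integral>\<^sup>+t. (\<integral>\<^sup>+x. q (x, t) * indicator A t \<partial>N1) \<partial>N2)"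
    by (subst P.nn_integral_snd[symmetric]) auto
  also have "\<dots> = (\<integral>\<^sup>+x. indicator A x \<partial>N2)"
  proof (rule nn_integral_cong_AE)
    show "AE t in N2. (\<integral>\<^sup>+x. q (x, t) * indicator A t \<partial>N1) = indicator A t"
      using q1 AE_space
    proof eventually_elim
      case (elim t)
      then have [measurable]: "(\<lambda>x. q (x, t)) \<in> borel_measurable N1"
        using measurable_compose[OF measurable_Pair2' q] by auto
      show ?case using elim by (simp add: nn_integral_multc)
    qed
  qed
  finally show "emeasure (density (N1 \<Otimes>\<^sub>M N2) q) (snd -` A \<inter> space (density (N1 \<Otimes>\<^sub>M N2) q)) = emeasure N2 A"
    by simp
qed

text \<open>There are countably many labels, so the classes of measure zero together form a null
  set.\<close>

lemma AE_finite_label_positive: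
  fixes \<alpha> :: "'a \<Rightarrow> nat"
  assumes "prob_space N" and [measurable]: "\<alpha> \<in> measurable N (count_space UNIV)"
  shows "AE x in N. measure N {y \<in> space N. \<alpha> y = \<alpha> x} \<noteq> 0"
proof -
  interpret prob_space N by fact
  have "AE x in N. \<forall>i. measure N {y \<in> space N. \<alpha> y = i} = 0 \<longrightarrow> \<alpha> x \<noteq> i"
    unfolding AE_all_countable
  proof (intro allI)
    fix i
    show "AE x in N. measure N {y \<in> space N. \<alpha> y = i} = 0 \<longrightarrow> \<alpha> x \<noteq> i"
    proof (cases "measure N {y \<in> space N. \<alpha> y = i} = 0")
      case True
      then have "{y \<in> space N. \<alpha> y = i} \<in> null_sets N"
        by (auto simp: null_sets_def emeasure_eq_measure)
      then show ?thesis by (auto dest!: AE_not_in)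
    qed simp
  qed
  then show ?thesis by eventually_elim auto
qed

text \<open>Two spaces with the same law of a finite label are glued conditionally independently given the
  label; the density is explicit, so that no disintegration is needed.\<close>

lemma gluing:
  fixes \<alpha> :: "'a \<Rightarrow> nat" and \<beta> :: "'b \<Rightarrow> nat"
  assumes N1: "prob_space N1" and N2: "prob_space N2"
    and \<alpha>: "\<alpha> \<in> measurable N1 (count_space UNIV)" "finite (\<alpha> ` space N1)"
    and \<beta>: "\<beta> \<in> measurable N2 (count_space UNIV)"
    and eq: "\<And>i. measure N1 {x \<in> space N1. \<alpha> x = i} = measure N2 {x \<in> space N2. \<beta> x = i}"
  obtains N :: "('a \<times> 'b) measure" where "prob_space N"
    "measure_preserving_map N N1 fst" "measure_preserving_map N N2 snd"
    "transfers_test_functions N fst N1" "transfers_test_functions N snd N2"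
    "AE p in N. \<alpha> (fst p) = \<beta> (snd p)"
proof -
  interpret N1: prob_space N1 by fact
  interpret N2: prob_space N2 by fact
  have [measurable]: "\<alpha> \<in> measurable N1 (count_space UNIV)" "\<beta> \<in> measurable N2 (count_space UNIV)" by fact+
  define P where "P i = measure N1 {x \<in> space N1. \<alpha> x = i}" for i
  \<comment> \<open>On each pair of classes with equal label i this is the product measure rescaled
    to total mass \<open>P i\<close>. For a class of measure zero \<open>inverse 0 = 0\<close> makes
    the density vanish.\<close>
  define q :: "'a \<times> 'b \<Rightarrow> real" where "q p = (if \<alpha> (fst p) = \<beta> (snd p) then inverse (P (\<alpha> (fst p))) else 0)" for p
  have q[measurable]: "q \<in> borel_measurable (N1 \<Otimes>\<^sub>M N2)" unfolding q_def[abs_def]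
    by (rule measurable_compose_countable[where g = "\<lambda>p. \<alpha> (fst p)" and f = "\<lambda>i p. if i = \<beta> (snd p) then inverse (P i) else 0"])
       measurable
  have P0: "0 \<le> P i" for i by (simp add: P_def)
  have q0: "0 \<le> q p" for p by (simp add: q_def P0)
  \<comment> \<open>Finitely many labels occur, so the density is bounded and the integrals against
    it exist.\<close>
  define B where "B = Max (insert 0 ((\<lambda>i. inverse (P i)) ` (\<alpha> ` space N1)))"
  have qB: "q p \<le> B" if "p \<in> space (N1 \<Otimes>\<^sub>M N2)" for p
  proof -
    have "inverse (P (\<alpha> (fst p))) \<in> (\<lambda>i. inverse (P i)) ` (\<alpha> ` space N1)"
      using that by (intro imageI) (auto simp: space_pair_measure)
    then show ?thesis
      unfolding B_def using \<alpha>(2) by (intro Max_ge) (auto simp: q_def)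
  qed
  have q1: "(\<integral>t. q (x, t) \<partial>N2) = inverse (P (\<alpha> x)) * P (\<alpha> x)" for x
  proof -
    have "(\<integral>t. q (x, t) \<partial>N2) = (\<integral>t. inverse (P (\<alpha> x)) * indicator {t \<in> space N2. \<beta> t = \<alpha> x} t \<partial>N2)"
      by (rule Bochner_Integration.integral_cong) (auto simp: q_def indicator_def)
    then show ?thesis by (simp add: P_def eq)
  qed
  have q2: "(\<integral>x. q (x, t) \<partial>N1) = inverse (P (\<beta> t)) * P (\<beta> t)" for t
  proof -
    have "(\<integral>x. q (x, t) \<partial>N1) = (\<integral>x. inverse (P (\<beta> t)) * indicator {x \<in> space N1. \<alpha> x = \<beta> t} x \<partial>N1)"
      by (rule Bochner_Integration.integral_cong) (auto simp: q_def indicator_def)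
    then show ?thesis by (simp add: P_def)
  qed
  have le1: "inverse (P i) * P i \<le> 1" for i by (cases "P i = 0") auto
  define N where "N = density (N1 \<Otimes>\<^sub>M N2) (\<lambda>p. ennreal (q p))"
  have fst: "measure_preserving_map N N1 fst"
    unfolding N_def
  proof (rule density_preserving_fst[OF N1 N2])
    show "AE x in N1. (\<integral>\<^sup>+t. ennreal (q (x, t)) \<partial>N2) = 1"
      using AE_finite_label_positive[OF N1 \<alpha>(1)] AE_space
    proof eventually_elim
      case (elim x)
      have "(\<lambda>t. q (x, t)) \<in> borel_measurable N2"
        using measurable_compose[OF measurable_Pair1' q] elim by auto
      then have "integrable N2 (\<lambda>t. q (x, t))"
        using qB q0 elim by (intro N2.integrable_bounded[where C = B]) (auto simp: space_pair_measure)
      then show ?case using elim by (simp add: nn_integral_eq_integral q0 q1) (simp add: P_def)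
    qed
  qed measurable
  have snd: "measure_preserving_map N N2 snd"
    unfolding N_def
  proof (rule density_preserving_snd[OF N1 N2])
    show "AE t in N2. (\<integral>\<^sup>+x. ennreal (q (x, t)) \<partial>N1) = 1"
      using AE_finite_label_positive[OF N2 \<beta>] AE_space
    proof eventually_elim
      case (elim t)
      have "(\<lambda>x. q (x, t)) \<in> borel_measurable N1"
        using measurable_compose[OF measurable_Pair2' q] elim by auto
      then have "integrable N1 (\<lambda>x. q (x, t))"
        using qB q0 elim by (intro N1.integrable_bounded[where C = B]) (auto simp: space_pair_measure)
      then show ?case using elim by (simp add: nn_integral_eq_integral q0 q2) (simp add: P_def eq)
    qed
  qed measurable
  have "emeasure N (space N) = 1"
  proof -
    have "emeasure N (fst -` space N1 \<inter> space N) = emeasure N1 (space N1)"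
      using fst by (auto simp: measure_preserving_map_def)
    moreover have "fst -` space N1 \<inter> space N = space N" by (auto simp: N_def space_pair_measure)
    ultimately show ?thesis by (simp add: N1.emeasure_space_1)
  qed
  then have "prob_space N" by (rule prob_spaceI)
  moreover have "transfers_test_functions N fst N1" unfolding N_def
    using density_transfers_fst[OF N1 N2 q q0 qB] q1 le1 by simp
  moreover have "transfers_test_functions N snd N2" unfolding N_def
    using density_transfers_snd[OF N1 N2 q q0 qB] q2 le1 by simp
  moreover have "AE p in N. \<alpha> (fst p) = \<beta> (snd p)"
    unfolding N_def by (subst AE_density, measurable) (auto simp: q_def)
  ultimately show thesis using fst snd that by blast
qed

section \<open>The triangle inequality by way of step kernels\<close>

lemma cut_form_cong_AE:
  assumes N: "prob_space N" and D: "bounded_kernel N D" "bounded_kernel N E"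
    and f: "test_function N f" and g: "test_function N g"
    and AE: "AE x in N. AE y in N. D x y = E x y"
  shows "cut_form N D f g = cut_form N E f g"
proof -
  interpret prob_space N by fact
  have [measurable]: "(\<lambda>(x, y). D x y) \<in> borel_measurable (N \<Otimes>\<^sub>M N)" "(\<lambda>(x, y). E x y) \<in> borel_measurable (N \<Otimes>\<^sub>M N)"
    using D by (auto simp: bounded_kernel_def)
  have [measurable]: "f \<in> borel_measurable N" "g \<in> borel_measurable N"
    using f g by (auto simp: test_function_def)
  have "(\<integral>x. (\<integral>y. D x y * g y \<partial>N) * f x \<partial>N) = (\<integral>x. (\<integral>y. E x y * g y \<partial>N) * f x \<partial>N)"
  proof (rule integral_cong_AE)
    show "AE x in N. (\<integral>y. D x y * g y \<partial>N) * f x = (\<integral>y. E x y * g y \<partial>N) * f x"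
      using AE AE_space
    proof eventually_elim
      case (elim x)
      have [measurable]: "(\<lambda>y. D x y) \<in> borel_measurable N" "(\<lambda>y. E x y) \<in> borel_measurable N"
        using measurable_compose[OF measurable_Pair1'[OF elim(2)] \<open>(\<lambda>(x, y). D x y) \<in> _\<close>]
          measurable_compose[OF measurable_Pair1'[OF elim(2)] \<open>(\<lambda>(x, y). E x y) \<in> _\<close>] by simp_all
      have "(\<integral>y. D x y * g y \<partial>N) = (\<integral>y. E x y * g y \<partial>N)"
        using elim(1) by (intro integral_cong_AE) auto
      then show ?case by simp
    qed
  qed measurable
  then show ?thesis using assms by (simp add: cut_form_iterated)
qed

lemma cut_norm_cong_AE:
  assumes N: "prob_space N" and D: "bounded_kernel N D" "bounded_kernel N E"
    and AE: "AE x in N. AE y in N. D x y = E x y"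
  shows "cut_norm N D = cut_norm N E"
  using cut_form_cong_AE[OF N D _ _ AE] unfolding cut_norm_eq by metis

text \<open>The cut norm is at most the L1 norm, which a measure-preserving pull-back leaves
  unchanged. One approximation on \<open>M\<close> thus serves in every coupling.\<close>

lemma cut_norm_step_error:
  fixes \<pi> :: "'b \<Rightarrow> nat"
  assumes N: "prob_space N" and M: "prob_space M" and \<phi>: "measure_preserving_map N M \<phi>"
    and W: "bounded_kernel M W" and \<pi>: "\<pi> \<in> measurable M (count_space UNIV)" "finite (\<pi> ` space M)"
    and e: "(\<integral>p. \<bar>W (fst p) (snd p) - w (\<pi> (fst p)) (\<pi> (snd p))\<bar> \<partial>(M \<Otimes>\<^sub>M M)) < e"
  shows "cut_norm N (\<lambda>x y. W (\<phi> x) (\<phi> y) - w (\<pi> (\<phi> x)) (\<pi> (\<phi> y))) \<le> e"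
proof -
  interpret N: prob_space N by fact
  interpret M: prob_space M by fact
  have D: "bounded_kernel M (\<lambda>x y. W x y - w (\<pi> x) (\<pi> y))"
    by (rule bounded_kernel_diff[OF W bounded_kernel_step[OF \<pi>]])
  have \<phi>m: "\<phi> \<in> measurable N M" using \<phi> by (simp add: measure_preserving_map_def)
  have "cut_norm N (\<lambda>x y. W (\<phi> x) (\<phi> y) - w (\<pi> (\<phi> x)) (\<pi> (\<phi> y)))
      \<le> (\<integral>(x, y). \<bar>W (\<phi> x) (\<phi> y) - w (\<pi> (\<phi> x)) (\<pi> (\<phi> y))\<bar> \<partial>(N \<Otimes>\<^sub>M N))"
    by (rule N.cut_norm_le_integral[OF bounded_kernel_comp[OF D \<phi>m]])
  also have "\<dots> = (\<integral>p. (\<lambda>p. \<bar>W (fst p) (snd p) - w (\<pi> (fst p)) (\<pi> (snd p))\<bar>) ((\<lambda>(x, y). (\<phi> x, \<phi> y)) p) \<partial>(N \<Otimes>\<^sub>M N))"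
    by (rule Bochner_Integration.integral_cong) auto
  also have "\<dots> = (\<integral>p. \<bar>W (fst p) (snd p) - w (\<pi> (fst p)) (\<pi> (snd p))\<bar> \<partial>(M \<Otimes>\<^sub>M M))"
    using M.bounded_kernel_integrable[OF D]
    by (intro measure_preserving_integral measure_preserving_pair M \<phi>) auto
  finally show ?thesis using e by simp
qed

text \<open>A step kernel in place of \<open>W2\<close> costs \<open>e\<close> in each of the two
  couplings, which gives \<open>2 * e\<close>. It depends on the points of \<open>M2\<close> only
  through the finite label, and along this label the couplings can be glued.\<close>

lemma cut_dist_triangle_aux:
  fixes N1 :: "'s measure" and N2 :: "'t measure" and M2 :: "'b measure"
  assumes N: "prob_space N1" "prob_space N2" and M: "prob_space M1" "prob_space M2" "prob_space M3"
    and W1: "bounded_kernel M1 W1" and W2: "bounded_kernel M2 W2" and W3: "bounded_kernel M3 W3"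
    and \<phi>1: "measure_preserving_map N1 M1 \<phi>1" and \<phi>2: "measure_preserving_map N1 M2 \<phi>2"
    and \<psi>2: "measure_preserving_map N2 M2 \<psi>2" and \<psi>3: "measure_preserving_map N2 M3 \<psi>3"
    and e: "e > 0"
  shows "cut_dist M1 W1 M3 W3 \<le> cut_norm N1 (\<lambda>x y. W1 (\<phi>1 x) (\<phi>1 y) - W2 (\<phi>2 x) (\<phi>2 y))
     + cut_norm N2 (\<lambda>x y. W2 (\<psi>2 x) (\<psi>2 y) - W3 (\<psi>3 x) (\<psi>3 y)) + 2 * e"
proof -
  interpret M2: prob_space M2 by fact
  interpret N1: prob_space N1 by fact
  interpret N2: prob_space N2 by fact
  obtain \<pi> :: "'b \<Rightarrow> nat" and w where \<pi>: "\<pi> \<in> measurable M2 (count_space UNIV)" "finite (\<pi> ` space M2)"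
     and w: "(\<integral>p. \<bar>W2 (fst p) (snd p) - w (\<pi> (fst p)) (\<pi> (snd p))\<bar> \<partial>(M2 \<Otimes>\<^sub>M M2)) < e"
    using M2.step_approximable_integrable[OF M2.bounded_kernel_integrable[OF W2]] e
    unfolding step_approximable_def by blast
  let ?S = "\<lambda>x y. w (\<pi> x) (\<pi> y)"
  have S: "bounded_kernel M2 ?S" by (rule bounded_kernel_step[OF \<pi>])
  have m[measurable]: "\<phi>1 \<in> measurable N1 M1" "\<phi>2 \<in> measurable N1 M2" "\<psi>2 \<in> measurable N2 M2" "\<psi>3 \<in> measurable N2 M3"
     "\<pi> \<in> measurable M2 (count_space UNIV)"
    using \<phi>1 \<phi>2 \<psi>2 \<psi>3 \<pi> by (auto simp: measure_preserving_map_def)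
  \<comment> \<open>Both labels are pulled back from \<open>M2\<close> by measure-preserving maps,
    so they have the same law, as gluing requires.\<close>
  have pre: "measure L {x \<in> space L. \<pi> (\<phi> x) = i} = measure M2 {x \<in> space M2. \<pi> x = i}"
    if "measure_preserving_map L M2 \<phi>" for L \<phi> i
  proof -
    have "{x \<in> space L. \<pi> (\<phi> x) = i} = \<phi> -` {x \<in> space M2. \<pi> x = i} \<inter> space L"
      using that by (auto simp: measure_preserving_map_def dest: measurable_space)
    moreover have "{x \<in> space M2. \<pi> x = i} \<in> sets M2" by measurable
    ultimately have "emeasure L {x \<in> space L. \<pi> (\<phi> x) = i} = emeasure M2 {x \<in> space M2. \<pi> x = i}"
      using that by (simp only: measure_preserving_map_def)
    then show ?thesis by (simp add: measure_def)
  qed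
  have fin: "finite ((\<lambda>x. \<pi> (\<phi>2 x)) ` space N1)"
    by (rule finite_subset[OF _ \<pi>(2)]) (use measurable_space[OF m(2)] in auto)
  obtain N :: "('s \<times> 't) measure" where N': "prob_space N"
    "measure_preserving_map N N1 fst" "measure_preserving_map N N2 snd"
    "transfers_test_functions N fst N1" "transfers_test_functions N snd N2"
    and AE: "AE p in N. \<pi> (\<phi>2 (fst p)) = \<pi> (\<psi>2 (snd p))"
    by (rule gluing[OF N, of "\<lambda>x. \<pi> (\<phi>2 x)" "\<lambda>x. \<pi> (\<psi>2 x)"]) (use fin pre[OF \<phi>2] pre[OF \<psi>2] in auto)
  interpret N: prob_space N by fact
  have [measurable]: "fst \<in> measurable N N1" "snd \<in> measurable N N2"
    using N' by (auto simp: measure_preserving_map_def)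
  have \<Phi>1: "measure_preserving_map N M1 (\<lambda>p. \<phi>1 (fst p))" by (rule measure_preserving_comp[OF \<phi>1 N'(2)])
  have \<Phi>2: "measure_preserving_map N M2 (\<lambda>p. \<phi>2 (fst p))" by (rule measure_preserving_comp[OF \<phi>2 N'(2)])
  have \<Psi>2: "measure_preserving_map N M2 (\<lambda>p. \<psi>2 (snd p))" by (rule measure_preserving_comp[OF \<psi>2 N'(3)])
  have \<Psi>3: "measure_preserving_map N M3 (\<lambda>p. \<psi>3 (snd p))" by (rule measure_preserving_comp[OF \<psi>3 N'(3)])
  let ?D1 = "\<lambda>x y. W1 (\<phi>1 x) (\<phi>1 y) - ?S (\<phi>2 x) (\<phi>2 y)"
  let ?D2 = "\<lambda>x y. ?S (\<psi>2 x) (\<psi>2 y) - W3 (\<psi>3 x) (\<psi>3 y)"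
  have k: "bounded_kernel N (\<lambda>x y. W1 (\<phi>1 (fst x)) (\<phi>1 (fst y)))" "bounded_kernel N (\<lambda>x y. ?S (\<phi>2 (fst x)) (\<phi>2 (fst y)))"
     "bounded_kernel N (\<lambda>x y. ?S (\<psi>2 (snd x)) (\<psi>2 (snd y)))" "bounded_kernel N (\<lambda>x y. W3 (\<psi>3 (snd x)) (\<psi>3 (snd y)))"
    by (rule bounded_kernel_comp[OF W1], measurable) (rule bounded_kernel_comp[OF S], measurable,
        rule bounded_kernel_comp[OF S], measurable, rule bounded_kernel_comp[OF W3], measurable)
  have "cut_dist M1 W1 M3 W3 \<le> cut_norm N (\<lambda>x y. W1 (\<phi>1 (fst x)) (\<phi>1 (fst y)) - W3 (\<psi>3 (snd x)) (\<psi>3 (snd y)))"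
    by (rule cut_dist_le[OF N'(1) \<Phi>1 \<Psi>3 M(1,3) W1 W3])
  also have "\<dots> \<le> cut_norm N (\<lambda>x y. W1 (\<phi>1 (fst x)) (\<phi>1 (fst y)) - ?S (\<phi>2 (fst x)) (\<phi>2 (fst y)))
      + cut_norm N (\<lambda>x y. ?S (\<phi>2 (fst x)) (\<phi>2 (fst y)) - W3 (\<psi>3 (snd x)) (\<psi>3 (snd y)))"
    by (rule N.cut_norm_triangle[OF k(1,2,4)])
  \<comment> \<open>On the glued space the two labels agree almost everywhere, so the step kernel
    may be read through either coupling.\<close>
  also have "cut_norm N (\<lambda>x y. ?S (\<phi>2 (fst x)) (\<phi>2 (fst y)) - W3 (\<psi>3 (snd x)) (\<psi>3 (snd y)))
     = cut_norm N (\<lambda>x y. ?S (\<psi>2 (snd x)) (\<psi>2 (snd y)) - W3 (\<psi>3 (snd x)) (\<psi>3 (snd y)))"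
  proof (rule cut_norm_cong_AE[OF N'(1) bounded_kernel_diff[OF k(2,4)] bounded_kernel_diff[OF k(3,4)]])
    show "AE x in N. AE y in N. ?S (\<phi>2 (fst x)) (\<phi>2 (fst y)) - W3 (\<psi>3 (snd x)) (\<psi>3 (snd y))
        = ?S (\<psi>2 (snd x)) (\<psi>2 (snd y)) - W3 (\<psi>3 (snd x)) (\<psi>3 (snd y))"
      using AE
    proof eventually_elim
      case (elim x)
      show ?case using AE by eventually_elim (use elim in simp)
    qed
  qed
  also have "cut_norm N (\<lambda>x y. ?D1 (fst x) (fst y)) \<le> cut_norm N1 ?D1"
    by (rule cut_norm_transfer_le[OF N'(1) N(1) _ N'(4)]) (use bounded_kernel_coupling[OF W1 S \<phi>1 \<phi>2] in auto)
  also have "cut_norm N (\<lambda>x y. ?D2 (snd x) (snd y)) \<le> cut_norm N2 ?D2"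
    by (rule cut_norm_transfer_le[OF N'(1) N(2) _ N'(5)]) (use bounded_kernel_coupling[OF S W3 \<psi>2 \<psi>3] in auto)
  also have "cut_norm N1 ?D1 \<le> cut_norm N1 (\<lambda>x y. W1 (\<phi>1 x) (\<phi>1 y) - W2 (\<phi>2 x) (\<phi>2 y)) + e"
    using N1.cut_norm_triangle[OF bounded_kernel_comp[OF W1 m(1)] bounded_kernel_comp[OF W2 m(2)] bounded_kernel_comp[OF S m(2)]]
      cut_norm_step_error[OF N(1) M(2) \<phi>2 W2 \<pi> w] by linarith
  also have "cut_norm N2 ?D2 \<le> cut_norm N2 (\<lambda>x y. W2 (\<psi>2 x) (\<psi>2 y) - W3 (\<psi>3 x) (\<psi>3 y)) + e"
    using N2.cut_norm_triangle[OF bounded_kernel_comp[OF S m(3)] bounded_kernel_comp[OF W2 m(3)] bounded_kernel_comp[OF W3 m(4)]]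
      cut_norm_step_error[OF N(2) M(2) \<psi>2 W2 \<pi> w]
      cut_norm_uminus[of N2 "\<lambda>x y. W2 (\<psi>2 x) (\<psi>2 y) - ?S (\<psi>2 x) (\<psi>2 y)"] by simp
  finally show ?thesis by simp
qed

lemma cut_dist_triangle:
  fixes M1 :: "'a measure" and M2 :: "'b measure" and M3 :: "'c measure"
  assumes M: "prob_space M1" "prob_space M2" "prob_space M3"
    and W: "bounded_kernel M1 W1" "bounded_kernel M2 W2" "bounded_kernel M3 W3"
  shows "cut_dist M1 W1 M3 W3 \<le> cut_dist M1 W1 M2 W2 + cut_dist M2 W2 M3 W3"
proof (rule field_le_epsilon)
  fix e :: real assume e: "e > 0"
  have lt: "cut_dist M1 W1 M2 W2 < cut_dist M1 W1 M2 W2 + e / 4" "cut_dist M2 W2 M3 W3 < cut_dist M2 W2 M3 W3 + e / 4"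
    using e by auto
  obtain N1 :: "('a \<times> 'b) measure" and \<phi>1 \<phi>2 where 1: "prob_space N1" "measure_preserving_map N1 M1 \<phi>1"
    "measure_preserving_map N1 M2 \<phi>2"
    "cut_norm N1 (\<lambda>x y. W1 (\<phi>1 x) (\<phi>1 y) - W2 (\<phi>2 x) (\<phi>2 y)) < cut_dist M1 W1 M2 W2 + e / 4"
    by (rule cut_dist_ex[OF M(1,2) lt(1)])
  obtain N2 :: "('b \<times> 'c) measure" and \<psi>2 \<psi>3 where 2: "prob_space N2" "measure_preserving_map N2 M2 \<psi>2"
    "measure_preserving_map N2 M3 \<psi>3"
    "cut_norm N2 (\<lambda>x y. W2 (\<psi>2 x) (\<psi>2 y) - W3 (\<psi>3 x) (\<psi>3 y)) < cut_dist M2 W2 M3 W3 + e / 4"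
    by (rule cut_dist_ex[OF M(2,3) lt(2)])
  show "cut_dist M1 W1 M3 W3 \<le> cut_dist M1 W1 M2 W2 + cut_dist M2 W2 M3 W3 + e"
    using cut_dist_triangle_aux[OF 1(1) 2(1) M W 1(2,3) 2(2,3), of "e / 4"] 1(4) 2(4) e by simp
qed

section \<open>Graphs as kernels and the degree order\<close>

lemma prob_space_unit_interval: "prob_space unit_interval"
  unfolding unit_interval_def by (rule prob_space_restrict_space) auto

lemma space_unit_interval: "space unit_interval = {0..1}"
  by (simp add: unit_interval_def space_restrict_space)

lemma sets_unit_interval [measurable_cong]: "sets unit_interval = sets (restrict_space borel {0..1})"
  unfolding unit_interval_def by (rule sets_restrict_space_cong) simp

lemma measurable_unit_interval: "f \<in> measurable borel N \<Longrightarrow> f \<in> measurable unit_interval N"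
  unfolding unit_interval_def by (rule measurable_restrict_space1) simp

lemma emeasure_unit_interval:
  "A \<in> sets borel \<Longrightarrow> A \<subseteq> {0..1} \<Longrightarrow> emeasure unit_interval A = emeasure lborel A"
  unfolding unit_interval_def by (rule emeasure_restrict_space) auto

interpretation unit_interval: prob_space unit_interval by (rule prob_space_unit_interval)

text \<open>With \<open>adjacency\<close> this is the graph as a kernel without any labelling; every
  labelling gives a pull-back of it to the unit interval.\<close>

definition vertex_space :: "'a pair_pre_digraph \<Rightarrow> 'a measure" where
  "vertex_space G = uniform_count_measure (pverts G)"

definition adjacency :: "'a pair_pre_digraph \<Rightarrow> 'a \<Rightarrow> 'a \<Rightarrow> real" where
  "adjacency G u v = (if (u, v) \<in> parcs G then 1 else 0)"

text \<open>The maximum with 1 sends the point 0 to the first vertex, so that the whole closed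
  interval is mapped to vertices.\<close>

definition vertex_at :: "'a pair_pre_digraph \<Rightarrow> (nat \<Rightarrow> 'a) \<Rightarrow> real \<Rightarrow> 'a" where
  "vertex_at G l x = l (nat (max 1 \<lceil>real (card (pverts G)) * x\<rceil>))"

lemma space_vertex_space: "space (vertex_space G) = pverts G"
  by (simp add: vertex_space_def space_uniform_count_measure)

lemma sets_vertex_space [measurable_cong]: "sets (vertex_space G) = sets (count_space (pverts G))"
  by (simp add: vertex_space_def sets_uniform_count_measure)

lemma measurable_vertex_space: "f \<in> measurable (vertex_space G) M \<longleftrightarrow> f \<in> pverts G \<rightarrow> space M"
  by (simp add: measurable_cong_sets[OF sets_vertex_space refl])

lemma prob_space_vertex_space:
  "finite (pverts G) \<Longrightarrow> pverts G \<noteq> {} \<Longrightarrow> prob_space (vertex_space G)"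
  unfolding vertex_space_def by (rule prob_space_uniform_count_measure)

lemma integral_vertex_space:
  "finite (pverts G) \<Longrightarrow> integral\<^sup>L (vertex_space G) f = (\<Sum>v\<in>pverts G. f v) / real (card (pverts G))"
  for f :: "'a \<Rightarrow> real"
  unfolding vertex_space_def by (rule integral_uniform_count_measure)

lemma bounded_kernel_vertex_space:
  assumes fin: "finite (pverts G)"
  shows "bounded_kernel (vertex_space G) D"
proof -
  have eq: "sets (vertex_space G \<Otimes>\<^sub>M vertex_space G) = sets (count_space (pverts G \<times> pverts G))"
    unfolding sets_pair_measure_cong[OF sets_vertex_space sets_vertex_space, of G G]
    by (subst pair_measure_countable) (use fin in \<open>auto intro: countable_finite\<close>)
  have "(\<lambda>(x, y). D x y) \<in> borel_measurable (vertex_space G \<Otimes>\<^sub>M vertex_space G)"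
    unfolding measurable_cong_sets[OF eq refl] by simp
  moreover have "\<bar>D x y\<bar> \<le> (\<Sum>(x, y)\<in>pverts G \<times> pverts G. \<bar>D x y\<bar>)" if "x \<in> pverts G" "y \<in> pverts G" for x y
    using member_le_sum[of "(x, y)" "pverts G \<times> pverts G" "\<lambda>(x, y). \<bar>D x y\<bar>"] fin that by auto
  ultimately show ?thesis by (auto simp: bounded_kernel_def space_vertex_space)
qed

lemma vertex_at_in:
  assumes "labelling G l" "0 \<le> x" "x \<le> 1" "pverts G \<noteq> {}" "finite (pverts G)"
  shows "nat (max 1 \<lceil>real (card (pverts G)) * x\<rceil>) \<in> {1..card (pverts G)}" "vertex_at G l x \<in> pverts G"
proof -
  have n: "card (pverts G) > 0" using assms by (simp add: card_gt_0_iff)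
  have "real (card (pverts G)) * x \<le> real (card (pverts G))"
    using assms by (intro mult_left_le) auto
  then have "\<lceil>real (card (pverts G)) * x\<rceil> \<le> int (card (pverts G))" by (simp add: ceiling_le_iff)
  then show *: "nat (max 1 \<lceil>real (card (pverts G)) * x\<rceil>) \<in> {1..card (pverts G)}" using n by auto
  show "vertex_at G l x \<in> pverts G"
    using assms(1) * unfolding labelling_def vertex_at_def by (rule bij_betwE[THEN bspec])
qed

lemma vertex_at_preserving:
  assumes l: "labelling G l" and fin: "finite (pverts G)" and ne: "pverts G \<noteq> {}"
  shows "measure_preserving_map unit_interval (vertex_space G) (vertex_at G l)"
proof -
  define n where "n = card (pverts G)"
  have n: "n > 0" using fin ne by (simp add: n_def card_gt_0_iff)
  have "(\<lambda>x. nat (max 1 \<lceil>real n * x\<rceil>)) \<in> measurable unit_interval (count_space UNIV)"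
    by (rule measurable_unit_interval) measurable
  then have U: "vertex_at G l \<in> measurable unit_interval (count_space UNIV)"
    unfolding vertex_at_def[abs_def] n_def by (rule measurable_compose) simp
  have m: "vertex_at G l \<in> measurable unit_interval (vertex_space G)"
  proof (rule measurableI)
    show "vertex_at G l x \<in> space (vertex_space G)" if "x \<in> space unit_interval" for x
      using vertex_at_in(2)[OF l _ _ ne fin] that by (simp add: space_vertex_space space_unit_interval)
    show "vertex_at G l -` A \<inter> space unit_interval \<in> sets unit_interval" for A
      using measurable_sets[OF U, of A] by simp
  qed
  have "distr unit_interval (vertex_space G) (vertex_at G l) = vertex_space G"
  proof (rule measure_eqI_finite[where A = "pverts G"])
    fix v assume v: "v \<in> pverts G"
    have "pverts G = l ` {1..n}" using l by (simp add: labelling_def bij_betw_def n_def)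
    then obtain i where i: "i \<in> {1..n}" "l i = v" using v by (metis imageE)
    have inj: "inj_on l {1..n}" using l unfolding labelling_def n_def bij_betw_def by simp
    have eq: "vertex_at G l x = v \<longleftrightarrow> nat (max 1 \<lceil>real n * x\<rceil>) = i" if "0 \<le> x" "x \<le> 1" for x
      using inj_on_eq_iff[OF inj vertex_at_in(1)[OF l that ne fin, folded n_def] i(1)] i(2)
      by (simp add: vertex_at_def n_def)
    have iv: "nat (max 1 \<lceil>real n * x\<rceil>) = i \<longleftrightarrow> (if i = 1 then real n * x \<le> 1 else real i - 1 < real n * x \<and> real n * x \<le> real i)"
      if "0 \<le> x" for x
    proof (cases "i = 1")
      case True
      have "nat (max 1 \<lceil>real n * x\<rceil>) = 1 \<longleftrightarrow> \<lceil>real n * x\<rceil> \<le> 1" by linarith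
      then show ?thesis using True by (simp add: ceiling_le_iff)
    next
      case False
      then have "2 \<le> i" using i(1) by auto
      then have "nat (max 1 \<lceil>real n * x\<rceil>) = i \<longleftrightarrow> \<lceil>real n * x\<rceil> = int i" by linarith
      then show ?thesis using False by (simp add: ceiling_eq_iff)
    qed
    \<comment> \<open>The fibre of the first vertex is closed on the left since it absorbs the point
      0; all the others are half-open. Each has length 1/n.\<close>
    have "vertex_at G l -` {v} \<inter> {0..1} = (if i = 1 then {0..1 / real n} else {(real i - 1) / real n<..real i / real n})"
    proof (rule set_eqI)
      fix x
      have le: "real i / real n \<le> 1" using i n by simp
      show "x \<in> vertex_at G l -` {v} \<inter> {0..1} \<longleftrightarrow> x \<in> (if i = 1 then {0..1 / real n} else {(real i - 1) / real n<..real i / real n})"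
      proof (cases "0 \<le> x \<and> x \<le> 1")
        case True
        then show ?thesis using eq[of x] iv[of x] n by (auto simp: field_simps)
      next
        case False
        have "0 \<le> (real i - 1) / real n" using i by simp
        moreover have "1 / real n \<le> 1" using n by simp
        ultimately show ?thesis using False le by (auto split: if_splits)
      qed
    qed
    moreover have "emeasure lborel (if i = 1 then {0..1 / real n} else {(real i - 1) / real n<..real i / real n}) = ennreal (1 / real n)"
    proof -
      have "(real i - 1) / real n \<le> real i / real n" "real i / real n - (real i - 1) / real n = 1 / real n"
        using n by (auto simp: divide_right_mono diff_divide_distrib)
      then show ?thesis by simp
    qed
    moreover have "(if i = 1 then {0..1 / real n} else {(real i - 1) / real n<..real i / real n}) \<subseteq> {0..1}"
      using \<open>vertex_at G l -` {v} \<inter> {0..1} = _\<close> by blast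
    ultimately have "emeasure unit_interval (vertex_at G l -` {v} \<inter> {0..1}) = ennreal (1 / real n)"
      by (subst emeasure_unit_interval) auto
    then show "emeasure (distr unit_interval (vertex_space G) (vertex_at G l)) {v} = emeasure (vertex_space G) {v}"
      using v fin m by (simp add: emeasure_distr sets_vertex_space space_unit_interval vertex_space_def n_def emeasure_uniform_count_measure
          sets_uniform_count_measure divide_inverse)
  qed (use fin in \<open>auto simp: sets_vertex_space\<close>)
  then show ?thesis using m by (simp add: measure_preserving_map_iff_distr)
qed

lemma graph_kernel_eq_adjacency:
  assumes "0 < x" "0 < y" "pverts G \<noteq> {}" "finite (pverts G)"
  shows "graph_kernel G l x y = adjacency G (vertex_at G l x) (vertex_at G l y)"
proof -
  have n: "card (pverts G) > 0" using assms by (simp add: card_gt_0_iff)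
  have "max 1 \<lceil>real (card (pverts G)) * z\<rceil> = \<lceil>real (card (pverts G)) * z\<rceil>" if "0 < z" for z
    using n that by (intro max_absorb2) (simp add: one_le_ceiling)
  then show ?thesis using assms by (simp add: graph_kernel_def adjacency_def vertex_at_def)
qed

lemma bounded_kernel_vertex_at:
  assumes "labelling G l" "finite (pverts G)" "pverts G \<noteq> {}"
  shows "bounded_kernel unit_interval (\<lambda>x y. adjacency G (vertex_at G l x) (vertex_at G l y))"
  using bounded_kernel_comp[OF bounded_kernel_vertex_space[OF assms(2)]] vertex_at_preserving[OF assms]
  by (auto simp: measure_preserving_map_def)

lemma bounded_kernel_graph_kernel:
  assumes "labelling G l" "finite (pverts G)" "pverts G \<noteq> {}"
  shows "bounded_kernel unit_interval (graph_kernel G l)"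
proof -
  have [measurable]: "(\<lambda>(x, y). adjacency G (vertex_at G l x) (vertex_at G l y)) \<in> borel_measurable (unit_interval \<Otimes>\<^sub>M unit_interval)"
    using bounded_kernel_vertex_at[OF assms] by (simp add: bounded_kernel_def)
  have [measurable]: "(\<lambda>x. x) \<in> borel_measurable unit_interval" by (rule measurable_unit_interval) simp
  have "(\<lambda>p. if 0 < fst p \<and> 0 < snd p then adjacency G (vertex_at G l (fst p)) (vertex_at G l (snd p)) else 0)
      \<in> borel_measurable (unit_interval \<Otimes>\<^sub>M unit_interval)"
    by measurable
  moreover have "(if 0 < fst p \<and> 0 < snd p then adjacency G (vertex_at G l (fst p)) (vertex_at G l (snd p)) else 0)
      = graph_kernel G l (fst p) (snd p)" for p
    using graph_kernel_eq_adjacency[of "fst p" "snd p" G l] assms by (auto simp: graph_kernel_def)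
  ultimately show ?thesis
    by (auto simp: bounded_kernel_def case_prod_beta' graph_kernel_def intro!: exI[of _ 1])
qed

lemma AE_unit_interval_positive: "AE x in unit_interval. 0 < x"
proof -
  have "emeasure unit_interval {0} = 0" by (subst emeasure_unit_interval) auto
  then have "{0} \<in> null_sets unit_interval"
    by (auto simp: null_sets_def sets_unit_interval sets_restrict_space)
  from AE_not_in[OF this] AE_space show ?thesis
    by eventually_elim (auto simp: space_unit_interval)
qed

text \<open>The two kernels on the unit interval differ only where a coordinate is 0, which is a
  null set.\<close>

lemma cut_dist_graph_kernel:
  assumes l: "labelling G l" "finite (pverts G)" "pverts G \<noteq> {}"
  shows "cut_dist unit_interval (graph_kernel G l) (vertex_space G) (adjacency G) = 0"
proof -
  let ?A = "\<lambda>x y. adjacency G (vertex_at G l x) (vertex_at G l y)"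
  note gk = bounded_kernel_graph_kernel[OF l] and ak = bounded_kernel_vertex_at[OF l]
  have "cut_dist unit_interval (graph_kernel G l) (vertex_space G) (adjacency G)
      \<le> cut_norm unit_interval (\<lambda>x y. graph_kernel G l x y - ?A x y)"
    using l by (intro cut_dist_le measure_preserving_id vertex_at_preserving prob_space_vertex_space
        bounded_kernel_vertex_space prob_space_unit_interval gk)
  also have "\<dots> = cut_norm unit_interval (\<lambda>x y. ?A x y - ?A x y)"
  proof (rule cut_norm_cong_AE[OF prob_space_unit_interval bounded_kernel_diff[OF gk ak] bounded_kernel_diff[OF ak ak]])
    show "AE x in unit_interval. AE y in unit_interval. graph_kernel G l x y - ?A x y = ?A x y - ?A x y"
      using AE_unit_interval_positive
    proof eventually_elim
      case (elim x)
      show ?case using AE_unit_interval_positive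
        by eventually_elim (use elim l graph_kernel_eq_adjacency in simp)
    qed
  qed
  also have "\<dots> \<le> 0" by (rule cut_norm_least) (simp add: cut_form_def case_prod_beta')
  finally show ?thesis
    using cut_dist_nonneg[OF prob_space_unit_interval prob_space_vertex_space[OF l(2,3)] gk
      bounded_kernel_vertex_space[OF l(2), of "adjacency G"]] by simp
qed

text \<open>For fixed \<open>g\<close> the best partner is the sign of the inner integral. In this
  way a small cut norm forces degrees into any weighted set to be close in the mean.\<close>

lemma (in prob_space) integral_abs_le_cut_norm:
  assumes D: "bounded_kernel M D" and g: "test_function M g"
  shows "(\<integral>x. \<bar>\<integral>y. D x y * g y \<partial>M\<bar> \<partial>M) \<le> cut_norm M D"
proof -
  have [measurable]: "(\<lambda>(x, y). D x y) \<in> borel_measurable (M \<Otimes>\<^sub>M M)" "g \<in> borel_measurable M"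
    using D g by (auto simp: bounded_kernel_def test_function_def)
  define f where "f x = sgn (\<integral>y. D x y * g y \<partial>M)" for x
  have f: "test_function M f"
    unfolding test_function_def f_def by (auto simp: abs_sgn_eq)
  have "cut_form M D f g = (\<integral>x. \<bar>\<integral>y. D x y * g y \<partial>M\<bar> \<partial>M)"
    by (simp add: cut_form_iterated[OF D f g] f_def abs_sgn)
  then show ?thesis using cut_norm_upper[OF D f g] by simp
qed

lemma ex_linear_order_by_key:
  fixes f :: "'a \<Rightarrow> real"
  assumes "finite V"
  obtains r where "linear_order_on V r" "\<And>v w. (v, w) \<in> r \<Longrightarrow> f v \<le> f w"
proof -
  obtain idx :: "'a \<Rightarrow> nat" where idx: "inj_on idx V"
    using finite_imp_inj_to_nat_seg[OF assms] by blast
  define r where "r = {(v, w). v \<in> V \<and> w \<in> V \<and> (f v < f w \<or> f v = f w \<and> idx v \<le> idx w)}"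
  have "linear_order_on V r"
    unfolding order_on_defs
  proof (intro conjI)
    show "r \<subseteq> V \<times> V" "refl_on V r" by (auto simp: r_def refl_on_def)
    show "trans r" by (rule transI) (auto simp: r_def)
    show "antisym r" by (rule antisymI) (use idx in \<open>auto simp: r_def inj_on_def\<close>)
    show "total_on V r" by (auto simp: total_on_def r_def)
  qed
  moreover have "f v \<le> f w" if "(v, w) \<in> r" for v w using that by (auto simp: r_def)
  ultimately show thesis using that by blast
qed

section \<open>Evaluating the functional on finite graphs\<close>

lemma finite_linear_orders:
  assumes "finite V" shows "finite {r. linear_order_on V r}"
  by (rule finite_subset[of _ "Pow (V \<times> V)"]) (use assms in \<open>auto simp: order_on_defs\<close>)

lemma Omega0_le:
  assumes "finite (pverts G)" "linear_order_on (pverts G) r"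
    "\<And>A. A \<subseteq> pverts G \<Longrightarrow> Omega0_order_set G r A \<le> c"
  shows "Omega0 G \<le> c"
proof -
  have "Omega0 G \<le> Omega0_order G r"
    unfolding Omega0_def using assms finite_linear_orders[OF assms(1)]
    by (intro Min_le) (auto simp: setcompr_eq_image)
  also have "\<dots> \<le> c"
    unfolding Omega0_order_def using assms
    by (subst Max_le_iff) (auto simp: setcompr_eq_image Pow_def[symmetric])
  finally show ?thesis .
qed

lemma Omega0_attained:
  assumes fin: "finite (pverts G)"
  obtains r where "linear_order_on (pverts G) r" "\<And>A. A \<subseteq> pverts G \<Longrightarrow> Omega0_order_set G r A \<le> Omega0 G"
proof -
  obtain r0 where r0: "linear_order_on (pverts G) r0" using ex_linear_order_by_key[OF fin] by blast
  have "Omega0 G \<in> {Omega0_order G r | r. linear_order_on (pverts G) r}"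
    unfolding Omega0_def using r0 finite_linear_orders[OF fin]
    by (intro Min_in) (auto simp: setcompr_eq_image)
  then obtain r where r: "linear_order_on (pverts G) r" "Omega0 G = Omega0_order G r" by blast
  have "Omega0_order_set G r A \<le> Omega0 G" if "A \<subseteq> pverts G" for A
    unfolding r(2) Omega0_order_def using fin that
    by (intro Max_ge) (auto simp: setcompr_eq_image Pow_def[symmetric])
  then show thesis using r that by blast
qed

lemma Omega0_nonneg:
  assumes fin: "finite (pverts G)" shows "0 \<le> Omega0 G"
proof -
  obtain r where r: "\<And>A. A \<subseteq> pverts G \<Longrightarrow> Omega0_order_set G r A \<le> Omega0 G"
    using Omega0_attained[OF fin] by blast
  have "0 \<le> Omega0_order_set G r {}"
    unfolding Omega0_order_set_def by (intro divide_nonneg_nonneg sum_nonneg) auto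
  then show ?thesis using r[of "{}"] by simp
qed

text \<open>A vertex is not its own neighbour, so deleting both \<open>v\<close> and
  \<open>w\<close> can only cost \<open>v\<close> the neighbour \<open>w\<close>. An error of 1 for
  each of at most n^2 pairs, divided by n^3, is the origin of the term 1/n in both
  directions.\<close>

lemma nbrs_in_remove2:
  assumes "finite A"
  shows "nbrs_in G v (A - {v, w}) \<le> nbrs_in G v A" 
    and "(v, v) \<notin> parcs G \<Longrightarrow> nbrs_in G v A \<le> nbrs_in G v (A - {v, w}) + 1"
    and "(v, v) \<notin> parcs G \<Longrightarrow> nbrs_in G v A \<le> nbrs_in G v (A - {w, v}) + 1"
proof -
  show "nbrs_in G v (A - {v, w}) \<le> nbrs_in G v A"
    unfolding nbrs_in_def by (rule card_mono) (use assms in auto)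
  show *: "nbrs_in G v A \<le> nbrs_in G v (A - {v, w}) + 1" if "(v, v) \<notin> parcs G"
  proof -
    have "{u \<in> A. (v, u) \<in> parcs G} \<subseteq> insert w {u \<in> A - {v, w}. (v, u) \<in> parcs G}" using that by auto
    from card_mono[OF _ this] show ?thesis
      using assms card_insert_le_m1 by (fastforce simp: nbrs_in_def card_insert_if)
  qed
  then show "nbrs_in G v A \<le> nbrs_in G v (A - {w, v}) + 1" if "(v, v) \<notin> parcs G"
    using that by (simp add: insert_commute)
qed

lemma sum_adjacency:
  assumes "finite (pverts G)" "A \<subseteq> pverts G"
  shows "(\<Sum>u\<in>pverts G. adjacency G v u * indicator A u) = real (nbrs_in G v A)"
proof -
  have "(\<Sum>u\<in>pverts G. adjacency G v u * indicator A u) = (\<Sum>u\<in>pverts G. if u \<in> {u \<in> A. (v, u) \<in> parcs G} then 1 else 0)"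
    by (rule sum.cong) (auto simp: adjacency_def indicator_def)
  also have "\<dots> = real (card (pverts G \<inter> {u \<in> A. (v, u) \<in> parcs G}))"
    using assms by (simp only: sum.If_cases[OF assms(1)]) simp
  also have "pverts G \<inter> {u \<in> A. (v, u) \<in> parcs G} = {u \<in> A. (v, u) \<in> parcs G}" using assms by auto
  finally show ?thesis by (simp add: nbrs_in_def)
qed


lemma Omega0_order_set_le_degree_order:
  assumes G: "pair_graph G" and ne: "pverts G \<noteq> {}"
    and N: "prob_space N" and \<phi>1: "measure_preserving_map N (vertex_space G) \<phi>1"
    and \<phi>2: "measure_preserving_map N unit_interval \<phi>2" and V: "monotone_kernel V"
    and e: "cut_norm N (\<lambda>x y. adjacency G (\<phi>1 x) (\<phi>1 y) - V (\<phi>2 x) (\<phi>2 y)) \<le> e"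
    and r: "linear_order_on (pverts G) r" "\<And>v w. (v, w) \<in> r \<Longrightarrow> nbrs_in G v (pverts G) \<le> nbrs_in G w (pverts G)"
    and A: "A \<subseteq> pverts G"
  shows "Omega0_order_set G r A \<le> 4 * e + 1 / real (card (pverts G))"
proof -
  interpret pair_graph G by fact
  interpret N: prob_space N by fact
  have fin: "finite (pverts G)" by simp
  define n where "n = real (card (pverts G))"
  have n: "n > 0" using fin ne by (simp add: n_def card_gt_0_iff)
  have VK: "bounded_kernel unit_interval V" and AK: "bounded_kernel (vertex_space G) (adjacency G)"
    using V by (auto simp: monotone_kernel_def is_kernel_bounded bounded_kernel_vertex_space)
  have V01: "0 \<le> V x y \<and> V x y \<le> 1" if "x \<in> {0..1}" "y \<in> {0..1}" for x y
    using V that by (auto simp: monotone_kernel_def is_kernel_def space_unit_interval)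
  have Vmono: "V x y \<le> V x' y" if "x \<in> {0..1}" "x' \<in> {0..1}" "y \<in> {0..1}" "x \<le> x'" for x x' y
    using V that unfolding monotone_kernel_def by simp
  have [measurable]: "(\<lambda>(x, y). V x y) \<in> borel_measurable (unit_interval \<Otimes>\<^sub>M unit_interval)"
    using VK by (simp add: bounded_kernel_def)
  have m1[measurable]: "\<phi>1 \<in> measurable N (vertex_space G)" and m2[measurable]: "\<phi>2 \<in> measurable N unit_interval"
    using \<phi>1 \<phi>2 by (auto simp: measure_preserving_map_def)
  have s1: "\<phi>1 s \<in> pverts G" if "s \<in> space N" for s using measurable_space[OF m1 that] by (simp add: space_vertex_space)
  have s2: "\<phi>2 s \<in> {0..1}" if "s \<in> space N" for s using measurable_space[OF m2 that] by (simp add: space_unit_interval)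
  have vm: "(\<lambda>s. h (\<phi>1 s)) \<in> borel_measurable N" for h :: "'a \<Rightarrow> real"
    by (rule measurable_compose[OF m1]) (simp add: measurable_vertex_space)
  have vint: "(\<integral>s. h (\<phi>1 s) \<partial>N) = (\<Sum>v\<in>pverts G. h v) / n" for h :: "'a \<Rightarrow> real"
    using measure_preserving_integral[OF \<phi>1, of h] by (simp add: integral_vertex_space fin n_def measurable_vertex_space)
  \<comment> \<open>The coupling turns a vertex set into a test function, so degrees into the same
    set can be formed for the graph and for \<open>V\<close>.\<close>
  define g where "g B s = (indicator B (\<phi>1 s) :: real)" for B s
  have g: "test_function N (g B)" for B unfolding test_function_def g_def using vm[of "indicator B"] by (auto simp: indicator_def)
  have gm[measurable]: "g B \<in> borel_measurable N" for B using g by (rule test_function_measurable)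
  have g01: "0 \<le> g B s" "g B s \<le> 1" for B s by (auto simp: g_def indicator_def)
  define d where "d B v = real (nbrs_in G v B) / n" for B v
  have d: "(\<integral>s. adjacency G v (\<phi>1 s) * g B s \<partial>N) = d B v" if "B \<subseteq> pverts G" for B v
    using vint[of "\<lambda>u. adjacency G v u * indicator B u"] sum_adjacency[OF fin that] by (simp add: g_def d_def)
  define D where "D B x = (\<integral>s. V x (\<phi>2 s) * g B s \<partial>N)" for B x
  have Vi: "integrable N (\<lambda>s. V x (\<phi>2 s) * g B s)" if "x \<in> {0..1}" for x B
  proof (rule N.integrable_bounded[where C = 1])
    have "(\<lambda>y. V x y) \<in> borel_measurable unit_interval"
      using measurable_compose[OF measurable_Pair1' \<open>(\<lambda>(x, y). V x y) \<in> _\<close>, of x] that by (simp add: space_unit_interval)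
    from measurable_compose[OF m2 this] have [measurable]: "(\<lambda>s. V x (\<phi>2 s)) \<in> borel_measurable N" .
    show "(\<lambda>s. V x (\<phi>2 s) * g B s) \<in> borel_measurable N" by measurable
    show "\<bar>V x (\<phi>2 s) * g B s\<bar> \<le> 1" if "s \<in> space N" for s
      using V01[OF \<open>x \<in> {0..1}\<close> s2[OF that]] by (auto simp: g_def indicator_def)
  qed
  have Dmono: "D B x \<le> D B x'" if "x \<in> {0..1}" "x' \<in> {0..1}" "x \<le> x'" for B x x'
    unfolding D_def using that Vi Vmono s2 g01 by (intro integral_mono mult_right_mono) auto
  \<comment> \<open>the complement of A has a monotone degree function too, so D A varies at most as much as D of all vertices\<close>
  have Dlip: "D A x' - D A x \<le> D (pverts G) x' - D (pverts G) x" if "x \<in> {0..1}" "x' \<in> {0..1}" "x \<le> x'" for x x'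
  proof -
    have "D (pverts G) z = D A z + D (pverts G - A) z" if "z \<in> {0..1}" for z
    proof -
      have "D A z + D (pverts G - A) z = (\<integral>s. V z (\<phi>2 s) * g A s + V z (\<phi>2 s) * g (pverts G - A) s \<partial>N)"
        unfolding D_def using Vi that by (intro Bochner_Integration.integral_add[symmetric])
      also have "\<dots> = D (pverts G) z"
        unfolding D_def by (rule Bochner_Integration.integral_cong) (use A s1 in \<open>auto simp: g_def indicator_def\<close>)
      finally show ?thesis by simp
    qed
    then show ?thesis using Dmono[OF that, of "pverts G - A"] that by auto
  qed
  define E where "E B s = \<bar>d B (\<phi>1 s) - D B (\<phi>2 s)\<bar>" for B s
  have AKN: "bounded_kernel N (\<lambda>x y. adjacency G (\<phi>1 x) (\<phi>1 y))" by (rule bounded_kernel_comp[OF AK m1])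
  have VKN: "bounded_kernel N (\<lambda>x y. V (\<phi>2 x) (\<phi>2 y))" by (rule bounded_kernel_comp[OF VK m2])
  have [measurable]: "(\<lambda>(x, y). adjacency G (\<phi>1 x) (\<phi>1 y)) \<in> borel_measurable (N \<Otimes>\<^sub>M N)" 
     "(\<lambda>(x, y). V (\<phi>2 x) (\<phi>2 y)) \<in> borel_measurable (N \<Otimes>\<^sub>M N)"
    using AKN VKN by (auto simp: bounded_kernel_def)
  have Em[measurable]: "E B \<in> borel_measurable N" for B
  proof -
    have [measurable]: "(\<lambda>s. d B (\<phi>1 s)) \<in> borel_measurable N" by (rule vm)
    show ?thesis unfolding E_def[abs_def] D_def by measurable
  qed
  have d01: "0 \<le> d B v" "d B v \<le> 1" if "B \<subseteq> pverts G" for B v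
  proof -
    have "nbrs_in G v B \<le> card (pverts G)" unfolding nbrs_in_def
      by (rule card_mono) (use that fin in auto)
    then show "0 \<le> d B v" "d B v \<le> 1" using n by (auto simp: d_def n_def divide_le_eq_1)
  qed
  have D01: "0 \<le> D B x" "D B x \<le> 1" if "x \<in> {0..1}" for B x
  proof -
    have "V x (\<phi>2 s) * g B s \<le> 1" "0 \<le> V x (\<phi>2 s) * g B s" if "s \<in> space N" for s
      using V01[OF \<open>x \<in> {0..1}\<close> s2[OF that]] by (auto simp: g_def indicator_def)
    then show "0 \<le> D B x" "D B x \<le> 1"
      unfolding D_def by (auto intro: N.integral_bounded_le Bochner_Integration.integral_nonneg)
  qed
  have Ei: "integrable N (E B)" if "B \<subseteq> pverts G" for B
  proof (rule N.integrable_bounded[where C = 1])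
    show "\<bar>E B s\<bar> \<le> 1" if "s \<in> space N" for s
      using d01[OF \<open>B \<subseteq> _\<close>, of "\<phi>1 s"] D01[OF s2[OF that], of B] unfolding E_def by linarith
  qed measurable
  have E: "(\<integral>s. E B s \<partial>N) \<le> e" if B: "B \<subseteq> pverts G" for B
  proof -
    have "(\<integral>s. E B s \<partial>N) = (\<integral>s. \<bar>\<integral>t. (adjacency G (\<phi>1 s) (\<phi>1 t) - V (\<phi>2 s) (\<phi>2 t)) * g B t \<partial>N\<bar> \<partial>N)"
    proof (rule Bochner_Integration.integral_cong)
      fix s assume s: "s \<in> space N"
      have "integrable N (\<lambda>t. adjacency G (\<phi>1 s) (\<phi>1 t) * g B t)"
        using vm[of "\<lambda>u. adjacency G (\<phi>1 s) u * indicator B u"]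
        by (intro N.integrable_bounded[where C = 1]) (auto simp: adjacency_def g_def indicator_def)
      then have "d B (\<phi>1 s) - D B (\<phi>2 s) = (\<integral>t. adjacency G (\<phi>1 s) (\<phi>1 t) * g B t - V (\<phi>2 s) (\<phi>2 t) * g B t \<partial>N)"
        using Vi[OF s2[OF s]] by (subst Bochner_Integration.integral_diff) (auto simp: d[OF B] D_def)
      then show "E B s = \<bar>\<integral>t. (adjacency G (\<phi>1 s) (\<phi>1 t) - V (\<phi>2 s) (\<phi>2 t)) * g B t \<partial>N\<bar>"
        by (simp add: E_def left_diff_distrib)
    qed simp
    also have "\<dots> \<le> e" using N.integral_abs_le_cut_norm[OF bounded_kernel_diff[OF AKN VKN] g, of B] e by simp
    finally show ?thesis .
  qed
  \<comment> \<open>The condition compares degrees instead of using \<open>r\<close>, which only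
    enters through this comparison. So \<open>h\<close> can be summed over all pairs of
    vertices.\<close>
  define h where "h v w = (if d (pverts G) v \<le> d (pverts G) w then max (d A v - d A w) 0 else 0)" for v w
  define E' where "E' s = E A s + E (pverts G) s" for s
  have E'i: "integrable N E'" unfolding E'_def[abs_def] using Ei A by auto
  \<comment> \<open>If the coupling puts s before t, \<open>D A\<close> does not decrease from s to
    t. Otherwise \<open>Dlip\<close> bounds the drop of \<open>D A\<close> by that of the total
    degree, which up to the errors is not positive by the condition in \<open>h\<close>.\<close>
  have hE: "h (\<phi>1 s) (\<phi>1 t) \<le> E' s + E' t" if st: "s \<in> space N" "t \<in> space N" for s t
  proof (cases "\<phi>2 s \<le> \<phi>2 t")
    case True
    then show ?thesis using Dmono[OF s2[OF st(1)] s2[OF st(2)], of A] by (auto simp: h_def E'_def E_def)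
  next
    case False
    then show ?thesis using Dlip[OF s2[OF st(2)] s2[OF st(1)]] by (auto simp: h_def E'_def E_def)
  qed
  have hi: "integrable N (\<lambda>t. h v (\<phi>1 t))" for v
    using vm[of "h v"] d01[OF A, of v] d01[OF A] 
    by (intro N.integrable_bounded[where C = 1]) (auto simp: h_def abs_if intro!: order_trans[OF _ d01(2)[OF A, of v]])
  have "(\<Sum>v\<in>pverts G. (\<Sum>w\<in>pverts G. h v w) / n) / n = (\<integral>s. (\<integral>t. h (\<phi>1 s) (\<phi>1 t) \<partial>N) \<partial>N)"
    by (simp only: vint vint[of "\<lambda>v. (\<Sum>w\<in>pverts G. h v w) / n"])
  also have "\<dots> \<le> (\<integral>s. E' s + (\<integral>t. E' t \<partial>N) \<partial>N)"
  proof (rule integral_mono)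
    show "integrable N (\<lambda>s. \<integral>t. h (\<phi>1 s) (\<phi>1 t) \<partial>N)"
    proof (rule N.integrable_bounded)
      show "(\<lambda>s. \<integral>t. h (\<phi>1 s) (\<phi>1 t) \<partial>N) \<in> borel_measurable N" using vm[of "\<lambda>v. \<integral>t. h v (\<phi>1 t) \<partial>N"] .
      show "\<bar>\<integral>t. h (\<phi>1 s) (\<phi>1 t) \<partial>N\<bar> \<le> 1" for s
        by (rule N.abs_integral_bounded_le) (use d01[OF A] in \<open>auto simp: h_def abs_if intro!: order_trans[OF _ d01(2)[OF A, of "\<phi>1 s"]]\<close>)
    qed
    show "(\<integral>t. h (\<phi>1 s) (\<phi>1 t) \<partial>N) \<le> E' s + (\<integral>t. E' t \<partial>N)" if "s \<in> space N" for s
    proof -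
      have "(\<integral>t. h (\<phi>1 s) (\<phi>1 t) \<partial>N) \<le> (\<integral>t. E' s + E' t \<partial>N)"
        using hE that E'i hi by (intro integral_mono) auto
      then show ?thesis using E'i by (simp add: N.prob_space)
    qed
  qed (use E'i in auto)
  also have "\<dots> = 2 * (\<integral>t. E' t \<partial>N)" using E'i by (simp add: N.prob_space)
  \<comment> \<open>Each of the two points carries the errors for \<open>A\<close> and for the full
    vertex set: four errors with mean at most \<open>e\<close>.\<close>
  also have "(\<integral>t. E' t \<partial>N) \<le> 2 * e"
    unfolding E'_def using Ei[OF A] Ei[of "pverts G"] E[OF A] E[of "pverts G"] by simp
  finally have sum: "(\<Sum>v\<in>pverts G. \<Sum>w\<in>pverts G. h v w) \<le> 4 * e * n ^ 2"
    using n by (simp add: sum_divide_distrib[symmetric] field_simps power2_eq_square)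
  have "(\<Sum>(v, w) \<in> {(v, w) \<in> pverts G \<times> pverts G. (v, w) \<in> r \<and> v \<noteq> w}.
        max (real (nbrs_in G v (A - {v, w})) - real (nbrs_in G w (A - {v, w}))) 0)
     \<le> (\<Sum>(v, w) \<in> {(v, w) \<in> pverts G \<times> pverts G. (v, w) \<in> r \<and> v \<noteq> w}. n * h v w + 1)"
  proof (rule sum_mono, clarify)
    fix v w assume vw: "(v, w) \<in> r"
    have "d (pverts G) v \<le> d (pverts G) w" using r(2)[OF vw] n by (simp add: d_def divide_right_mono)
    then have h: "n * h v w = max (real (nbrs_in G v A) - real (nbrs_in G w A)) 0"
      using n by (simp add: h_def d_def diff_divide_distrib[symmetric] max_def field_simps)
    have "finite A" using A fin by (rule finite_subset)
    note rem = nbrs_in_remove2[OF this]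
    have "nbrs_in G v (A - {v, w}) \<le> nbrs_in G v A" "nbrs_in G w A \<le> nbrs_in G w (A - {v, w}) + 1"
      using rem(1)[of G v w] rem(3)[of w G v] no_loops' by auto
    then show "max (real (nbrs_in G v (A - {v, w})) - real (nbrs_in G w (A - {v, w}))) 0 \<le> n * h v w + 1"
      unfolding h by linarith
  qed
  also have "\<dots> \<le> (\<Sum>(v, w) \<in> pverts G \<times> pverts G. n * h v w + 1)"
    by (rule sum_mono2) (use fin n in \<open>auto simp: h_def\<close>)
  also have "\<dots> = n * (\<Sum>v\<in>pverts G. \<Sum>w\<in>pverts G. h v w) + n ^ 2"
    by (simp add: sum.cartesian_product[symmetric] sum.distrib sum_distrib_left n_def power2_eq_square)
  also have "\<dots> \<le> n * (4 * e * n ^ 2) + n ^ 2" using sum n by simp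
  finally show ?thesis
    unfolding Omega0_order_set_def n_def[symmetric] using n by (simp add: field_simps power3_eq_cube power2_eq_square)
qed

lemma Omega0_le_cut_dist:
  assumes G: "pair_graph G" and ne: "pverts G \<noteq> {}" and V: "monotone_kernel V"
    and e: "cut_dist (vertex_space G) (adjacency G) unit_interval V < e"
  shows "Omega0 G \<le> 4 * e + 1 / real (card (pverts G))"
proof -
  interpret pair_graph G by fact
  have fin: "finite (pverts G)" by simp
  obtain N :: "('a \<times> real) measure" and \<phi>1 \<phi>2 where N: "prob_space N" "measure_preserving_map N (vertex_space G) \<phi>1"
    "measure_preserving_map N unit_interval \<phi>2"
    "cut_norm N (\<lambda>x y. adjacency G (\<phi>1 x) (\<phi>1 y) - V (\<phi>2 x) (\<phi>2 y)) < e"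
    by (rule cut_dist_ex[OF prob_space_vertex_space[OF fin ne] prob_space_unit_interval e])
  obtain r where r: "linear_order_on (pverts G) r"
    "\<And>v w. (v, w) \<in> r \<Longrightarrow> real (nbrs_in G v (pverts G)) \<le> real (nbrs_in G w (pverts G))"
    by (rule ex_linear_order_by_key[OF fin, of "\<lambda>v. real (nbrs_in G v (pverts G))"]) blast
  show ?thesis
    using Omega0_order_set_le_degree_order[OF G ne N(1-3) V _ r(1)] N(4) r(2)
    by (intro Omega0_le[OF fin r(1)]) auto
qed

section \<open>Block means of almost monotone functions\<close>

interpretation unit_pair: pair_sigma_finite unit_interval unit_interval ..
interpretation unit_square: prob_space "unit_interval \<Otimes>\<^sub>M unit_interval" by (rule unit_interval.pair_prob)

lemma measurable_id_unit_interval [measurable]: "(\<lambda>x. x) \<in> borel_measurable unit_interval"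
  by (rule measurable_unit_interval) simp

lemma measurable_fst_unit_square [measurable]: "fst \<in> borel_measurable (unit_interval \<Otimes>\<^sub>M unit_interval)"
  using measurable_compose[OF measurable_fst measurable_id_unit_interval] by simp

lemma measurable_snd_unit_square [measurable]: "snd \<in> borel_measurable (unit_interval \<Otimes>\<^sub>M unit_interval)"
  using measurable_compose[OF measurable_snd measurable_id_unit_interval] by simp

lemma space_unit_square: "space (unit_interval \<Otimes>\<^sub>M unit_interval) = {0..1} \<times> {0..1}"
  by (simp add: space_pair_measure space_unit_interval)

lemma integral_unit_interval_indicator:
  assumes "A \<in> sets borel" "A \<subseteq> {0..1}"
  shows "(\<integral>x. indicator A x \<partial>unit_interval) = measure lborel A"
proof -
  have "A \<in> sets unit_interval"
    using assms by (auto simp: sets_unit_interval sets_restrict_space intro!: image_eqI[of _ _ A])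
  moreover have "measure unit_interval A = measure lborel A"
    using emeasure_unit_interval[OF assms] by (simp add: measure_def)
  ultimately show ?thesis by simp
qed

text \<open>For numbers a and b the absolute difference equals
  \<open>2 * max (a - b) 0 + (b - a)\<close>. On the strip above the diagonal the first part
  integrates to at most \<open>2 * e\<close>. In the signed part almost everything cancels, since a
  point is the upper end of pairs of total measure at most h, and the lower end of measure h unless
  it lies within h of 1. The factor 2 in front accounts for the strip below the diagonal.\<close>

lemma local_variation_le:
  fixes d :: "real \<Rightarrow> real"
  assumes dm[measurable]: "d \<in> borel_measurable unit_interval"
    and d01: "\<And>x. x \<in> {0..1} \<Longrightarrow> 0 \<le> d x \<and> d x \<le> 1"
    and e: "(\<integral>p. (if fst p < snd p then max (d (fst p) - d (snd p)) 0 else 0) \<partial>(unit_interval \<Otimes>\<^sub>M unit_interval)) \<le> e"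
    and h: "0 < h" "h \<le> 1"
  shows "(\<integral>p. (if \<bar>fst p - snd p\<bar> \<le> h then \<bar>d (fst p) - d (snd p)\<bar> else 0) \<partial>(unit_interval \<Otimes>\<^sub>M unit_interval)) \<le> 2 * (2 * e + h ^ 2)"
proof -
  let ?U = "unit_interval" and ?P = "unit_interval \<Otimes>\<^sub>M unit_interval"
  define r where "r p = (if fst p < snd p \<and> snd p \<le> fst p + h then 1 else 0 :: real)" for p :: "real \<times> real"
  have rm[measurable]: "r \<in> borel_measurable ?P" unfolding r_def[abs_def] by measurable
  define pos where "pos p = (if fst p < snd p then max (d (fst p) - d (snd p)) 0 else 0)" for p
  have posm[measurable]: "pos \<in> borel_measurable ?P" unfolding pos_def[abs_def] by measurable
  have dp: "0 \<le> d (fst p)" "d (fst p) \<le> 1" "0 \<le> d (snd p)" "d (snd p) \<le> 1" if "p \<in> space ?P" for p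
    using that d01[of "fst p"] d01[of "snd p"] by (auto simp: space_unit_square)
  have ipos: "integrable ?P pos"
  proof (rule unit_square.integrable_bounded[where C = 1])
    show "\<bar>pos p\<bar> \<le> 1" if "p \<in> space ?P" for p
      using dp[OF that] by (auto simp: pos_def)
  qed measurable
  have i1a: "integrable ?P (\<lambda>p. r p * d (fst p))"
  proof (rule unit_square.integrable_bounded[where C = 1])
    show "\<bar>r p * d (fst p)\<bar> \<le> 1" if "p \<in> space ?P" for p
      using dp[OF that] by (auto simp: r_def)
  qed measurable
  have i1b: "integrable ?P (\<lambda>p. r p * d (snd p))"
  proof (rule unit_square.integrable_bounded[where C = 1])
    show "\<bar>r p * d (snd p)\<bar> \<le> 1" if "p \<in> space ?P" for p
      using dp[OF that] by (auto simp: r_def)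
  qed measurable
  note i1 = i1a i1b
  have iabs: "integrable ?P (\<lambda>p. r p * \<bar>d (fst p) - d (snd p)\<bar>)"
  proof (rule unit_square.integrable_bounded[where C = 1])
    show "\<bar>r p * \<bar>d (fst p) - d (snd p)\<bar>\<bar> \<le> 1" if "p \<in> space ?P" for p
      using dp[OF that] by (auto simp: r_def)
  qed measurable
  have ihd: "integrable ?U (\<lambda>x. h * d x)"
    using d01 by (intro integrable_mult_right unit_interval.integrable_bounded[where C = 1]) (auto simp: space_unit_interval)
  have ibd: "integrable ?U (\<lambda>x. (if x \<le> 1 - h then h else 0) * d x)"
  proof (rule Bochner_Integration.integrable_bound[OF ihd])
    show "AE x in ?U. norm ((if x \<le> 1 - h then h else 0) * d x) \<le> norm (h * d x)" by (rule AE_I2) auto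
  qed measurable
  have alpha: "(\<integral>x. r (x, y) \<partial>?U) \<le> h" if y: "y \<in> {0..1}" for y
  proof -
    have "(\<integral>x. r (x, y) \<partial>?U) = (\<integral>x. indicator ({y - h..<y} \<inter> {0..1}) x \<partial>?U)"
      by (rule Bochner_Integration.integral_cong) (auto simp: r_def indicator_def space_unit_interval)
    also have "\<dots> = measure lborel ({y - h..<y} \<inter> {0..1})"
      by (rule integral_unit_interval_indicator) auto
    also have "\<dots> \<le> measure lborel {y - h..<y}"
      by (rule measure_mono_fmeasurable) (use h in \<open>auto simp: fmeasurable_def\<close>)
    finally show ?thesis using h by simp
  qed
  \<comment> \<open>Lower bound for the pairs with lower end x. Only points within h of the right
    end miss part of the strip; bounding them by 0 costs at most h on a set of length h.\<close>
  have beta: "(if x \<le> 1 - h then h else 0) \<le> (\<integral>y. r (x, y) \<partial>?U)" if x: "x \<in> {0..1}" for x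
  proof (cases "x \<le> 1 - h")
    case True
    have "(\<integral>y. r (x, y) \<partial>?U) = (\<integral>y. indicator {x<..x + h} y \<partial>?U)"
      by (rule Bochner_Integration.integral_cong) (auto simp: r_def indicator_def)
    also have "\<dots> = measure lborel {x<..x + h}"
      by (rule integral_unit_interval_indicator) (use True x in auto)
    finally show ?thesis using True h by simp
  next
    case False
    have "0 \<le> (\<integral>y. r (x, y) \<partial>?U)" by (rule Bochner_Integration.integral_nonneg) (simp add: r_def)
    then show ?thesis using False by simp
  qed
  have "(\<integral>p. r p * d (snd p) \<partial>?P) = (\<integral>y. (\<integral>x. r (x, y) * d y \<partial>?U) \<partial>?U)"
    using unit_pair.integral_snd[of "\<lambda>x y. r (x, y) * d y"] i1(2) by (simp add: case_prod_beta')
  also have "\<dots> \<le> (\<integral>y. h * d y \<partial>?U)"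
  proof (rule integral_mono)
    show "integrable ?U (\<lambda>y. \<integral>x. r (x, y) * d y \<partial>?U)"
      using unit_pair.integrable_snd[of "\<lambda>x y. r (x, y) * d y"] i1(2) by (simp add: case_prod_beta')
    show "integrable ?U (\<lambda>y. h * d y)" by (rule ihd)
    show "(\<integral>x. r (x, y) * d y \<partial>?U) \<le> h * d y" if "y \<in> space ?U" for y
      using alpha[of y] d01[of y] that by (simp add: space_unit_interval mult_right_mono)
  qed
  finally have 1: "(\<integral>p. r p * d (snd p) \<partial>?P) \<le> (\<integral>y. h * d y \<partial>?U)" .
  have "(\<integral>x. (if x \<le> 1 - h then h else 0) * d x \<partial>?U) \<le> (\<integral>x. (\<integral>y. r (x, y) * d x \<partial>?U) \<partial>?U)"
  proof (rule integral_mono)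
    show "integrable ?U (\<lambda>x. \<integral>y. r (x, y) * d x \<partial>?U)"
      using unit_pair.integrable_fst[of "\<lambda>x y. r (x, y) * d x"] i1(1) by (simp add: case_prod_beta')
    show "integrable ?U (\<lambda>x. (if x \<le> 1 - h then h else 0) * d x)" by (rule ibd)
    show "(if x \<le> 1 - h then h else 0) * d x \<le> (\<integral>y. r (x, y) * d x \<partial>?U)" if "x \<in> space ?U" for x
      using mult_right_mono[OF beta[of x], of "d x"] d01[of x] that by (simp add: space_unit_interval)
  qed
  also have "\<dots> = (\<integral>p. r p * d (fst p) \<partial>?P)"
    using unit_pair.integral_fst[of "\<lambda>x y. r (x, y) * d x"] i1(1) by (simp add: case_prod_beta')
  finally have 2: "(\<integral>x. (if x \<le> 1 - h then h else 0) * d x \<partial>?U) \<le> (\<integral>p. r p * d (fst p) \<partial>?P)" .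
  have "(\<integral>y. h * d y \<partial>?U) - (\<integral>x. (if x \<le> 1 - h then h else 0) * d x \<partial>?U)
      = (\<integral>x. h * d x - (if x \<le> 1 - h then h else 0) * d x \<partial>?U)"
    using ihd ibd by (intro Bochner_Integration.integral_diff[symmetric])
  also have "\<dots> \<le> (\<integral>x. h * indicator {1 - h<..1} x \<partial>?U)"
  proof (rule integral_mono)
    show "integrable ?U (\<lambda>x. h * d x - (if x \<le> 1 - h then h else 0) * d x)"
      using ihd ibd by (intro Bochner_Integration.integrable_diff)
    show "integrable ?U (\<lambda>x. h * indicator {1 - h<..1} x)"
      using h by (intro unit_interval.integrable_bounded[where C = "h"]) (auto simp: indicator_def)
    show "h * d x - (if x \<le> 1 - h then h else 0) * d x \<le> h * indicator {1 - h<..1} x" if "x \<in> space ?U" for x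
      using that d01[of x] h by (auto simp: space_unit_interval indicator_def)
  qed
  also have "\<dots> = h * h"
  proof -
    have "{1 - h<..1} \<subseteq> {0..1}" using h by auto
    then show ?thesis using integral_unit_interval_indicator[of "{1 - h<..1}"] h by simp
  qed
  finally have signed: "(\<integral>p. r p * d (snd p) \<partial>?P) - (\<integral>p. r p * d (fst p) \<partial>?P) \<le> h * h"
    using 1 2 by linarith
  define T where "T = (\<integral>p. r p * \<bar>d (fst p) - d (snd p)\<bar> \<partial>?P)"
  have "T \<le> (\<integral>p. 2 * pos p + (r p * d (snd p) - r p * d (fst p)) \<partial>?P)"
    unfolding T_def
  proof (rule integral_mono[OF iabs])
    show "r p * \<bar>d (fst p) - d (snd p)\<bar> \<le> 2 * pos p + (r p * d (snd p) - r p * d (fst p))" for p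
    proof (cases "fst p < snd p \<and> snd p \<le> fst p + h")
      case True
      then have "r p = 1" "pos p = max (d (fst p) - d (snd p)) 0" by (auto simp: r_def pos_def)
      then show ?thesis by (simp add: max_def)
    next
      case False
      then have "r p = 0" "0 \<le> pos p" by (auto simp: r_def pos_def)
      then show ?thesis by simp
    qed
  qed (use ipos i1 in auto)
  also have "\<dots> = 2 * (\<integral>p. pos p \<partial>?P) + ((\<integral>p. r p * d (snd p) \<partial>?P) - (\<integral>p. r p * d (fst p) \<partial>?P))"
    using ipos i1 by simp
  also have "\<dots> \<le> 2 * e + h * h" using signed e by (simp add: pos_def)
  finally have T: "T \<le> 2 * e + h ^ 2" by (simp add: power2_eq_square)
  have swap: "(\<integral>p. r (snd p, fst p) * \<bar>d (fst p) - d (snd p)\<bar> \<partial>?P) = T"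
    unfolding T_def by (subst unit_pair.integral_product_swap[symmetric])
      (auto simp: case_prod_beta' abs_minus_commute)
  have iabs': "integrable ?P (\<lambda>p. r (snd p, fst p) * \<bar>d (fst p) - d (snd p)\<bar>)"
  proof (rule unit_square.integrable_bounded[where C = 1])
    show "\<bar>r (snd p, fst p) * \<bar>d (fst p) - d (snd p)\<bar>\<bar> \<le> 1" if "p \<in> space ?P" for p
      using dp[OF that] by (auto simp: r_def)
  qed measurable
  have "(\<integral>p. (if \<bar>fst p - snd p\<bar> \<le> h then \<bar>d (fst p) - d (snd p)\<bar> else 0) \<partial>?P)
     = (\<integral>p. r p * \<bar>d (fst p) - d (snd p)\<bar> + r (snd p, fst p) * \<bar>d (fst p) - d (snd p)\<bar> \<partial>?P)"
  proof (rule Bochner_Integration.integral_cong)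
    fix p :: "real \<times> real"
    show "(if \<bar>fst p - snd p\<bar> \<le> h then \<bar>d (fst p) - d (snd p)\<bar> else 0)
      = r p * \<bar>d (fst p) - d (snd p)\<bar> + r (snd p, fst p) * \<bar>d (fst p) - d (snd p)\<bar>"
      by (cases "fst p" "snd p" rule: linorder_cases) (auto simp: r_def)
  qed simp
  also have "\<dots> = 2 * T" using iabs iabs' swap by (simp add: T_def)
  finally show ?thesis using T by simp
qed


section \<open>Averaging over equal blocks\<close>

text \<open>The last block also contains the right end point, so that the blocks partition the closed interval.\<close>

definition block :: "nat \<Rightarrow> nat \<Rightarrow> real set" where
  "block k i = {real i / real k..<(real i + 1) / real k} \<union> (if Suc i = k then {1} else {})"

lemma block_bounds: "x \<in> block k i \<Longrightarrow> k > 0 \<Longrightarrow> real i / real k \<le> x \<and> x \<le> (real i + 1) / real k"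
  by (auto simp: block_def divide_le_eq_1 split: if_splits)

lemma block_less: "x \<in> block k i \<Longrightarrow> x < 1 \<Longrightarrow> x < (real i + 1) / real k"
  by (auto simp: block_def split: if_splits)

lemma block_subset: "i < k \<Longrightarrow> block k i \<subseteq> {0..1}"
proof
  fix x assume i: "i < k" and x: "x \<in> block k i"
  have "(real i + 1) / real k \<le> 1" using i by (simp add: divide_le_eq_1)
  moreover have "0 \<le> real i / real k" by simp
  ultimately show "x \<in> {0..1}" using block_bounds[OF x] i unfolding atLeastAtMost_iff by linarith
qed

lemma block_sets [measurable]: "block k i \<in> sets borel"
  by (auto simp: block_def)

lemma indicator_block_measurable [measurable]: "indicator (block k i) \<in> borel_measurable unit_interval"
  by (rule measurable_unit_interval) simp

lemma block_unique:
  assumes "x \<in> block k i" "x \<in> block k j" "i < k" "j < k" shows "i = j"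
proof -
  have *: "i \<le> j" if ij: "x \<in> block k i" "x \<in> block k j" "i < k" "j < k" for i j
  proof (cases "x < 1")
    case True
    have "real i / real k < (real j + 1) / real k"
      using block_bounds[OF ij(1)] block_less[OF ij(2) True] ij by linarith
    then show ?thesis using ij by (simp add: divide_less_cancel)
  next
    case False
    then have "\<not> x < (real j + 1) / real k" using ij by (auto simp: not_less divide_le_eq_1 intro: order_trans[of _ 1])
    then have "Suc j = k" using ij(2) by (auto simp: block_def split: if_splits)
    then show ?thesis using ij by simp
  qed
  show ?thesis using *[of i j] *[of j i] assms by simp
qed

lemma block_exists:
  assumes "x \<in> {0..1}" "k > 0" obtains i where "i < k" "x \<in> block k i"
proof (cases "x = 1")
  case True
  show thesis by (rule that[of "k - 1"]) (use True assms in \<open>auto simp: block_def\<close>)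
next
  case False
  define i where "i = nat \<lfloor>real k * x\<rfloor>"
  have i: "real i \<le> real k * x" "real k * x < real i + 1" using assms by (auto simp: i_def)
  have "real k * x < real k * 1" using False assms by (intro mult_strict_left_mono) auto
  then have "i < k" using i by linarith
  moreover have "x \<in> block k i" using i assms by (auto simp: block_def field_simps)
  ultimately show thesis using that by blast
qed

lemma sum_block:
  fixes F :: "nat \<Rightarrow> real"
  assumes "i < k" "x \<in> block k i"
  shows "(\<Sum>j<k. F j * indicator (block k j) x) = F i"
proof -
  have "(\<Sum>j<k. F j * indicator (block k j) x) = (\<Sum>j<k. if j = i then F i else 0)"
    using assms block_unique[of x k] by (intro sum.cong) (auto simp: indicator_def)
  then show ?thesis using assms by simp
qed

lemma integral_block:
  assumes "i < k" shows "(\<integral>x. indicator (block k i) x \<partial>unit_interval) = 1 / real k"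
proof -
  have "(\<integral>x. indicator (block k i) x \<partial>unit_interval) = measure lborel (block k i)"
    by (rule integral_unit_interval_indicator) (use block_subset[OF assms] in auto)
  also have "\<dots> = measure lborel {real i / real k..<(real i + 1) / real k}"
  proof -
    have "{1::real} \<in> null_sets lborel" by (simp add: null_sets_def)
    from measure_Un_null_set[OF _ this, of "{real i / real k..<(real i + 1) / real k}"]
    show ?thesis unfolding block_def by (cases "Suc i = k") (simp_all only: if_True if_False Un_empty_right, simp)
  qed
  also have "\<dots> = 1 / real k"
    using assms by (simp add: divide_right_mono diff_divide_distrib[symmetric])
  finally show ?thesis .
qed

lemma test_function_block: "test_function unit_interval (indicator (block k i))"
  unfolding test_function_def using indicator_block_measurable by (auto split: split_indicator)

text \<open>The conditional expectation with respect to the partition into k blocks, each of measure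
  1/k.\<close>

definition block_mean :: "nat \<Rightarrow> (real \<Rightarrow> real) \<Rightarrow> real \<Rightarrow> real" where
  "block_mean k f x = (\<Sum>i<k. (real k * (\<integral>z. f z * indicator (block k i) z \<partial>unit_interval)) * indicator (block k i) x)"

lemma block_mean_measurable [measurable]: "block_mean k f \<in> borel_measurable unit_interval"
  unfolding block_mean_def[abs_def] by measurable

lemma integrable_times_block:
  fixes f :: "real \<Rightarrow> real"
  assumes "integrable unit_interval f"
  shows "integrable unit_interval (\<lambda>z. f z * indicator (block k i) z)"
proof (rule Bochner_Integration.integrable_bound[OF assms])
  show "AE x in unit_interval. norm (f x * indicator (block k i) x) \<le> norm (f x)"
    by (rule AE_I2) (auto simp: indicator_def)
qed (use assms in measurable)

lemma test_function_integrable: "test_function unit_interval f \<Longrightarrow> integrable unit_interval f"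
  by (rule unit_interval.integrable_bounded[where C = 1]) (auto simp: test_function_def)

lemma test_function_block_mean:
  assumes f: "test_function unit_interval f" and k: "k > 0"
  shows "test_function unit_interval (block_mean k f)"
proof -
  have "\<bar>block_mean k f x\<bar> \<le> 1" if x: "x \<in> {0..1}" for x
  proof -
    obtain i where i: "i < k" "x \<in> block k i" using block_exists[OF x k] .
    have "\<bar>\<integral>z. f z * indicator (block k i) z \<partial>unit_interval\<bar> \<le> (\<integral>z. \<bar>f z * indicator (block k i) z\<bar> \<partial>unit_interval)"
      by (rule integral_abs_bound)
    also have "\<dots> \<le> (\<integral>z. indicator (block k i) z \<partial>unit_interval)"
      using integrable_times_block[OF test_function_integrable[OF f]] test_function_integrable[OF test_function_block] f
      by (intro integral_mono) (auto simp: test_function_def split: split_indicator)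
    also have "\<dots> = 1 / real k" by (rule integral_block[OF i(1)])
    finally show ?thesis unfolding block_mean_def sum_block[OF i] using k by (simp add: abs_mult field_simps)
  qed
  then show ?thesis by (auto simp: test_function_def space_unit_interval)
qed

text \<open>The right-hand side is symmetric in \<open>f\<close> and \<open>g\<close>, that is,
  averaging is self-adjoint. This lets the averaging move from a test function to a degree
  function.\<close>

lemma integral_block_mean:
  assumes f: "integrable unit_interval f" and g: "integrable unit_interval g"
  shows "(\<integral>x. block_mean k f x * g x \<partial>unit_interval) = (\<Sum>i<k. real k *
    (\<integral>z. f z * indicator (block k i) z \<partial>unit_interval) * (\<integral>z. g z * indicator (block k i) z \<partial>unit_interval))"
proof -
  have "(\<integral>x. block_mean k f x * g x \<partial>unit_interval)
      = (\<integral>x. (\<Sum>i<k. (real k * (\<integral>z. f z * indicator (block k i) z \<partial>unit_interval)) * (g x * indicator (block k i) x)) \<partial>unit_interval)"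
    unfolding block_mean_def sum_distrib_right
    by (intro Bochner_Integration.integral_cong sum.cong) (simp_all add: ac_simps)
  also have "\<dots> = (\<Sum>i<k. \<integral>x. (real k * (\<integral>z. f z * indicator (block k i) z \<partial>unit_interval)) * (g x * indicator (block k i) x) \<partial>unit_interval)"
    using integrable_times_block[OF g] by (intro Bochner_Integration.integral_sum integrable_mult_right)
  finally show ?thesis by simp
qed

text \<open>The deviation of \<open>d x\<close> from the mean of its block is at most k times the
  integral of \<open>\<bar>d x - d y\<bar>\<close> over that block, and a block has width 1/k. The
  strip bound with h = 1/k thus applies, multiplied by k.\<close>

lemma block_mean_error:
  fixes d :: "real \<Rightarrow> real"
  assumes dm[measurable]: "d \<in> borel_measurable unit_interval"
    and d01: "\<And>x. x \<in> {0..1} \<Longrightarrow> 0 \<le> d x \<and> d x \<le> 1"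
    and e: "(\<integral>p. (if fst p < snd p then max (d (fst p) - d (snd p)) 0 else 0) \<partial>(unit_interval \<Otimes>\<^sub>M unit_interval)) \<le> e"
    and k: "k > 0"
  shows "(\<integral>x. \<bar>d x - block_mean k d x\<bar> \<partial>unit_interval) \<le> 2 * real k * (2 * e + 1 / (real k)\<^sup>2)"
proof -
  let ?U = "unit_interval"
  define q where "q x y = (if \<bar>x - y\<bar> \<le> 1 / real k then \<bar>d x - d y\<bar> else 0)" for x y
  have qm: "(\<lambda>(x, y). q x y) \<in> borel_measurable (?U \<Otimes>\<^sub>M ?U)"
    unfolding q_def[abs_def] case_prod_beta' by measurable
  have q1: "\<bar>q x y\<bar> \<le> 1" if "x \<in> {0..1}" "y \<in> {0..1}" for x y
    using d01[OF that(1)] d01[OF that(2)] by (auto simp: q_def)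
  have qi: "integrable (?U \<Otimes>\<^sub>M ?U) (\<lambda>(x, y). q x y)"
    by (rule unit_square.integrable_bounded[where C = 1, OF qm]) (use q1 in \<open>auto simp: space_unit_square\<close>)
  have qxi: "integrable ?U (q x)" if "x \<in> {0..1}" for x
  proof (rule unit_interval.integrable_bounded[where C = 1])
    show "q x \<in> borel_measurable ?U" unfolding q_def[abs_def] by measurable
  qed (use q1[OF that] in \<open>auto simp: space_unit_interval\<close>)
  have di: "integrable ?U d"
    using d01 by (intro unit_interval.integrable_bounded[where C = 1]) (auto simp: space_unit_interval)
  have le: "\<bar>d x - block_mean k d x\<bar> \<le> real k * (\<integral>y. q x y \<partial>?U)" if x: "x \<in> {0..1}" for x
  proof -
    obtain i where i: "i < k" "x \<in> block k i" using block_exists[OF x k] .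
    have ib: "integrable ?U (indicator (block k i) :: real \<Rightarrow> real)" by (rule test_function_integrable[OF test_function_block])
    have "d x - block_mean k d x = d x * (real k * (\<integral>y. indicator (block k i) y \<partial>?U)) - real k * (\<integral>y. d y * indicator (block k i) y \<partial>?U)"
      unfolding block_mean_def sum_block[OF i] integral_block[OF i(1)] using k by simp
    also have "\<dots> = real k * ((\<integral>y. d x * indicator (block k i) y \<partial>?U) - (\<integral>y. d y * indicator (block k i) y \<partial>?U))"
      by (simp add: right_diff_distrib)
    also have "(\<integral>y. d x * indicator (block k i) y \<partial>?U) - (\<integral>y. d y * indicator (block k i) y \<partial>?U)
        = (\<integral>y. d x * indicator (block k i) y - d y * indicator (block k i) y \<partial>?U)"
      using ib integrable_times_block[OF di] by (intro Bochner_Integration.integral_diff[symmetric]) auto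
    finally have eq: "d x - block_mean k d x = real k * (\<integral>y. (d x - d y) * indicator (block k i) y \<partial>?U)"
      by (simp add: left_diff_distrib)
    have "\<bar>\<integral>y. (d x - d y) * indicator (block k i) y \<partial>?U\<bar> \<le> (\<integral>y. \<bar>(d x - d y) * indicator (block k i) y\<bar> \<partial>?U)"
      by (rule integral_abs_bound)
    also have "\<dots> \<le> (\<integral>y. q x y \<partial>?U)"
    proof (rule integral_mono)
      have "integrable ?U (\<lambda>y. d x - d y)" using di by auto
      from integrable_times_block[OF this]
      show "integrable ?U (\<lambda>y. \<bar>(d x - d y) * indicator (block k i) y\<bar>)" by auto
      show "integrable ?U (q x)" by (rule qxi[OF x])
      show "\<bar>(d x - d y) * indicator (block k i) y\<bar> \<le> q x y" for y
      proof (cases "y \<in> block k i")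
        case True
        have "(real i + 1) / real k = real i / real k + 1 / real k" by (simp add: add_divide_distrib)
        then have "\<bar>x - y\<bar> \<le> 1 / real k"
          using block_bounds[OF True k] block_bounds[OF i(2) k] by linarith
        then show ?thesis using True by (simp add: q_def)
      qed (simp add: q_def)
    qed
    finally show ?thesis unfolding eq using k by (simp add: abs_mult)
  qed
  have "(\<integral>x. \<bar>d x - block_mean k d x\<bar> \<partial>?U) \<le> (\<integral>x. real k * (\<integral>y. q x y \<partial>?U) \<partial>?U)"
  proof (rule integral_mono_AE')
    show "integrable ?U (\<lambda>x. real k * (\<integral>y. q x y \<partial>?U))"
      using unit_pair.integrable_fst'[OF qi] by simp
    show "AE x in ?U. \<bar>d x - block_mean k d x\<bar> \<le> real k * (\<integral>y. q x y \<partial>?U)"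
      by (rule AE_I2) (use le in \<open>simp add: space_unit_interval\<close>)
    show "AE x in ?U. 0 \<le> real k * (\<integral>y. q x y \<partial>?U)"
      by (rule AE_I2) (simp add: q_def)
  qed
  also have "\<dots> = real k * (\<integral>p. q (fst p) (snd p) \<partial>(?U \<Otimes>\<^sub>M ?U))"
    using unit_pair.integral_fst'[OF qi] by (simp add: case_prod_beta')
  also have "\<dots> \<le> real k * (2 * (2 * e + (1 / real k)\<^sup>2))"
    unfolding q_def using local_variation_le[OF dm d01 e, of "1 / real k"] k by (intro mult_left_mono) auto
  finally show ?thesis by (simp add: power_one_over algebra_simps)
qed

section \<open>Step kernels approximating almost monotone kernels\<close>

definition kernel_degree :: "(real \<Rightarrow> real \<Rightarrow> real) \<Rightarrow> (real \<Rightarrow> real) \<Rightarrow> real \<Rightarrow> real" where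
  "kernel_degree H a x = (\<integral>y. H x y * a y \<partial>unit_interval)"

text \<open>The analogue of a bound on \<open>Omega0\<close> for the natural order of the interval,
  with weights between 0 and 1 in place of vertex sets.\<close>

definition almost_monotone :: "(real \<Rightarrow> real \<Rightarrow> real) \<Rightarrow> real \<Rightarrow> bool" where
  "almost_monotone H e \<longleftrightarrow> (\<forall>a. test_function unit_interval a \<longrightarrow> (\<forall>x\<in>{0..1}. 0 \<le> a x) \<longrightarrow>
     (\<integral>p. (if fst p < snd p then max (kernel_degree H a (fst p) - kernel_degree H a (snd p)) 0 else 0)
        \<partial>(unit_interval \<Otimes>\<^sub>M unit_interval)) \<le> e)"

lemma kernel_section_measurable:
  assumes H: "is_kernel unit_interval H" and x: "x \<in> {0..1}"
  shows "(\<lambda>y. H x y) \<in> borel_measurable unit_interval"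
proof -
  have "(\<lambda>(x, y). H x y) \<in> borel_measurable (unit_interval \<Otimes>\<^sub>M unit_interval)"
    using H by (simp add: is_kernel_def)
  from measurable_compose[OF measurable_Pair1' this, of x] x show ?thesis by (simp add: space_unit_interval)
qed

lemma kernel_section_integrable:
  assumes H: "is_kernel unit_interval H" and x: "x \<in> {0..1}" and a: "test_function unit_interval a"
  shows "integrable unit_interval (\<lambda>y. H x y * a y)"
proof (rule unit_interval.integrable_bounded[where C = 1])
  have [measurable]: "(\<lambda>y. H x y) \<in> borel_measurable unit_interval" "a \<in> borel_measurable unit_interval"
    using kernel_section_measurable[OF H x] a by (auto simp: test_function_def)
  show "(\<lambda>y. H x y * a y) \<in> borel_measurable unit_interval" by measurable
  fix y assume y: "y \<in> space unit_interval"
  then have "\<bar>H x y\<bar> * \<bar>a y\<bar> \<le> 1 * 1"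
    using H x a by (intro mult_mono) (auto simp: is_kernel_def test_function_def space_unit_interval)
  then show "\<bar>H x y * a y\<bar> \<le> 1" by (simp add: abs_mult)
qed

lemma kernel_degree_measurable:
  assumes H: "is_kernel unit_interval H" and a: "test_function unit_interval a"
  shows "kernel_degree H a \<in> borel_measurable unit_interval"
proof -
  have [measurable]: "(\<lambda>(x, y). H x y) \<in> borel_measurable (unit_interval \<Otimes>\<^sub>M unit_interval)" "a \<in> borel_measurable unit_interval"
    using H a by (auto simp: is_kernel_def test_function_def)
  show ?thesis unfolding kernel_degree_def[abs_def] by measurable
qed

lemma kernel_degree_test_function:
  assumes H: "is_kernel unit_interval H" and a: "test_function unit_interval a"
  shows "test_function unit_interval (kernel_degree H a)"
proof -
  have "\<bar>kernel_degree H a x\<bar> \<le> 1" if x: "x \<in> {0..1}" for x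
    unfolding kernel_degree_def
  proof (rule unit_interval.abs_integral_bounded_le)
    fix y assume y: "y \<in> space unit_interval"
    then have "\<bar>H x y\<bar> * \<bar>a y\<bar> \<le> 1 * 1"
      using H x a by (intro mult_mono) (auto simp: is_kernel_def test_function_def space_unit_interval)
    then show "\<bar>H x y * a y\<bar> \<le> 1" by (simp add: abs_mult)
  qed simp
  then show ?thesis using kernel_degree_measurable[OF assms] by (simp add: test_function_def space_unit_interval)
qed

lemma kernel_degree_nonneg:
  assumes "is_kernel unit_interval H" "\<And>y. y \<in> {0..1} \<Longrightarrow> 0 \<le> a y" "x \<in> {0..1}"
  shows "0 \<le> kernel_degree H a x"
  unfolding kernel_degree_def using assms
  by (intro Bochner_Integration.integral_nonneg) (auto simp: is_kernel_def space_unit_interval)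

lemma cut_form_kernel_degree:
  assumes "is_kernel unit_interval H" "test_function unit_interval f" "test_function unit_interval g"
  shows "cut_form unit_interval H f g = (\<integral>x. kernel_degree H g x * f x \<partial>unit_interval)"
  using assms by (simp add: unit_interval.cut_form_iterated is_kernel_bounded kernel_degree_def)

lemma cut_form_commute:
  assumes H: "is_kernel unit_interval H" and f: "test_function unit_interval f" and g: "test_function unit_interval g"
  shows "cut_form unit_interval H f g = cut_form unit_interval H g f"
proof -
  have [measurable]: "(\<lambda>(x, y). H x y) \<in> borel_measurable (unit_interval \<Otimes>\<^sub>M unit_interval)"
    "f \<in> borel_measurable unit_interval" "g \<in> borel_measurable unit_interval"
    using H f g by (auto simp: is_kernel_def test_function_def)
  have "cut_form unit_interval H f g = (\<integral>(x, y). (\<lambda>(x, y). H x y * f x * g y) (y, x) \<partial>(unit_interval \<Otimes>\<^sub>M unit_interval))"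
    unfolding cut_form_def by (rule unit_pair.integral_product_swap[symmetric]) measurable
  also have "\<dots> = cut_form unit_interval H g f"
    unfolding cut_form_def using H
    by (intro Bochner_Integration.integral_cong) (auto simp: is_kernel_def space_pair_measure)
  finally show ?thesis .
qed

lemma block_mean_diff:
  assumes "integrable unit_interval f" "integrable unit_interval g"
  shows "block_mean k (\<lambda>x. f x - g x) x = block_mean k f x - block_mean k g x"
proof -
  have *: "(\<integral>z. (f z - g z) * indicator (block k i) z \<partial>unit_interval)
     = (\<integral>z. f z * indicator (block k i) z \<partial>unit_interval) - (\<integral>z. g z * indicator (block k i) z \<partial>unit_interval)" for i
    unfolding left_diff_distrib using assms by (intro Bochner_Integration.integral_diff integrable_times_block)
  show ?thesis unfolding block_mean_def *
    by (simp only: sum_subtractf[symmetric] left_diff_distrib right_diff_distrib)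
qed

lemma block_mean_cong:
  assumes "\<And>x. x \<in> {0..1} \<Longrightarrow> f x = g x"
  shows "block_mean k f x = block_mean k g x"
proof -
  have "(\<integral>z. f z * indicator (block k i) z \<partial>unit_interval) = (\<integral>z. g z * indicator (block k i) z \<partial>unit_interval)" for i
    using assms by (intro Bochner_Integration.integral_cong) (auto simp: space_unit_interval)
  then show ?thesis unfolding block_mean_def by simp
qed

text \<open>\<open>almost_monotone\<close> concerns nonnegative weights. The positive and the
  negative part of \<open>g\<close> are treated separately, which doubles the constant.\<close>

lemma block_mean_kernel_degree_error:
  assumes H: "is_kernel unit_interval H" and e: "almost_monotone H e" and k: "k > 0"
    and g: "test_function unit_interval g"
  shows "(\<integral>x. \<bar>kernel_degree H g x - block_mean k (kernel_degree H g) x\<bar> \<partial>unit_interval)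
     \<le> 4 * real k * (2 * e + 1 / (real k)\<^sup>2)"
proof -
  let ?U = unit_interval and ?b = "2 * real k * (2 * e + 1 / (real k)\<^sup>2)"
  define gp gm where "gp x = max (g x) 0" and "gm x = max (- g x) 0" for x
  have t: "test_function ?U gp" "test_function ?U gm"
    using g by (auto simp: test_function_def gp_def[abs_def] gm_def[abs_def])
  have *: "(\<integral>x. \<bar>kernel_degree H a x - block_mean k (kernel_degree H a) x\<bar> \<partial>?U) \<le> ?b"
    if a: "test_function ?U a" "\<And>x. 0 \<le> a x" for a
  proof (rule block_mean_error[OF _ _ _ k])
    show "0 \<le> kernel_degree H a x \<and> kernel_degree H a x \<le> 1" if "x \<in> {0..1}" for x
    proof -
      have "\<bar>kernel_degree H a x\<bar> \<le> 1"
        using kernel_degree_test_function[OF H a(1)] that by (simp add: test_function_def space_unit_interval)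
      moreover have "0 \<le> kernel_degree H a x" by (rule kernel_degree_nonneg[OF H _ that]) (rule a(2))
      ultimately show ?thesis by simp
    qed
  qed (use e a kernel_degree_measurable[OF H a(1)] in \<open>auto simp: almost_monotone_def\<close>)
  let ?dp = "kernel_degree H gp" and ?dm = "kernel_degree H gm"
  have i: "integrable ?U ?dp" "integrable ?U ?dm"
    using t by (auto intro!: test_function_integrable kernel_degree_test_function[OF H])
  have ib: "integrable ?U (block_mean k ?dp)" "integrable ?U (block_mean k ?dm)"
    using t k by (auto intro!: test_function_integrable test_function_block_mean kernel_degree_test_function[OF H])
  have split: "kernel_degree H g x = ?dp x - ?dm x" if "x \<in> {0..1}" for x
  proof -
    have "?dp x - ?dm x = (\<integral>y. H x y * gp y - H x y * gm y \<partial>?U)"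
      unfolding kernel_degree_def using kernel_section_integrable[OF H that] t
      by (intro Bochner_Integration.integral_diff[symmetric])
    also have "\<dots> = kernel_degree H g x"
      unfolding kernel_degree_def by (rule Bochner_Integration.integral_cong) (auto simp: gp_def gm_def max_def)
    finally show ?thesis by simp
  qed
  have "(\<integral>x. \<bar>kernel_degree H g x - block_mean k (kernel_degree H g) x\<bar> \<partial>?U)
     \<le> (\<integral>x. \<bar>?dp x - block_mean k ?dp x\<bar> + \<bar>?dm x - block_mean k ?dm x\<bar> \<partial>?U)"
  proof (rule integral_mono)
    show "integrable ?U (\<lambda>x. \<bar>kernel_degree H g x - block_mean k (kernel_degree H g) x\<bar>)"
      using g k by (intro integrable_abs Bochner_Integration.integrable_diff test_function_integrable
          test_function_block_mean kernel_degree_test_function[OF H])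
    fix x assume "x \<in> space ?U"
    then have x: "x \<in> {0..1}" by (simp add: space_unit_interval)
    have "block_mean k (kernel_degree H g) x = block_mean k ?dp x - block_mean k ?dm x"
      using block_mean_cong[of "kernel_degree H g" "\<lambda>x. ?dp x - ?dm x" k x] split block_mean_diff[OF i, of k x] by simp
    then show "\<bar>kernel_degree H g x - block_mean k (kernel_degree H g) x\<bar>
      \<le> \<bar>?dp x - block_mean k ?dp x\<bar> + \<bar>?dm x - block_mean k ?dm x\<bar>"
      using split[OF x] by linarith
  qed (use i ib in auto)
  also have "\<dots> = (\<integral>x. \<bar>?dp x - block_mean k ?dp x\<bar> \<partial>?U) + (\<integral>x. \<bar>?dm x - block_mean k ?dm x\<bar> \<partial>?U)"
    using i ib by (intro Bochner_Integration.integral_add) auto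
  also have "\<dots> \<le> ?b + ?b"
    using t by (intro add_mono *) (auto simp: gp_def gm_def)
  finally show ?thesis by simp
qed

text \<open>By self-adjointness the averaging is moved from \<open>f\<close> onto the degree
  function of \<open>g\<close>. What remains is the L1 error of averaging that function, for
  \<open>f\<close> is bounded by 1.\<close>

lemma cut_form_block_mean_left_error:
  assumes H: "is_kernel unit_interval H" and e: "almost_monotone H e" and k: "k > 0"
    and f: "test_function unit_interval f" and g: "test_function unit_interval g"
  shows "\<bar>cut_form unit_interval H f g - cut_form unit_interval H (block_mean k f) g\<bar> \<le> 4 * real k * (2 * e + 1 / (real k)\<^sup>2)"
proof -
  let ?U = unit_interval and ?d = "kernel_degree H g"
  have d: "test_function ?U ?d" by (rule kernel_degree_test_function[OF H g])
  note i = test_function_integrable[OF f] test_function_integrable[OF d]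
  have mb: "test_function ?U (block_mean k f)" "test_function ?U (block_mean k ?d)"
    using f d k by (auto intro: test_function_block_mean)
  have [measurable]: "f \<in> borel_measurable ?U" "?d \<in> borel_measurable ?U"
    using f d by (auto simp: test_function_def)
  have pi: "integrable ?U (\<lambda>x. u x * v x)" if "test_function ?U u" "test_function ?U v" for u v
  proof (rule test_function_integrable)
    have "\<bar>u x\<bar> * \<bar>v x\<bar> \<le> 1 * 1" if "x \<in> space ?U" for x
      using \<open>test_function ?U u\<close> \<open>test_function ?U v\<close> that by (intro mult_mono) (auto simp: test_function_def)
    then show "test_function ?U (\<lambda>x. u x * v x)" using that by (auto simp: test_function_def abs_mult)
  qed
  have "cut_form ?U H (block_mean k f) g = (\<integral>x. block_mean k f x * ?d x \<partial>?U)"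
    using cut_form_kernel_degree[OF H mb(1) g] by (simp add: mult.commute)
  also have "\<dots> = (\<integral>x. block_mean k ?d x * f x \<partial>?U)"
    unfolding integral_block_mean[OF i] integral_block_mean[OF i(2) i(1)] by (simp add: ac_simps)
  finally have eq: "cut_form ?U H f g - cut_form ?U H (block_mean k f) g
      = (\<integral>x. ?d x * f x - block_mean k ?d x * f x \<partial>?U)"
    using pi[OF d f] pi[OF mb(2) f] by (simp add: cut_form_kernel_degree[OF H f g])
  have "\<bar>cut_form ?U H f g - cut_form ?U H (block_mean k f) g\<bar> \<le> (\<integral>x. \<bar>?d x * f x - block_mean k ?d x * f x\<bar> \<partial>?U)"
    unfolding eq by (rule integral_abs_bound)
  also have "\<dots> \<le> (\<integral>x. \<bar>?d x - block_mean k ?d x\<bar> \<partial>?U)"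
  proof (rule integral_mono)
    show "integrable ?U (\<lambda>x. \<bar>?d x * f x - block_mean k ?d x * f x\<bar>)"
      using pi[OF d f] pi[OF mb(2) f] by simp
    show "integrable ?U (\<lambda>x. \<bar>?d x - block_mean k ?d x\<bar>)"
      using test_function_integrable[OF d] test_function_integrable[OF mb(2)] by simp
    show "\<bar>?d x * f x - block_mean k ?d x * f x\<bar> \<le> \<bar>?d x - block_mean k ?d x\<bar>" if "x \<in> space ?U" for x
      using f that mult_left_mono[of "\<bar>f x\<bar>" 1 "\<bar>?d x - block_mean k ?d x\<bar>"]
      by (simp add: left_diff_distrib[symmetric] abs_mult test_function_def)
  qed
  also have "\<dots> \<le> 4 * real k * (2 * e + 1 / (real k)\<^sup>2)"
    by (rule block_mean_kernel_degree_error[OF H e k g])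
  finally show ?thesis .
qed

text \<open>The arguments are averaged one after the other. Symmetry of the kernel brings the second
  one to the front, and the constant doubles from 4 to 8.\<close>

lemma cut_form_block_mean_error:
  assumes H: "is_kernel unit_interval H" and e: "almost_monotone H e" and k: "k > 0"
    and f: "test_function unit_interval f" and g: "test_function unit_interval g"
  shows "\<bar>cut_form unit_interval H f g - cut_form unit_interval H (block_mean k f) (block_mean k g)\<bar>
     \<le> 8 * real k * (2 * e + 1 / (real k)\<^sup>2)"
proof -
  have m: "test_function unit_interval (block_mean k f)" by (rule test_function_block_mean[OF f k])
  have m': "test_function unit_interval (block_mean k g)" by (rule test_function_block_mean[OF g k])
  have "cut_form unit_interval H (block_mean k f) g = cut_form unit_interval H g (block_mean k f)"
    "cut_form unit_interval H (block_mean k f) (block_mean k g) = cut_form unit_interval H (block_mean k g) (block_mean k f)"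
    using m m' g by (auto intro: cut_form_commute[OF H])
  then show ?thesis
    using cut_form_block_mean_left_error[OF H e k f g] cut_form_block_mean_left_error[OF H e k g m] by linarith
qed

section \<open>Block averages of a kernel\<close>

definition block_average :: "(real \<Rightarrow> real \<Rightarrow> real) \<Rightarrow> nat \<Rightarrow> nat \<Rightarrow> nat \<Rightarrow> real" where
  "block_average H k i j = (real k)\<^sup>2 * cut_form unit_interval H (indicator (block k i)) (indicator (block k j))"

definition step_kernel :: "nat \<Rightarrow> (nat \<Rightarrow> nat \<Rightarrow> real) \<Rightarrow> real \<Rightarrow> real \<Rightarrow> real" where
  "step_kernel k c x y = (\<Sum>i<k. \<Sum>j<k. c i j * (indicator (block k i) x * indicator (block k j) y))"

lemma step_kernel_eq:
  assumes "i < k" "j < k" "x \<in> block k i" "y \<in> block k j"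
  shows "step_kernel k c x y = c i j"
proof -
  have "step_kernel k c x y = (\<Sum>i<k. (\<Sum>j<k. c i j * indicator (block k j) y) * indicator (block k i) x)"
    unfolding step_kernel_def sum_distrib_right by (simp add: ac_simps)
  also have "\<dots> = c i j" using assms by (simp only: sum_block)
  finally show ?thesis .
qed

lemma bounded_kernel_step_kernel: "bounded_kernel unit_interval (step_kernel k c)"
proof -
  have "\<bar>step_kernel k c x y\<bar> \<le> (\<Sum>i<k. \<Sum>j<k. \<bar>c i j\<bar>)" for x y
    unfolding step_kernel_def
    by (intro order_trans[OF sum_abs] sum_mono) (auto split: split_indicator)
  moreover have "(\<lambda>(x, y). step_kernel k c x y) \<in> borel_measurable (unit_interval \<Otimes>\<^sub>M unit_interval)"
    unfolding step_kernel_def[abs_def] by measurable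
  ultimately show ?thesis unfolding bounded_kernel_def by blast
qed

lemma cut_form_sum_kernel:
  assumes D: "\<And>i. i \<in> I \<Longrightarrow> bounded_kernel unit_interval (D i)" and f: "test_function unit_interval f" and g: "test_function unit_interval g"
  shows "cut_form unit_interval (\<lambda>x y. \<Sum>i\<in>I. c i * D i x y) f g = (\<Sum>i\<in>I. c i * cut_form unit_interval (D i) f g)"
proof -
  have "cut_form unit_interval (\<lambda>x y. \<Sum>i\<in>I. c i * D i x y) f g
      = (\<integral>p. (\<Sum>i\<in>I. c i * (case p of (x, y) \<Rightarrow> D i x y * f x * g y)) \<partial>(unit_interval \<Otimes>\<^sub>M unit_interval))"
    unfolding cut_form_def by (rule Bochner_Integration.integral_cong) (auto simp: sum_distrib_left sum_distrib_right ac_simps intro!: sum.cong)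
  also have "\<dots> = (\<Sum>i\<in>I. \<integral>p. c i * (case p of (x, y) \<Rightarrow> D i x y * f x * g y) \<partial>(unit_interval \<Otimes>\<^sub>M unit_interval))"
    using unit_interval.kernel_integrable[OF D f g] by (intro Bochner_Integration.integral_sum integrable_mult_right)
  also have "\<dots> = (\<Sum>i\<in>I. c i * cut_form unit_interval (D i) f g)"
    by (simp add: cut_form_def)
  finally show ?thesis .
qed

lemma cut_form_sum_left:
  assumes D: "bounded_kernel unit_interval D" and f: "\<And>i. i \<in> I \<Longrightarrow> test_function unit_interval (f i)" and g: "test_function unit_interval g"
  shows "cut_form unit_interval D (\<lambda>x. \<Sum>i\<in>I. c i * f i x) g = (\<Sum>i\<in>I. c i * cut_form unit_interval D (f i) g)"
proof -
  have "cut_form unit_interval D (\<lambda>x. \<Sum>i\<in>I. c i * f i x) g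
      = (\<integral>p. (\<Sum>i\<in>I. c i * (case p of (x, y) \<Rightarrow> D x y * f i x * g y)) \<partial>(unit_interval \<Otimes>\<^sub>M unit_interval))"
    unfolding cut_form_def by (rule Bochner_Integration.integral_cong) (auto simp: sum_distrib_left sum_distrib_right ac_simps intro!: sum.cong)
  also have "\<dots> = (\<Sum>i\<in>I. \<integral>p. c i * (case p of (x, y) \<Rightarrow> D x y * f i x * g y) \<partial>(unit_interval \<Otimes>\<^sub>M unit_interval))"
    using unit_interval.kernel_integrable[OF D f g] by (intro Bochner_Integration.integral_sum integrable_mult_right)
  also have "\<dots> = (\<Sum>i\<in>I. c i * cut_form unit_interval D (f i) g)"
    by (simp add: cut_form_def)
  finally show ?thesis .
qed

lemma cut_form_step_kernel:
  assumes f: "test_function unit_interval f" and g: "test_function unit_interval g"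
  shows "cut_form unit_interval (step_kernel k c) f g = (\<Sum>i<k. \<Sum>j<k. c i j *
    ((\<integral>x. f x * indicator (block k i) x \<partial>unit_interval) * (\<integral>x. g x * indicator (block k j) x \<partial>unit_interval)))"
proof -
  let ?D = "\<lambda>p x y. indicator (block k (fst p)) x * indicator (block k (snd p)) y :: real"
  have [measurable]: "f \<in> borel_measurable unit_interval" "g \<in> borel_measurable unit_interval"
    using f g by (auto simp: test_function_def)
  have D: "bounded_kernel unit_interval (?D p)" for p
  proof -
    have "(\<lambda>(x, y). ?D p x y) \<in> borel_measurable (unit_interval \<Otimes>\<^sub>M unit_interval)" by measurable
    then show ?thesis unfolding bounded_kernel_def by (auto intro!: exI[of _ 1] split: split_indicator)
  qed
  have B: "cut_form unit_interval (?D p) f g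
     = (\<integral>x. f x * indicator (block k (fst p)) x \<partial>unit_interval) * (\<integral>x. g x * indicator (block k (snd p)) x \<partial>unit_interval)" for p
  proof -
    have "cut_form unit_interval (?D p) f g = (\<integral>x. (\<integral>y. ?D p x y * g y \<partial>unit_interval) * f x \<partial>unit_interval)"
      by (rule unit_interval.cut_form_iterated[OF D f g])
    also have "\<dots> = (\<integral>x. (\<integral>x. g x * indicator (block k (snd p)) x \<partial>unit_interval) * (f x * indicator (block k (fst p)) x) \<partial>unit_interval)"
    proof (rule Bochner_Integration.integral_cong[OF refl])
      fix x
      have "(\<integral>y. ?D p x y * g y \<partial>unit_interval) = (\<integral>y. indicator (block k (fst p)) x * (g y * indicator (block k (snd p)) y) \<partial>unit_interval)"
        by (simp add: ac_simps)
      then show "(\<integral>y. ?D p x y * g y \<partial>unit_interval) * f x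
        = (\<integral>x. g x * indicator (block k (snd p)) x \<partial>unit_interval) * (f x * indicator (block k (fst p)) x)"
        by simp
    qed
    finally show ?thesis by simp
  qed
  have eq: "step_kernel k c = (\<lambda>x y. \<Sum>p\<in>{..<k} \<times> {..<k}. c (fst p) (snd p) * ?D p x y)"
    by (intro ext) (simp add: step_kernel_def sum.cartesian_product case_prod_beta')
  have "cut_form unit_interval (step_kernel k c) f g
      = (\<Sum>p\<in>{..<k} \<times> {..<k}. c (fst p) (snd p) * cut_form unit_interval (?D p) f g)"
    unfolding eq by (rule cut_form_sum_kernel[OF D f g])
  then show ?thesis unfolding B by (simp add: sum.cartesian_product case_prod_beta')
qed

text \<open>Averaging both test functions has the same effect as averaging the kernel. An error in
  the test functions thereby becomes a distance in cut norm.\<close>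

lemma cut_form_block_mean:
  assumes H: "is_kernel unit_interval H" and k: "k > 0"
    and f: "test_function unit_interval f" and g: "test_function unit_interval g"
  shows "cut_form unit_interval H (block_mean k f) (block_mean k g) = cut_form unit_interval (step_kernel k (block_average H k)) f g"
proof -
  have Hb: "bounded_kernel unit_interval H" by (rule is_kernel_bounded[OF H])
  have *: "cut_form unit_interval H (block_mean k u) v = (\<Sum>i<k. (real k * (\<integral>z. u z * indicator (block k i) z \<partial>unit_interval)) *
     cut_form unit_interval H (indicator (block k i)) v)" if "test_function unit_interval v" for u v
    unfolding block_mean_def[abs_def] by (rule cut_form_sum_left[OF Hb test_function_block that])
  have "cut_form unit_interval H (indicator (block k i)) (block_mean k g)
     = (\<Sum>j<k. (real k * (\<integral>z. g z * indicator (block k j) z \<partial>unit_interval)) *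
     cut_form unit_interval H (indicator (block k i)) (indicator (block k j)))" for i
    using *[OF test_function_block, of g] cut_form_commute[OF H test_function_block test_function_block_mean[OF g k]]
      cut_form_commute[OF H test_function_block test_function_block] by simp
  then show ?thesis
    unfolding cut_form_step_kernel[OF f g] *[OF test_function_block_mean[OF g k]]
    by (simp add: sum_distrib_left block_average_def power2_eq_square ac_simps)
qed

lemma cut_norm_step_kernel_error:
  assumes H: "is_kernel unit_interval H" and e: "almost_monotone H e" and k: "k > 0"
  shows "cut_norm unit_interval (\<lambda>x y. H x y - step_kernel k (block_average H k) x y) \<le> 8 * real k * (2 * e + 1 / (real k)\<^sup>2)"
proof (rule cut_norm_least)
  fix f g assume f: "test_function unit_interval f" and g: "test_function unit_interval g"
  show "\<bar>cut_form unit_interval (\<lambda>x y. H x y - step_kernel k (block_average H k) x y) f g\<bar> \<le> 8 * real k * (2 * e + 1 / (real k)\<^sup>2)"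
    using cut_form_block_mean_error[OF H e k f g]
    by (simp add: unit_interval.cut_form_diff[OF is_kernel_bounded[OF H] bounded_kernel_step_kernel f g] cut_form_block_mean[OF H k f g])
qed

section \<open>Compactness of almost monotone kernels\<close>

lemma integral_product_unit_square:
  assumes u: "test_function unit_interval u" and v: "test_function unit_interval v"
  shows "(\<integral>p. u (fst p) * v (snd p) \<partial>(unit_interval \<Otimes>\<^sub>M unit_interval))
    = (\<integral>x. u x \<partial>unit_interval) * (\<integral>x. v x \<partial>unit_interval)"
    and "integrable (unit_interval \<Otimes>\<^sub>M unit_interval) (\<lambda>p. u (fst p) * v (snd p))"
proof -
  have b: "bounded_kernel unit_interval (\<lambda>_ _. 1)" by (auto simp: bounded_kernel_def)
  show "(\<integral>p. u (fst p) * v (snd p) \<partial>(unit_interval \<Otimes>\<^sub>M unit_interval))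
    = (\<integral>x. u x \<partial>unit_interval) * (\<integral>x. v x \<partial>unit_interval)"
    using unit_interval.cut_form_iterated[OF b u v] by (simp add: cut_form_def case_prod_beta')
  show "integrable (unit_interval \<Otimes>\<^sub>M unit_interval) (\<lambda>p. u (fst p) * v (snd p))"
    using unit_interval.kernel_integrable[OF b u v] by (simp add: case_prod_beta')
qed

lemma test_function_mult:
  assumes "test_function M u" "test_function M v" shows "test_function M (\<lambda>x. u x * v x)"
proof -
  have "\<bar>u x\<bar> * \<bar>v x\<bar> \<le> 1 * 1" if "x \<in> space M" for x
    using assms that by (intro mult_mono) (auto simp: test_function_def)
  then show ?thesis using assms by (auto simp: test_function_def abs_mult)
qed

lemma block_separated:
  assumes "x \<in> block k i" "y \<in> block l j" "i < k" "j < l" "(real i + 1) / real k \<le> real j / real l"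
  shows "x < y"
proof -
  \<comment> \<open>The point 1, the only one at which a block is closed on the right, has to be
    ruled out for \<open>x\<close>; then the inequality is strict even for adjacent blocks.\<close>
  have "real j / real l < 1" using assms by simp
  moreover have "x \<le> (real i + 1) / real k" using block_bounds[OF assms(1)] assms by auto
  ultimately have "x < 1" using assms(5) by linarith
  then have "x < (real i + 1) / real k" by (rule block_less[OF assms(1)])
  then show ?thesis using block_bounds[OF assms(2)] assms by auto
qed

text \<open>All points of the first block lie before all points of the second, so the integral of
  the degree difference over their product is at most \<open>e\<close>. Multiplying by k and l, the
  inverse measures of the blocks, turns it into a comparison of means.\<close>

lemma cut_form_block_shift:
  assumes H: "is_kernel unit_interval H" and e: "almost_monotone H e"
    and a: "test_function unit_interval a" "\<And>x. 0 \<le> a x"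
    and i: "i < k" and j: "j < l" and sep: "(real i + 1) / real k \<le> real j / real l"
  shows "real k * cut_form unit_interval H (indicator (block k i)) a
    \<le> real l * cut_form unit_interval H (indicator (block l j)) a + real k * real l * e"
proof -
  let ?U = unit_interval and ?P = "unit_interval \<Otimes>\<^sub>M unit_interval" and ?d = "kernel_degree H a"
  let ?I = "indicator (block k i) :: real \<Rightarrow> real" and ?J = "indicator (block l j) :: real \<Rightarrow> real"
  have d: "test_function ?U ?d" by (rule kernel_degree_test_function[OF H a(1)])
  have [measurable]: "?d \<in> borel_measurable ?U" using d by (rule test_function_measurable)
  note tb = test_function_block
  have dI: "test_function ?U (\<lambda>x. ?d x * ?I x)" by (rule test_function_mult[OF d tb])
  have dJ: "test_function ?U (\<lambda>x. ?d x * ?J x)" by (rule test_function_mult[OF d tb])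
  let ?F = "\<lambda>p. (?d (fst p) * ?I (fst p)) * ?J (snd p) - ?I (fst p) * (?d (snd p) * ?J (snd p))"
  have "(\<integral>p. ?F p \<partial>?P) = (\<integral>x. ?d x * ?I x \<partial>?U) * (1 / real l) - (1 / real k) * (\<integral>x. ?d x * ?J x \<partial>?U)"
    by (simp only: Bochner_Integration.integral_diff[OF integral_product_unit_square(2)[OF dI tb] integral_product_unit_square(2)[OF tb dJ]]
      integral_product_unit_square(1)[OF dI tb] integral_product_unit_square(1)[OF tb dJ] integral_block[OF i] integral_block[OF j])
  also have "\<dots> = cut_form ?U H ?I a / real l - cut_form ?U H ?J a / real k"
    by (simp add: cut_form_kernel_degree[OF H tb a(1)])
  finally have eq: "(\<integral>p. ?F p \<partial>?P) = cut_form ?U H ?I a / real l - cut_form ?U H ?J a / real k" .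
  have "(\<integral>p. ?F p \<partial>?P) \<le> (\<integral>p. (if fst p < snd p then max (?d (fst p) - ?d (snd p)) 0 else 0) \<partial>?P)"
  proof (rule integral_mono)
    show "integrable ?P ?F"
      by (intro Bochner_Integration.integrable_diff integral_product_unit_square(2) dI dJ tb)
    show "integrable ?P (\<lambda>p. if fst p < snd p then max (?d (fst p) - ?d (snd p)) 0 else 0)"
    proof (rule unit_square.integrable_bounded[where C = 2])
      fix p assume "p \<in> space ?P"
      then have "\<bar>?d (fst p)\<bar> \<le> 1" "\<bar>?d (snd p)\<bar> \<le> 1"
        using d by (auto simp: test_function_def space_pair_measure)
      then show "\<bar>if fst p < snd p then max (?d (fst p) - ?d (snd p)) 0 else 0\<bar> \<le> 2" by auto
    qed measurable
    fix p
    show "?F p \<le> (if fst p < snd p then max (?d (fst p) - ?d (snd p)) 0 else 0)"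
      using block_separated[OF _ _ i j sep, of "fst p" "snd p"] by (auto split: split_indicator)
  qed
  also have "\<dots> \<le> e" using e a unfolding almost_monotone_def by blast
  finally have "cut_form ?U H ?I a / real l - cut_form ?U H ?J a / real k \<le> e" using eq by simp
  then have "(real k * real l) * (cut_form ?U H ?I a / real l - cut_form ?U H ?J a / real k) \<le> (real k * real l) * e"
    by (rule mult_left_mono) simp
  then show ?thesis using i j by (simp add: right_diff_distrib)
qed

text \<open>One index is moved at a time, by way of a mixed form that pairs a block of scale k with
  one of scale l. Two scales are allowed because the limit kernel is a supremum over blocks of all
  scales.\<close>

lemma block_average_monotone:
  assumes H: "is_kernel unit_interval H" and e: "almost_monotone H e"
    and "i < k" "j < k" "i' < l" "j' < l"
    and "(real i + 1) / real k \<le> real i' / real l" "(real j + 1) / real k \<le> real j' / real l"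
  shows "block_average H k i j \<le> block_average H l i' j' + (real k * real k * real l + real k * real l * real l) * e"
proof -
  let ?B = "\<lambda>k i l j. cut_form unit_interval H (indicator (block k i)) (indicator (block l j))"
  have com: "?B l i' k j = ?B k j l i'" "?B l j' l i' = ?B l i' l j'"
    by (auto intro: cut_form_commute[OF H] test_function_block)
  have 1: "real k * ?B k i k j \<le> real l * ?B l i' k j + real k * real l * e"
    using assms by (intro cut_form_block_shift[OF H e test_function_block]) auto
  have 2: "real k * ?B k j l i' \<le> real l * ?B l j' l i' + real k * real l * e"
    using assms by (intro cut_form_block_shift[OF H e test_function_block]) auto
  \<comment> \<open>The shift supplies one normalising factor; the other is k in the first move and
    l in the second, whence the two products in the error.\<close>
  have "real k * (real k * ?B k i k j) \<le> real k * (real l * ?B l i' k j + real k * real l * e)"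
    using 1 by (rule mult_left_mono) simp
  moreover have "real l * (real k * ?B k j l i') \<le> real l * (real l * ?B l j' l i' + real k * real l * e)"
    using 2 by (rule mult_left_mono) simp
  ultimately show ?thesis unfolding block_average_def com
    by (simp add: power2_eq_square algebra_simps)
qed

lemma block_average_bounds:
  assumes H: "is_kernel unit_interval H" and i: "i < k" "j < k"
  shows "0 \<le> block_average H k i j" "block_average H k i j \<le> 1"
proof -
  let ?U = unit_interval
  let ?I = "indicator (block k i) :: real \<Rightarrow> real" and ?J = "indicator (block k j) :: real \<Rightarrow> real"
  note tb = test_function_block
  have J: "integrable ?U ?J" and I: "integrable ?U ?I" using tb by (auto intro: test_function_integrable)
  have d0: "0 \<le> kernel_degree H ?J x" if "x \<in> {0..1}" for x
    by (rule kernel_degree_nonneg[OF H _ that]) simp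
  have d1: "kernel_degree H ?J x \<le> 1 / real k" if "x \<in> {0..1}" for x
  proof -
    have "kernel_degree H ?J x \<le> (\<integral>y. ?J y \<partial>?U)"
      unfolding kernel_degree_def
      by (rule integral_mono[OF kernel_section_integrable[OF H that tb] J])
         (use H that in \<open>auto simp: is_kernel_def space_unit_interval split: split_indicator\<close>)
    then show ?thesis by (simp only: integral_block[OF i(2)])
  qed
  have eq: "cut_form ?U H ?I ?J = (\<integral>x. kernel_degree H ?J x * ?I x \<partial>?U)"
    by (rule cut_form_kernel_degree[OF H tb tb])
  show "0 \<le> block_average H k i j"
    unfolding block_average_def eq using d0
    by (intro mult_nonneg_nonneg Bochner_Integration.integral_nonneg) (auto simp: space_unit_interval)
  have "cut_form ?U H ?I ?J \<le> (\<integral>x. (1 / real k) * ?I x \<partial>?U)"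
    unfolding eq
  proof (rule integral_mono)
    show "integrable ?U (\<lambda>x. kernel_degree H ?J x * ?I x)"
      by (intro test_function_integrable test_function_mult kernel_degree_test_function[OF H] tb)
    show "integrable ?U (\<lambda>x. (1 / real k) * ?I x)" using I by (rule integrable_mult_right)
    show "kernel_degree H ?J x * ?I x \<le> 1 / real k * ?I x" if "x \<in> space ?U" for x
      using d1[of x] that by (intro mult_right_mono) (auto simp: space_unit_interval)
  qed
  also have "\<dots> = (1 / real k) * (1 / real k)"
    unfolding integral_mult_right_zero integral_block[OF i(1)] ..
  finally have "(real k)\<^sup>2 * cut_form ?U H ?I ?J \<le> (real k)\<^sup>2 * ((1 / real k) * (1 / real k))"
    by (rule mult_left_mono) simp
  then show "block_average H k i j \<le> 1" unfolding block_average_def using i by (simp add: power2_eq_square)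
qed

lemma block_average_commute:
  "is_kernel unit_interval H \<Longrightarrow> block_average H k i j = block_average H k j i"
  unfolding block_average_def using cut_form_commute[OF _ test_function_block test_function_block] by simp

section \<open>The monotone kernel in the limit\<close>

lemma diagonal_subsequence:
  fixes c :: "nat \<Rightarrow> nat \<Rightarrow> real"
  assumes c: "\<And>\<nu> n. 0 \<le> c \<nu> n \<and> c \<nu> n \<le> 1"
  obtains \<rho> where "strict_mono \<rho>" "\<And>n. convergent (\<lambda>\<nu>. c (\<rho> \<nu>) n)"
proof -
  interpret subseqs "\<lambda>n s. convergent (\<lambda>\<nu>. c (s \<nu>) n)"
  proof
    fix n and s :: "nat \<Rightarrow> nat" assume "strict_mono s"
    have "\<forall>\<nu>. c (s \<nu>) n \<in> {0..1}" using c by simp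
    then obtain l r where "strict_mono r" "((\<lambda>\<nu>. c (s \<nu>) n) \<circ> r) \<longlonglongrightarrow> l"
      using compact_Icc[of 0 "1 :: real"] unfolding compact_eq_seq_compact_metric seq_compact_def by metis
    then show "\<exists>r'. strict_mono r' \<and> convergent (\<lambda>\<nu>. c ((s \<circ> r') \<nu>) n)"
      by (auto simp: convergent_def comp_def)
  qed
  have "convergent (\<lambda>\<nu>. c (diagseq \<nu>) n)" for n
  proof -
    have "convergent (\<lambda>\<nu>. c ((diagseq \<circ> (+) (Suc n)) \<nu>) n)"
    proof (rule diagseq_holds)
      fix r s n assume r: "strict_mono (r :: nat \<Rightarrow> nat)" and "convergent (\<lambda>\<nu>. c (s \<nu>) n)"
      then show "convergent (\<lambda>\<nu>. c ((s \<circ> r) \<nu>) n)"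
        using convergent_subseq_convergent[OF _ r, of "\<lambda>\<nu>. c (s \<nu>) n"] by (simp add: comp_def)
    qed
    then show ?thesis
      using convergent_ignore_initial_segment[of "\<lambda>\<nu>. c (diagseq \<nu>) n" "Suc n"] by (simp add: add.commute)
  qed
  then show thesis using that subseq_diagseq by blast
qed

lemma sum_shift2_diff_le:
  fixes F :: "nat \<Rightarrow> real"
  assumes "\<And>j. 0 \<le> F j \<and> F j \<le> 1"
  shows "(\<Sum>j<k. F (j + 2) - F j) \<le> 2"
proof -
  have "(\<Sum>j<k. F (j + 2) - F j) = F (k + 1) + F k - F 1 - F 0" by (induction k) auto
  then show ?thesis using assms[of "k + 1"] assms[of k] assms[of 0] assms[of 1] by linarith
qed

text \<open>Telescoping along each of the two coordinates.\<close>

lemma sum_diagonal_shift_le: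
  fixes F :: "nat \<Rightarrow> nat \<Rightarrow> real"
  assumes F: "\<And>i j. 0 \<le> F i j \<and> F i j \<le> 1"
  shows "(\<Sum>i<k. \<Sum>j<k. F (i + 2) (j + 2) - F i j) \<le> 4 * real k"
proof -
  have "(\<Sum>i<k. \<Sum>j<k. F (i + 2) (j + 2) - F i j)
      = (\<Sum>i<k. \<Sum>j<k. F (i + 2) (j + 2) - F (i + 2) j) + (\<Sum>j<k. \<Sum>i<k. F (i + 2) j - F i j)"
    by (subst (3) sum.swap) (simp add: sum.distrib[symmetric])
  also have "\<dots> \<le> (\<Sum>i<k. 2) + (\<Sum>j<k. 2)"
    using F by (intro add_mono sum_mono sum_shift2_diff_le)
  finally show ?thesis by simp
qed

text \<open>Let (x, y) lie in block (i, j) of scale k. Both \<open>V x y\<close> and the average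
  \<open>m k i j\<close> are between the averages of the blocks (i-1, j-1) and (i+1, j+1). Their
  difference is at most that of two averages shifted by 2; these differences telescope to at most 4k
  in total, and each block has area 1/k^2.\<close>

lemma ex_monotone_kernel:
  fixes m :: "nat \<Rightarrow> nat \<Rightarrow> nat \<Rightarrow> real"
  assumes m01: "\<And>k i j. i < k \<Longrightarrow> j < k \<Longrightarrow> 0 \<le> m k i j \<and> m k i j \<le> 1"
    and msym: "\<And>k i j. i < k \<Longrightarrow> j < k \<Longrightarrow> m k i j = m k j i"
    and mmono: "\<And>k l i j i' j'. i < k \<Longrightarrow> j < k \<Longrightarrow> i' < l \<Longrightarrow> j' < l \<Longrightarrow>
      (real i + 1) / real k \<le> real i' / real l \<Longrightarrow> (real j + 1) / real k \<le> real j' / real l \<Longrightarrow> m k i j \<le> m l i' j'"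
  obtains V where "monotone_kernel V"
    "\<And>k. k > 0 \<Longrightarrow> cut_norm unit_interval (\<lambda>x y. step_kernel k (m k) x y - V x y) \<le> 4 / real k"
proof -
  let ?U = unit_interval
  define T where "T = {(k, i, j). i < k \<and> j < (k :: nat)}"
  \<comment> \<open>Each block contributes its average on the quadrant above its upper right corner.
    The value 0 elsewhere keeps every single \<open>v t\<close> monotone, as averages are
    nonnegative.\<close>
  define v where "v = (\<lambda>(k, i, j) x y. if (real i + 1) / real k \<le> x \<and> (real j + 1) / real k \<le> y then m k i j else 0)"
  define V where "V x y = (SUP t\<in>T. v t x y)" for x y :: real
  have T1: "(1, 0, 0) \<in> T" by (simp add: T_def)
  have v01: "0 \<le> v t x y" "v t x y \<le> 1" if "t \<in> T" for t x y
    using that m01 by (auto simp: T_def v_def)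
  have bdd: "bdd_above ((\<lambda>t. v t x y) ` T)" for x y using v01 by (intro bdd_aboveI[of _ 1]) auto
  have V0: "0 \<le> V x y" for x y
    unfolding V_def using v01 T1 by (intro order_trans[OF _ cSUP_upper[OF T1 bdd]]) auto
  have V1: "V x y \<le> 1" for x y
    unfolding V_def using v01 T1 by (intro cSUP_least) auto
  have Vmono: "V x y \<le> V x' y'" if "x \<le> x'" "y \<le> y'" for x x' y y'
    unfolding V_def
  proof (rule cSUP_mono)
    fix t assume t: "t \<in> T"
    show "\<exists>t'\<in>T. v t x y \<le> v t' x' y'"
      by (rule bexI[OF _ t]) (use t that m01 in \<open>auto simp: v_def T_def\<close>)
  qed (use T1 bdd in auto)
  have Vsym: "V x y \<le> V y x" for x y
    unfolding V_def
  proof (rule cSUP_mono)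
    fix t assume t: "t \<in> T"
    obtain k i j where t': "t = (k, i, j)" by (cases t)
    show "\<exists>t'\<in>T. v t x y \<le> v t' y x"
      by (rule bexI[of _ "(k, j, i)"]) (use t msym in \<open>auto simp: v_def T_def t'\<close>)
  qed (use T1 bdd in auto)
  have "(\<lambda>p. SUP t\<in>T. v t (fst p) (snd p)) \<in> borel_measurable (?U \<Otimes>\<^sub>M ?U)"
  proof (rule borel_measurable_cSUP)
    show "(\<lambda>p. v t (fst p) (snd p)) \<in> borel_measurable (?U \<Otimes>\<^sub>M ?U)" for t
    proof -
      obtain k i j where t': "t = (k, i, j)" by (cases t)
      show ?thesis unfolding v_def t' by simp
    qed
  qed (use bdd in auto)
  then have Vm: "(\<lambda>(x, y). V x y) \<in> borel_measurable (?U \<Otimes>\<^sub>M ?U)" by (simp add: V_def case_prod_beta')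
  then have VK: "is_kernel ?U V"
    using V0 V1 Vsym by (auto simp: is_kernel_def intro: antisym)
  then have "monotone_kernel V" using Vmono by (simp add: monotone_kernel_def)
  moreover have "cut_norm ?U (\<lambda>x y. step_kernel k (m k) x y - V x y) \<le> 4 / real k" if k: "k > 0" for k
  proof -
    \<comment> \<open>the averages extended by 0 to the left and by 1 to the right, with indices shifted by one\<close>
    define F where "F i j = (if i = 0 \<or> j = 0 then 0 else if i > k \<or> j > k then 1 else m k (i - 1) (j - 1))" for i j
    have F01: "0 \<le> F i j \<and> F i j \<le> 1" for i j
      using m01[of "i - 1" k "j - 1"] by (auto simp: F_def)
    define G where "G i j = F (i + 2) (j + 2) - F i j" for i j
    have le: "\<bar>step_kernel k (m k) x y - V x y\<bar> \<le> step_kernel k G x y" if xy: "x \<in> {0..1}" "y \<in> {0..1}" for x y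
    proof -
      obtain i where i: "i < k" "x \<in> block k i" using block_exists[OF xy(1) k] .
      obtain j where j: "j < k" "y \<in> block k j" using block_exists[OF xy(2) k] .
      have lowV: "F i j \<le> V x y"
      proof (cases "i = 0 \<or> j = 0")
        case False
        then have t: "(k, i - 1, j - 1) \<in> T" using i j by (auto simp: T_def)
        have "F i j = v (k, i - 1, j - 1) x y"
          using False i j block_bounds[OF i(2) k] block_bounds[OF j(2) k] by (auto simp: F_def v_def of_nat_diff)
        also have "\<dots> \<le> V x y" unfolding V_def by (rule cSUP_upper[OF t bdd])
        finally show ?thesis .
      qed (use V0 in \<open>auto simp: F_def\<close>)
      have lowm: "F i j \<le> m k i j"
        using i j m01[of i k j] mmono[of "i - 1" k "j - 1" i k j] by (auto simp: F_def of_nat_diff)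
      have upm: "m k i j \<le> F (i + 2) (j + 2)"
        using i j m01[of i k j] mmono[of i k j "i + 1" k "j + 1"] by (auto simp: F_def add.commute)
      have upV: "V x y \<le> F (i + 2) (j + 2)"
      proof (cases "i + 2 > k \<or> j + 2 > k")
        case True
        then show ?thesis using V1 by (auto simp: F_def)
      next
        case False
        \<comment> \<open>A block that contributes at (x, y) has its upper corner below (x, y),
          hence below the lower corner of block (i+1, j+1), and \<open>mmono\<close> compares the
          two across scales.\<close>
        have "v t x y \<le> m k (i + 1) (j + 1)" if t: "t \<in> T" for t
        proof -
          obtain l i' j' where t': "t = (l, i', j')" by (cases t)
          show ?thesis
          proof (cases "(real i' + 1) / real l \<le> x \<and> (real j' + 1) / real l \<le> y")
            case True
            then have "(real i' + 1) / real l \<le> real (i + 1) / real k" "(real j' + 1) / real l \<le> real (j + 1) / real k"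
              using block_bounds[OF i(2) k] block_bounds[OF j(2) k] by (auto simp: add.commute)
            then have "m l i' j' \<le> m k (i + 1) (j + 1)"
              using False t by (intro mmono) (auto simp: T_def t')
            then show ?thesis using True by (simp add: v_def t')
          next
            case neg: False
            then show ?thesis using m01[of "i + 1" k "j + 1"] False unfolding v_def t' by auto
          qed
        qed
        then have "V x y \<le> m k (i + 1) (j + 1)" unfolding V_def using T1 by (intro cSUP_least) auto
        then show ?thesis using False by (simp add: F_def)
      qed
      show ?thesis
        unfolding step_kernel_eq[OF i(1) j(1) i(2) j(2)] G_def using lowV lowm upm upV by linarith
    qed
    note one = test_function_const[of 1 ?U, simplified]
    have b: "bounded_kernel ?U (\<lambda>x y. step_kernel k (m k) x y - V x y)"
      by (intro bounded_kernel_diff bounded_kernel_step_kernel is_kernel_bounded[OF VK])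
    have "cut_norm ?U (\<lambda>x y. step_kernel k (m k) x y - V x y) \<le> (\<integral>(x, y). \<bar>step_kernel k (m k) x y - V x y\<bar> \<partial>(?U \<Otimes>\<^sub>M ?U))"
      by (rule unit_interval.cut_norm_le_integral[OF b])
    also have "\<dots> \<le> (\<integral>(x, y). step_kernel k G x y * 1 * 1 \<partial>(?U \<Otimes>\<^sub>M ?U))"
    proof (rule integral_mono)
      show "integrable (?U \<Otimes>\<^sub>M ?U) (\<lambda>(x, y). \<bar>step_kernel k (m k) x y - V x y\<bar>)"
        using unit_interval.bounded_kernel_integrable[OF b] by (simp add: case_prod_beta')
      show "integrable (?U \<Otimes>\<^sub>M ?U) (\<lambda>(x, y). step_kernel k G x y * 1 * 1)"
        by (rule unit_interval.kernel_integrable[OF bounded_kernel_step_kernel one one])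
    qed (use le in \<open>auto simp: space_unit_square\<close>)
    also have "\<dots> = cut_form ?U (step_kernel k G) (\<lambda>_. 1) (\<lambda>_. 1)" by (simp add: cut_form_def)
    also have "\<dots> = (\<Sum>i<k. \<Sum>j<k. G i j * ((1 / real k) * (1 / real k)))"
      unfolding cut_form_step_kernel[OF one one] mult_1
      by (intro sum.cong refl) (simp only: integral_block lessThan_iff)
    also have "\<dots> = (\<Sum>i<k. \<Sum>j<k. G i j) * ((1 / real k) * (1 / real k))"
      by (simp only: sum_distrib_right)
    also have "\<dots> \<le> (4 * real k) * ((1 / real k) * (1 / real k))"
      unfolding G_def by (intro mult_right_mono sum_diagonal_shift_le F01) simp
    also have "\<dots> = 4 / real k" using k by simp
    finally show ?thesis .
  qed
  ultimately show thesis using that by blast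
qed

lemma cut_norm_step_kernel_diff_le:
  "cut_norm unit_interval (\<lambda>x y. step_kernel k c x y - step_kernel k c' x y) \<le> (\<Sum>i<k. \<Sum>j<k. \<bar>c i j - c' i j\<bar>)"
proof (rule order_trans[OF unit_interval.cut_norm_le_integral])
  show "bounded_kernel unit_interval (\<lambda>x y. step_kernel k c x y - step_kernel k c' x y)"
    by (intro bounded_kernel_diff bounded_kernel_step_kernel)
  have "\<bar>step_kernel k c x y - step_kernel k c' x y\<bar> \<le> (\<Sum>i<k. \<Sum>j<k. \<bar>c i j - c' i j\<bar>)" for x y
  proof -
    have "step_kernel k c x y - step_kernel k c' x y = step_kernel k (\<lambda>i j. c i j - c' i j) x y"
      unfolding step_kernel_def sum_subtractf[symmetric] left_diff_distrib ..
    also have "\<bar>\<dots>\<bar> \<le> (\<Sum>i<k. \<Sum>j<k. \<bar>c i j - c' i j\<bar>)"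
      unfolding step_kernel_def by (intro order_trans[OF sum_abs] sum_mono) (auto split: split_indicator)
    finally show ?thesis .
  qed
  then show "(\<integral>(x, y). \<bar>step_kernel k c x y - step_kernel k c' x y\<bar> \<partial>(unit_interval \<Otimes>\<^sub>M unit_interval)) \<le> (\<Sum>i<k. \<Sum>j<k. \<bar>c i j - c' i j\<bar>)"
    by (intro unit_square.integral_bounded_le) (auto intro: sum_nonneg)
qed

proposition almost_monotone_compactness:
  assumes H: "\<And>\<nu>. is_kernel unit_interval (H \<nu>)" and e: "\<And>\<nu>. almost_monotone (H \<nu>) (e \<nu>)" and e0: "e \<longlonglongrightarrow> 0"
  obtains \<rho> V where "strict_mono \<rho>" "monotone_kernel V"
    "(\<lambda>\<nu>. cut_norm unit_interval (\<lambda>x y. H (\<rho> \<nu>) x y - V x y)) \<longlonglongrightarrow> 0"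
proof -
  let ?U = unit_interval
  \<comment> \<open>Triples outside the range get the value 0, so all sequences lie in the unit
    interval and one diagonal argument covers all scales and blocks.\<close>
  define c :: "nat \<Rightarrow> nat \<times> nat \<times> nat \<Rightarrow> real" where
    "c \<nu> t = (case t of (k, i, j) \<Rightarrow> if i < k \<and> j < k then block_average (H \<nu>) k i j else 0)" for \<nu> t
  have c01: "0 \<le> c \<nu> t \<and> c \<nu> t \<le> 1" for \<nu> t
    using block_average_bounds[OF H] by (auto simp: c_def split: prod.split)
  obtain \<rho> where \<rho>: "strict_mono \<rho>" "\<And>n. convergent (\<lambda>\<nu>. c (\<rho> \<nu>) (from_nat n))"
    using diagonal_subsequence[of "\<lambda>\<nu> n. c \<nu> (from_nat n)"] c01 by blast
  define m where "m k i j = lim (\<lambda>\<nu>. c (\<rho> \<nu>) (k, i, j))" for k i j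
  have m: "(\<lambda>\<nu>. block_average (H (\<rho> \<nu>)) k i j) \<longlonglongrightarrow> m k i j" if "i < k" "j < k" for k i j
  proof -
    have "convergent (\<lambda>\<nu>. c (\<rho> \<nu>) (k, i, j))" using \<rho>(2)[of "to_nat (k, i, j)"] by simp
    then have "(\<lambda>\<nu>. c (\<rho> \<nu>) (k, i, j)) \<longlonglongrightarrow> m k i j" by (simp add: m_def convergent_LIMSEQ_iff)
    then show ?thesis using that by (simp add: c_def)
  qed
  have e\<rho>: "(\<lambda>\<nu>. e (\<rho> \<nu>)) \<longlonglongrightarrow> 0" using LIMSEQ_subseq_LIMSEQ[OF e0 \<rho>(1)] by (simp add: comp_def)
  obtain V where V: "monotone_kernel V"
    "\<And>k. k > 0 \<Longrightarrow> cut_norm ?U (\<lambda>x y. step_kernel k (m k) x y - V x y) \<le> 4 / real k"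
  proof (rule ex_monotone_kernel[of m])
    show "0 \<le> m k i j \<and> m k i j \<le> 1" if "i < k" "j < k" for k i j
      using block_average_bounds[OF H that] m[OF that]
      by (auto intro: LIMSEQ_le_const LIMSEQ_le_const2)
    show "m k i j = m k j i" if "i < k" "j < k" for k i j
      using m[OF that] m[OF that(2,1)] block_average_commute[OF H, of _ k i j] LIMSEQ_unique by fastforce
    \<comment> \<open>For fixed scales the error is a constant times
      \<open>e (\<rho> \<nu>)\<close>, so the comparison becomes exact in the limit.\<close>
    show "m k i j \<le> m l i' j'" if a: "i < k" "j < k" "i' < l" "j' < l"
      "(real i + 1) / real k \<le> real i' / real l" "(real j + 1) / real k \<le> real j' / real l" for k l i j i' j'
    proof (rule LIMSEQ_le[OF m[OF a(1,2)]])
      show "(\<lambda>\<nu>. block_average (H (\<rho> \<nu>)) l i' j' + (real k * real k * real l + real k * real l * real l) * e (\<rho> \<nu>)) \<longlonglongrightarrow> m l i' j'"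
        using tendsto_add[OF m[OF a(3,4)] tendsto_mult[OF tendsto_const e\<rho>]] by simp
      show "\<exists>N. \<forall>\<nu>\<ge>N. block_average (H (\<rho> \<nu>)) k i j
        \<le> block_average (H (\<rho> \<nu>)) l i' j' + (real k * real k * real l + real k * real l * real l) * e (\<rho> \<nu>)"
        using block_average_monotone[OF H e a] by blast
    qed
  qed blast
  have VK: "bounded_kernel ?U V" using V(1) by (simp add: monotone_kernel_def is_kernel_bounded)
  note HK = is_kernel_bounded[OF H]
  have "(\<lambda>\<nu>. cut_norm ?U (\<lambda>x y. H (\<rho> \<nu>) x y - V x y)) \<longlonglongrightarrow> 0"
  proof (rule LIMSEQ_I)
    fix r :: real assume r: "r > 0"
    \<comment> \<open>Two errors do not vanish for fixed k: 8/k from averaging and 4/k from passing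
      to \<open>V\<close>. Their sum 12/k is made smaller than r/2.\<close>
    obtain k :: nat where k: "real k > 24 / r" using reals_Archimedean2 by blast
    then have k0: "k > 0" using r by (auto intro: gr0I simp: field_simps)
    have kr: "12 / real k < r / 2" using k k0 r by (simp add: field_simps)
    \<comment> \<open>Collects the terms that vanish as \<nu> grows with k fixed: the defect of
      monotonicity and finitely many deviations of averages.\<close>
    define b where "b \<nu> = 16 * real k * e (\<rho> \<nu>) + (\<Sum>i<k. \<Sum>j<k. \<bar>block_average (H (\<rho> \<nu>)) k i j - m k i j\<bar>)" for \<nu>
    have "b \<longlonglongrightarrow> 16 * real k * 0 + (\<Sum>i<k. \<Sum>j<k. \<bar>m k i j - m k i j\<bar>)"
      unfolding b_def using m e\<rho> by (intro tendsto_intros) auto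
    then have "b \<longlonglongrightarrow> 0" by simp
    from order_tendstoD(2)[OF this, of "r / 2"] r obtain N where N: "\<And>\<nu>. \<nu> \<ge> N \<Longrightarrow> b \<nu> < r / 2"
      by (auto simp: eventually_sequentially)
    show "\<exists>N. \<forall>\<nu>\<ge>N. norm (cut_norm ?U (\<lambda>x y. H (\<rho> \<nu>) x y - V x y) - 0) < r"
    proof (intro exI[of _ N] allI impI)
      fix \<nu> assume \<nu>: "\<nu> \<ge> N"
      let ?S = "step_kernel k (block_average (H (\<rho> \<nu>)) k)"
      note sk = bounded_kernel_step_kernel
      have "cut_norm ?U (\<lambda>x y. H (\<rho> \<nu>) x y - V x y)
         \<le> cut_norm ?U (\<lambda>x y. H (\<rho> \<nu>) x y - ?S x y) + cut_norm ?U (\<lambda>x y. ?S x y - V x y)"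
        by (rule unit_interval.cut_norm_triangle[OF HK sk VK])
      also have "cut_norm ?U (\<lambda>x y. ?S x y - V x y) \<le> cut_norm ?U (\<lambda>x y. ?S x y - step_kernel k (m k) x y)
         + cut_norm ?U (\<lambda>x y. step_kernel k (m k) x y - V x y)"
        by (rule unit_interval.cut_norm_triangle[OF sk sk VK])
      also have "cut_norm ?U (\<lambda>x y. step_kernel k (m k) x y - V x y) \<le> 4 / real k" by (rule V(2)[OF k0])
      also have "cut_norm ?U (\<lambda>x y. ?S x y - step_kernel k (m k) x y) \<le> (\<Sum>i<k. \<Sum>j<k. \<bar>block_average (H (\<rho> \<nu>)) k i j - m k i j\<bar>)"
        by (rule cut_norm_step_kernel_diff_le)
      also have "cut_norm ?U (\<lambda>x y. H (\<rho> \<nu>) x y - ?S x y) \<le> 8 * real k * (2 * e (\<rho> \<nu>) + 1 / (real k)\<^sup>2)"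
        by (rule cut_norm_step_kernel_error[OF H e k0])
      also have "8 * real k * (2 * e (\<rho> \<nu>) + 1 / (real k)\<^sup>2) = 16 * real k * e (\<rho> \<nu>) + 8 / real k"
        using k0 by (simp add: algebra_simps power2_eq_square)
      finally have "cut_norm ?U (\<lambda>x y. H (\<rho> \<nu>) x y - V x y) \<le> b \<nu> + 12 / real k" by (simp add: b_def)
      then have "cut_norm ?U (\<lambda>x y. H (\<rho> \<nu>) x y - V x y) < r" using N[OF \<nu>] kr by simp
      then show "norm (cut_norm ?U (\<lambda>x y. H (\<rho> \<nu>) x y - V x y) - 0) < r"
        using unit_interval.cut_norm_nonneg[OF bounded_kernel_diff[OF HK VK]] by simp
    qed
  qed
  then show thesis using that \<rho>(1) V(1) by blast
qed

section \<open>From small functional to monotone limit\<close>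

lemma ex_labelling_along_order:
  assumes fin: "finite (pverts G)" and r: "linear_order_on (pverts G) r"
  obtains l where "labelling G l" "\<And>i j. 1 \<le> i \<Longrightarrow> i \<le> j \<Longrightarrow> j \<le> card (pverts G) \<Longrightarrow> (l i, l j) \<in> r"
proof -
  let ?V = "pverts G"
  have tr: "trans r" and as: "antisym r" and tot: "total_on ?V r" and rf: "refl_on ?V r"
    using r by (auto simp: order_on_defs)
  \<comment> \<open>The count includes \<open>v\<close> itself, so ranks run from 1 to the number of
    vertices; the labelling is the inverse of this map.\<close>
  define rank where "rank v = card {u \<in> ?V. (u, v) \<in> r}" for v
  have less: "rank u < rank v" if "(u, v) \<in> r" "u \<noteq> v" "u \<in> ?V" "v \<in> ?V" for u v
    unfolding rank_def
  proof (rule psubset_card_mono)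
    have "v \<in> {w \<in> ?V. (w, v) \<in> r}" "v \<notin> {w \<in> ?V. (w, u) \<in> r}"
      using that rf as by (auto simp: refl_on_def antisym_def)
    moreover have "{w \<in> ?V. (w, u) \<in> r} \<subseteq> {w \<in> ?V. (w, v) \<in> r}" using that(1) tr by (auto dest: transD)
    ultimately show "{w \<in> ?V. (w, u) \<in> r} \<subset> {w \<in> ?V. (w, v) \<in> r}" by blast
  qed (use fin in auto)
  have inj: "inj_on rank ?V"
  proof (rule inj_onI, rule ccontr)
    fix u v assume uv: "u \<in> ?V" "v \<in> ?V" "rank u = rank v" "u \<noteq> v"
    then have "(u, v) \<in> r \<or> (v, u) \<in> r" using tot by (auto simp: total_on_def)
    then show False using less[of u v] less[of v u] uv by auto
  qed
  have "rank ` ?V = {1..card ?V}"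
  proof (rule card_subset_eq)
    show "rank ` ?V \<subseteq> {1..card ?V}"
    proof
      fix i assume "i \<in> rank ` ?V"
      then obtain v where v: "v \<in> ?V" "i = rank v" by blast
      have "rank v \<le> card ?V" unfolding rank_def by (rule card_mono) (use fin in auto)
      moreover have "rank v > 0" unfolding rank_def using fin v rf by (auto simp: card_gt_0_iff refl_on_def)
      ultimately show "i \<in> {1..card ?V}" using v by simp
    qed
    show "card (rank ` ?V) = card {1..card ?V}" using card_image[OF inj] by simp
  qed simp
  then have bij: "bij_betw rank ?V {1..card ?V}" using inj by (simp add: bij_betw_def)
  define l where "l = inv_into ?V rank"
  have lb: "bij_betw l {1..card ?V} ?V" unfolding l_def by (rule bij_betw_inv_into[OF bij])
  have rl: "rank (l i) = i" "l i \<in> ?V" if "i \<in> {1..card ?V}" for i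
  proof -
    show "rank (l i) = i" unfolding l_def by (rule bij_betw_inv_into_right[OF bij that])
    show "l i \<in> ?V" by (rule bspec[OF bij_betwE[OF lb] that])
  qed
  have "(l i, l j) \<in> r" if ij: "1 \<le> i" "i \<le> j" "j \<le> card ?V" for i j
  proof (rule ccontr)
    assume n: "(l i, l j) \<notin> r"
    have v: "l i \<in> ?V" "l j \<in> ?V" "rank (l i) = i" "rank (l j) = j" using rl[of i] rl[of j] ij by auto
    have "l i \<noteq> l j"
    proof
      assume "l i = l j"
      then have "(l i, l j) \<in> r" using rf v(2) unfolding refl_on_def by metis
      then show False using n by contradiction
    qed
    then have "(l j, l i) \<in> r" using n tot v(1,2) unfolding total_on_def by metis
    from less[OF this] \<open>l i \<noteq> l j\<close> v(1,2) have "rank (l j) < rank (l i)" by metis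
    then show False unfolding v(3,4) using ij by simp
  qed
  then show thesis using that lb by (auto simp: labelling_def)
qed

text \<open>Weights are rounded to 0 or 1 one vertex at a time. By \<open>conv\<close> one of the
  two end points does not decrease the functional.\<close>

lemma unit_weights_to_sets:
  fixes \<Phi> :: "('a \<Rightarrow> real) \<Rightarrow> real"
  assumes fin: "finite V" and a: "\<And>u. u \<in> V \<Longrightarrow> 0 \<le> a u \<and> a u \<le> 1"
    and conv: "\<And>b u s. 0 \<le> s \<Longrightarrow> s \<le> 1 \<Longrightarrow> \<Phi> (b(u := s)) \<le> max (\<Phi> (b(u := 0))) (\<Phi> (b(u := 1)))"
  shows "\<exists>A\<subseteq>V. \<Phi> a \<le> \<Phi> (\<lambda>u. if u \<in> V then indicator A u else a u)"
  using fin a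
proof (induction V rule: finite_induct)
  case empty
  then show ?case by simp
next
  case (insert v V)
  then obtain A where A: "A \<subseteq> V" "\<Phi> a \<le> \<Phi> (\<lambda>u. if u \<in> V then indicator A u else a u)" by auto
  let ?b = "\<lambda>u. if u \<in> V then indicator A u else a u"
  have "?b(v := a v) = ?b" using insert(2) by auto
  then have "\<Phi> ?b \<le> max (\<Phi> (?b(v := 0))) (\<Phi> (?b(v := 1)))"
    using conv[of "a v" ?b v] insert.prems[of v] by simp
  moreover have "?b(v := 0) = (\<lambda>u. if u \<in> insert v V then indicator A u else a u)"
    using insert(2) A(1) by (auto simp: fun_eq_iff split: split_indicator)
  moreover have "?b(v := 1) = (\<lambda>u. if u \<in> insert v V then indicator (insert v A) u else a u)"
    using insert(2) A(1) by (auto simp: fun_eq_iff split: split_indicator)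
  ultimately have "\<Phi> a \<le> \<Phi> (\<lambda>u. if u \<in> insert v V then indicator A u else a u)
    \<or> \<Phi> a \<le> \<Phi> (\<lambda>u. if u \<in> insert v V then indicator (insert v A) u else a u)"
    using A(2) by (auto simp: max_def split: if_splits)
  then show ?case
  proof
    assume "\<Phi> a \<le> \<Phi> (\<lambda>u. if u \<in> insert v V then indicator A u else a u)"
    moreover have "A \<subseteq> insert v V" using A(1) by blast
    ultimately show ?case by (intro exI[of _ A] conjI)
  next
    assume "\<Phi> a \<le> \<Phi> (\<lambda>u. if u \<in> insert v V then indicator (insert v A) u else a u)"
    moreover have "insert v A \<subseteq> insert v V" using A(1) by blast
    ultimately show ?case by (intro exI[of _ "insert v A"] conjI)
  qed
qed

text \<open>The positive part of a linear form is convex in every coordinate, and so is a sum of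
  such parts; therefore rounding applies.\<close>

lemma sum_positive_part_weights_le:
  fixes K :: "'p \<Rightarrow> 'a \<Rightarrow> real"
  assumes fin: "finite V" and a: "\<And>u. u \<in> V \<Longrightarrow> 0 \<le> a u \<and> a u \<le> 1"
  shows "\<exists>A\<subseteq>V. (\<Sum>p\<in>R. max (\<Sum>u\<in>V. K p u * a u) 0) \<le> (\<Sum>p\<in>R. max (\<Sum>u\<in>V. K p u * indicator A u) 0)"
proof -
  define \<Phi> where "\<Phi> b = (\<Sum>p\<in>R. max (\<Sum>u\<in>V. K p u * b u) 0)" for b :: "'a \<Rightarrow> real"
  have conv: "\<Phi> (b(u := s)) \<le> max (\<Phi> (b(u := 0))) (\<Phi> (b(u := 1)))" if s: "0 \<le> s" "s \<le> 1" for b u s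
  proof -
    let ?L = "\<lambda>p t. \<Sum>w\<in>V. K p w * (b(u := t)) w"
    have L: "?L p s = (1 - s) * ?L p 0 + s * ?L p 1" for p
      unfolding sum_distrib_left sum.distrib[symmetric] by (rule sum.cong) (auto simp: algebra_simps)
    have cvx: "max ((1 - s) * y + s * z) 0 \<le> (1 - s) * max y 0 + s * max z 0" for y z :: real
    proof -
      have "(1 - s) * y \<le> (1 - s) * max y 0" "s * z \<le> s * max z 0" using s by (auto intro: mult_left_mono)
      moreover have "0 \<le> (1 - s) * max y 0" "0 \<le> s * max z 0" using s by auto
      ultimately show ?thesis by linarith
    qed
    have "max (?L p s) 0 \<le> (1 - s) * max (?L p 0) 0 + s * max (?L p 1) 0" for p
      using cvx[of "?L p 0" "?L p 1"] unfolding L[symmetric] .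
    then have "\<Phi> (b(u := s)) \<le> (\<Sum>p\<in>R. (1 - s) * max (?L p 0) 0 + s * max (?L p 1) 0)"
      unfolding \<Phi>_def by (rule sum_mono)
    also have "\<dots> = (1 - s) * \<Phi> (b(u := 0)) + s * \<Phi> (b(u := 1))"
      by (simp only: \<Phi>_def sum.distrib sum_distrib_left)
    also have "\<dots> \<le> max (\<Phi> (b(u := 0))) (\<Phi> (b(u := 1)))"
      using s by (intro convex_bound_le) simp_all
    finally show ?thesis .
  qed
  have "\<exists>A\<subseteq>V. \<Phi> a \<le> \<Phi> (\<lambda>u. if u \<in> V then indicator A u else a u)"
    by (rule unit_weights_to_sets[of V a \<Phi>, OF fin]) (fact a, fact conv)
  then obtain A where A: "A \<subseteq> V" "\<Phi> a \<le> \<Phi> (\<lambda>u. if u \<in> V then indicator A u else a u)" by blast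
  moreover have "\<Phi> (\<lambda>u. if u \<in> V then indicator A u else a u) = \<Phi> (indicator A)"
    unfolding \<Phi>_def by simp
  ultimately show ?thesis unfolding \<Phi>_def by auto
qed

text \<open>The kernel is constant on the cells of the vertices, so a weight function on the
  interval only matters through its mean on each cell. Convexity replaces these means by a vertex
  set, to which the bound \<open>c\<close> applies; restoring the two removed vertices costs
  1/n.\<close>

lemma almost_monotone_graph:
  assumes G: "pair_graph G" and ne: "pverts G \<noteq> {}"
    and l: "labelling G l" "\<And>i j. 1 \<le> i \<Longrightarrow> i \<le> j \<Longrightarrow> j \<le> card (pverts G) \<Longrightarrow> (l i, l j) \<in> r"
    and c: "\<And>A. A \<subseteq> pverts G \<Longrightarrow> Omega0_order_set G r A \<le> c"
  shows "almost_monotone (\<lambda>x y. adjacency G (vertex_at G l x) (vertex_at G l y)) (c + 1 / real (card (pverts G)))"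
  unfolding almost_monotone_def
proof (intro allI impI)
  let ?U = unit_interval and ?H = "\<lambda>x y. adjacency G (vertex_at G l x) (vertex_at G l y)" and ?V = "pverts G"
  interpret pair_graph G by fact
  have fin: "finite ?V" by simp
  define n where "n = real (card ?V)"
  have n: "n > 0" using fin ne by (simp add: n_def card_gt_0_iff)
  define \<psi> where "\<psi> = vertex_at G l"
  have mp: "measure_preserving_map ?U (vertex_space G) \<psi>" unfolding \<psi>_def by (rule vertex_at_preserving[OF l(1) fin ne])
  then have \<psi>m: "\<psi> \<in> measurable ?U (vertex_space G)" by (simp add: measure_preserving_map_def)
  have \<psi>V: "\<psi> x \<in> ?V" if "x \<in> {0..1}" for x
    unfolding \<psi>_def using vertex_at_in(2)[OF l(1) _ _ ne fin] that by auto
  have vm[measurable]: "(\<lambda>x. h (\<psi> x)) \<in> borel_measurable ?U" for h :: "'a \<Rightarrow> real"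
    by (rule measurable_compose[OF \<psi>m]) (simp add: measurable_vertex_space)
  have vint: "(\<integral>x. h (\<psi> x) \<partial>?U) = (\<Sum>v\<in>?V. h v) / n" for h :: "'a \<Rightarrow> real"
    using measure_preserving_integral[OF mp, of h] by (simp add: integral_vertex_space fin n_def measurable_vertex_space)
  fix a assume a: "test_function ?U a" and a0: "\<forall>x\<in>{0..1}. 0 \<le> a x"
  have [measurable]: "a \<in> borel_measurable ?U" using a by (rule test_function_measurable)
  \<comment> \<open>The mean of \<open>a\<close> over the cell of \<open>u\<close>, which has
    measure 1/n.\<close>
  define \<alpha> where "\<alpha> u = n * (\<integral>y. a y * indicator {u} (\<psi> y) \<partial>?U)" for u
  have tu: "test_function ?U (\<lambda>y. a y * indicator {u} (\<psi> y))" for u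
    by (rule test_function_mult[OF a]) (auto simp: test_function_def vm split: split_indicator)
  have \<alpha>01: "0 \<le> \<alpha> u \<and> \<alpha> u \<le> 1" if u: "u \<in> ?V" for u
  proof -
    have "(\<integral>y. a y * indicator {u} (\<psi> y) \<partial>?U) \<le> (\<integral>y. indicator {u} (\<psi> y) \<partial>?U)"
    proof (rule integral_mono)
      show "integrable ?U (\<lambda>y. a y * indicator {u} (\<psi> y))" by (rule test_function_integrable[OF tu])
      show "integrable ?U (\<lambda>y. indicator {u} (\<psi> y) :: real)"
        by (rule test_function_integrable) (auto simp: test_function_def vm split: split_indicator)
      show "a y * indicator {u} (\<psi> y) \<le> indicator {u} (\<psi> y)" if "y \<in> space ?U" for y
        using a that by (auto simp: test_function_def abs_le_iff split: split_indicator)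
    qed
    also have "\<dots> = 1 / n"
    proof -
      have "(\<Sum>v\<in>?V. indicator {u} v :: real) = (\<Sum>v\<in>?V. if v = u then 1 else 0)"
        by (rule sum.cong) (auto simp: indicator_def)
      then show ?thesis unfolding vint using fin u by simp
    qed
    finally have "n * (\<integral>y. a y * indicator {u} (\<psi> y) \<partial>?U) \<le> n * (1 / n)" using n by (intro mult_left_mono) auto
    moreover have "0 \<le> (\<integral>y. a y * indicator {u} (\<psi> y) \<partial>?U)"
      by (rule Bochner_Integration.integral_nonneg) (use a0 in \<open>auto simp: space_unit_interval\<close>)
    ultimately show ?thesis using n by (simp add: \<alpha>_def)
  qed
  define D where "D v = (\<Sum>u\<in>?V. adjacency G v u * \<alpha> u) / n" for v
  have deg: "kernel_degree ?H a x = D (\<psi> x)" for x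
  proof -
    have "kernel_degree ?H a x = (\<integral>y. (\<Sum>u\<in>?V. adjacency G (\<psi> x) u * (a y * indicator {u} (\<psi> y))) \<partial>?U)"
      unfolding kernel_degree_def
    proof (rule Bochner_Integration.integral_cong)
      fix y assume "y \<in> space ?U"
      then have "\<psi> y \<in> ?V" using \<psi>V by (simp add: space_unit_interval)
      moreover have "(\<Sum>u\<in>?V. adjacency G (\<psi> x) u * (a y * indicator {u} (\<psi> y)))
          = (\<Sum>u\<in>?V. if u = \<psi> y then adjacency G (\<psi> x) (\<psi> y) * a y else 0)"
        by (rule sum.cong) (auto simp: indicator_def)
      ultimately show "adjacency G (vertex_at G l x) (vertex_at G l y) * a y
          = (\<Sum>u\<in>?V. adjacency G (\<psi> x) u * (a y * indicator {u} (\<psi> y)))"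
        using fin by (simp add: \<psi>_def)
    qed simp
    also have "\<dots> = (\<Sum>u\<in>?V. \<integral>y. adjacency G (\<psi> x) u * (a y * indicator {u} (\<psi> y)) \<partial>?U)"
      by (intro Bochner_Integration.integral_sum integrable_mult_right test_function_integrable tu)
    also have "\<dots> = (\<Sum>u\<in>?V. adjacency G (\<psi> x) u * (\<alpha> u / n))"
      using n by (simp add: \<alpha>_def)
    finally show ?thesis by (simp add: D_def sum_divide_distrib)
  qed
  define R where "R = {(v, w) \<in> ?V \<times> ?V. (v, w) \<in> r \<and> v \<noteq> w}"
  define h where "h v w = (if (v, w) \<in> R then max (D v - D w) 0 else 0)" for v w
  note one = test_function_const[of 1 ?U, simplified]
  have hb: "bounded_kernel ?U (\<lambda>x y. h (\<psi> x) (\<psi> y))"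
    by (rule bounded_kernel_comp[OF bounded_kernel_vertex_space[OF fin] \<psi>m])
  have "(\<integral>p. (if fst p < snd p then max (kernel_degree ?H a (fst p) - kernel_degree ?H a (snd p)) 0 else 0) \<partial>(?U \<Otimes>\<^sub>M ?U))
      \<le> (\<integral>p. h (\<psi> (fst p)) (\<psi> (snd p)) \<partial>(?U \<Otimes>\<^sub>M ?U))"
  proof (rule integral_mono_AE'[OF unit_interval.bounded_kernel_integrable[OF hb]])
    show "AE p in ?U \<Otimes>\<^sub>M ?U. (if fst p < snd p then max (kernel_degree ?H a (fst p) - kernel_degree ?H a (snd p)) 0 else 0)
       \<le> h (\<psi> (fst p)) (\<psi> (snd p))"
    proof (rule AE_I2)
      fix p assume "p \<in> space (?U \<Otimes>\<^sub>M ?U)"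
      then have p: "0 \<le> fst p" "fst p \<le> 1" "0 \<le> snd p" "snd p \<le> 1" by (auto simp: space_unit_square)
      show "(if fst p < snd p then max (kernel_degree ?H a (fst p) - kernel_degree ?H a (snd p)) 0 else 0)
       \<le> h (\<psi> (fst p)) (\<psi> (snd p))"
      \<comment> \<open>Points in the same cell have equal degrees and contribute nothing. For
        different cells the order of the points is that of the labels, hence of the vertices in
        \<open>r\<close>.\<close>
      proof (cases "fst p < snd p \<and> \<psi> (fst p) \<noteq> \<psi> (snd p)")
        case True
        have "real (card ?V) * fst p \<le> real (card ?V) * snd p" using True by (intro mult_left_mono) auto
        then have le: "nat (max 1 \<lceil>real (card ?V) * fst p\<rceil>) \<le> nat (max 1 \<lceil>real (card ?V) * snd p\<rceil>)"
          by (intro nat_mono max.mono ceiling_mono) auto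
        have "(\<psi> (fst p), \<psi> (snd p)) \<in> r"
          unfolding \<psi>_def vertex_at_def
          using vertex_at_in(1)[OF l(1) p(1,2) ne fin] vertex_at_in(1)[OF l(1) p(3,4) ne fin] le
          by (intro l(2)) auto
        then have "(\<psi> (fst p), \<psi> (snd p)) \<in> R" using True \<psi>V p by (auto simp: R_def)
        then show ?thesis using True by (simp add: h_def deg)
      next
        case False
        then show ?thesis by (auto simp: h_def deg)
      qed
    qed
    show "AE p in ?U \<Otimes>\<^sub>M ?U. 0 \<le> h (\<psi> (fst p)) (\<psi> (snd p))" by (rule AE_I2) (simp add: h_def)
  qed
  also have "\<dots> = cut_form ?U (\<lambda>x y. h (\<psi> x) (\<psi> y)) (\<lambda>_. 1) (\<lambda>_. 1)"
    by (simp add: cut_form_def case_prod_beta')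
  also have "\<dots> = (\<integral>x. (\<integral>y. h (\<psi> x) (\<psi> y) \<partial>?U) \<partial>?U)"
    using unit_interval.cut_form_iterated[OF hb one one] by simp
  also have "\<dots> = (\<Sum>v\<in>?V. (\<Sum>w\<in>?V. h v w) / n) / n"
    by (simp only: vint vint[of "\<lambda>v. (\<Sum>w\<in>?V. h v w) / n"])
  also have "\<dots> = (\<Sum>(v, w)\<in>?V \<times> ?V. h v w) / n ^ 2"
    by (simp add: sum_divide_distrib[symmetric] sum.cartesian_product power2_eq_square)
  also have "(\<Sum>(v, w)\<in>?V \<times> ?V. h v w) = (\<Sum>(v, w)\<in>R. max (D v - D w) 0)"
    unfolding h_def by (rule sum.mono_neutral_cong_right) (use fin in \<open>auto simp: R_def split: if_splits\<close>)
  also have "\<dots> = (\<Sum>(v, w)\<in>R. max (\<Sum>u\<in>?V. (adjacency G v u - adjacency G w u) * \<alpha> u) 0) / n"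
    unfolding sum_divide_distrib
  proof (rule sum.cong, simp, clarify)
    fix v w
    have "D v - D w = (\<Sum>u\<in>?V. (adjacency G v u - adjacency G w u) * \<alpha> u) / n"
      by (simp add: D_def diff_divide_distrib[symmetric] sum_subtractf[symmetric] left_diff_distrib)
    moreover have "max (s / n) 0 = max s 0 / n" for s using n by (simp add: max_def divide_le_0_iff)
    ultimately show "max (D v - D w) 0 = max (\<Sum>u\<in>?V. (adjacency G v u - adjacency G w u) * \<alpha> u) 0 / n"
      by simp
  qed
  finally have 1: "(\<integral>p. (if fst p < snd p then max (kernel_degree ?H a (fst p) - kernel_degree ?H a (snd p)) 0 else 0) \<partial>(?U \<Otimes>\<^sub>M ?U))
      \<le> (\<Sum>(v, w)\<in>R. max (\<Sum>u\<in>?V. (adjacency G v u - adjacency G w u) * \<alpha> u) 0) / n / n ^ 2" .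
  \<comment> \<open>Rounding of the weights \<alpha>: from here on the sum is that of the
    functional, up to the removal of \<open>v\<close> and \<open>w\<close> from the set.\<close>
  obtain A where A: "A \<subseteq> ?V" "(\<Sum>(v, w)\<in>R. max (\<Sum>u\<in>?V. (adjacency G v u - adjacency G w u) * \<alpha> u) 0)
      \<le> (\<Sum>(v, w)\<in>R. max (\<Sum>u\<in>?V. (adjacency G v u - adjacency G w u) * indicator A u) 0)"
    using sum_positive_part_weights_le[of ?V \<alpha> "\<lambda>p u. adjacency G (fst p) u - adjacency G (snd p) u" R, OF fin \<alpha>01]
    by (auto simp: case_prod_beta')
  have "(\<Sum>(v, w)\<in>R. max (\<Sum>u\<in>?V. (adjacency G v u - adjacency G w u) * indicator A u) 0)
     \<le> (\<Sum>(v, w)\<in>R. max (real (nbrs_in G v (A - {v, w})) - real (nbrs_in G w (A - {v, w}))) 0 + 1)"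
  proof (rule sum_mono, clarify)
    fix v w
    have "finite A" using A fin by (auto intro: finite_subset)
    note rem = nbrs_in_remove2[OF this]
    have "nbrs_in G v A \<le> nbrs_in G v (A - {v, w}) + 1" "nbrs_in G w (A - {v, w}) \<le> nbrs_in G w A"
      using rem(2)[of v G w] rem(1)[of G w v] no_loops' by (auto simp: insert_commute)
    moreover have "(\<Sum>u\<in>?V. (adjacency G v u - adjacency G w u) * indicator A u) = real (nbrs_in G v A) - real (nbrs_in G w A)"
      unfolding left_diff_distrib sum_subtractf sum_adjacency[OF fin A(1)] ..
    ultimately show "max (\<Sum>u\<in>?V. (adjacency G v u - adjacency G w u) * indicator A u) 0
      \<le> max (real (nbrs_in G v (A - {v, w})) - real (nbrs_in G w (A - {v, w}))) 0 + 1"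
      by linarith
  qed
  also have "\<dots> = (\<Sum>(v, w)\<in>R. max (real (nbrs_in G v (A - {v, w})) - real (nbrs_in G w (A - {v, w}))) 0) + real (card R)"
    by (simp add: case_prod_beta' sum.distrib)
  also have "(\<Sum>(v, w)\<in>R. max (real (nbrs_in G v (A - {v, w})) - real (nbrs_in G w (A - {v, w}))) 0) = n ^ 3 * Omega0_order_set G r A"
    using n by (simp add: Omega0_order_set_def R_def n_def)
  also have "n ^ 3 * Omega0_order_set G r A \<le> n ^ 3 * c" using c[OF A(1)] n by (intro mult_left_mono) auto
  also have "real (card R) \<le> n ^ 2"
  proof -
    have "card R \<le> card (?V \<times> ?V)" by (rule card_mono) (use fin in \<open>auto simp: R_def\<close>)
    then have "real (card R) \<le> real (card (?V \<times> ?V))" by (rule of_nat_mono)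
    then show ?thesis by (simp add: n_def card_cartesian_product power2_eq_square)
  qed
  finally have 2: "(\<Sum>(v, w)\<in>R. max (\<Sum>u\<in>?V. (adjacency G v u - adjacency G w u) * \<alpha> u) 0) \<le> n ^ 3 * c + n ^ 2"
    using A(2) by simp
  have "(\<Sum>(v, w)\<in>R. max (\<Sum>u\<in>?V. (adjacency G v u - adjacency G w u) * \<alpha> u) 0) / n / n ^ 2 \<le> (n ^ 3 * c + n ^ 2) / n / n ^ 2"
    using 2 n by (intro divide_right_mono) auto
  also have "\<dots> = c + 1 / n" using n by (simp add: field_simps power2_eq_square power3_eq_cube)
  finally show "(\<integral>p. (if fst p < snd p then max (kernel_degree ?H a (fst p) - kernel_degree ?H a (snd p)) 0 else 0) \<partial>(?U \<Otimes>\<^sub>M ?U))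
     \<le> c + 1 / real (card ?V)"
    using 1 unfolding n_def by linarith
qed

text \<open>The labelling comes from an optimal order and may differ from the one along which the
  graphs converge. The conclusion is therefore phrased as a distance from the unlabelled
  kernel.\<close>

lemma ex_almost_monotone_graph_kernel:
  assumes G: "pair_graph G" and ne: "pverts G \<noteq> {}"
  obtains H where "is_kernel unit_interval H" "almost_monotone H (Omega0 G + 1 / real (card (pverts G)))"
    "\<And>V. bounded_kernel unit_interval V \<Longrightarrow>
       cut_dist (vertex_space G) (adjacency G) unit_interval V \<le> cut_norm unit_interval (\<lambda>x y. H x y - V x y)"
proof -
  interpret pair_graph G by fact
  have fin: "finite (pverts G)" by simp
  obtain r where r: "linear_order_on (pverts G) r" "\<And>A. A \<subseteq> pverts G \<Longrightarrow> Omega0_order_set G r A \<le> Omega0 G"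
    using Omega0_attained[OF fin] by blast
  obtain l where l: "labelling G l" "\<And>i j. 1 \<le> i \<Longrightarrow> i \<le> j \<Longrightarrow> j \<le> card (pverts G) \<Longrightarrow> (l i, l j) \<in> r"
    using ex_labelling_along_order[OF fin r(1)] by blast
  let ?H = "\<lambda>x y. adjacency G (vertex_at G l x) (vertex_at G l y)"
  have sym: "adjacency G u v = adjacency G v u" for u v
    unfolding adjacency_def using arcs_symmetric by auto
  have b: "bounded_kernel unit_interval ?H" by (rule bounded_kernel_vertex_at[OF l(1) fin ne])
  have "is_kernel unit_interval ?H"
    using b sym unfolding bounded_kernel_def is_kernel_def by (auto simp: adjacency_def)
  moreover have "almost_monotone ?H (Omega0 G + 1 / real (card (pverts G)))"
    by (rule almost_monotone_graph[OF G ne l r(2)])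
  moreover have "cut_dist (vertex_space G) (adjacency G) unit_interval V \<le> cut_norm unit_interval (\<lambda>x y. ?H x y - V x y)"
    if "bounded_kernel unit_interval V" for V
    by (rule cut_dist_le[OF prob_space_unit_interval vertex_at_preserving[OF l(1) fin ne] measure_preserving_id
        prob_space_vertex_space[OF fin ne] prob_space_unit_interval bounded_kernel_vertex_space[OF fin] that])
  ultimately show thesis using that by blast
qed

section \<open>Graph limits as classes at cut distance zero\<close>

lemma cut_dist_self:
  assumes "prob_space M" "bounded_kernel M W" shows "cut_dist M W M W = 0"
proof -
  have "cut_dist M W M W \<le> cut_norm M (\<lambda>x y. W x y - W x y)"
    using assms by (intro cut_dist_le measure_preserving_id)
  also have "\<dots> \<le> 0" by (rule cut_norm_least) (simp add: cut_form_def case_prod_beta')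
  finally show ?thesis using cut_dist_nonneg[OF assms(1,1,2,2)] by simp
qed

lemma graph_limit_of_eqI:
  assumes M: "prob_space M1" "prob_space M2" and W: "bounded_kernel M1 W1" "bounded_kernel M2 W2"
    and 0: "cut_dist M1 W1 M2 W2 = 0"
  shows "graph_limit_of M1 W1 = graph_limit_of M2 W2"
proof -
  have "cut_dist M1 W1 unit_interval X = 0 \<longleftrightarrow> cut_dist M2 W2 unit_interval X = 0" if X: "is_kernel unit_interval X" for X
  proof -
    note b = is_kernel_bounded[OF X] and U = prob_space_unit_interval
    have "cut_dist M2 W2 M1 W1 = 0" using 0 cut_dist_commute[OF M W] by simp
    then show ?thesis
      using 0 cut_dist_triangle[OF M U W b] cut_dist_triangle[OF M(2,1) U W(2,1) b]
        cut_dist_nonneg[OF M(1) U W(1) b] cut_dist_nonneg[OF M(2) U W(2) b] by linarith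
  qed
  then show ?thesis unfolding graph_limit_of_def by auto
qed

theorem theorem1p6:
  fixes G :: "nat \<Rightarrow> 'a pair_pre_digraph"
    and M :: "'b measure" and W :: "'b \<Rightarrow> 'b \<Rightarrow> real"
  assumes "\<And>\<nu>. pair_graph (G \<nu>)"
    and "filterlim (\<lambda>\<nu>. card (pverts (G \<nu>))) at_top sequentially"
    and "prob_space M" and "is_kernel M W"
    and "graphs_converge_to G M W"
  shows "graph_limit_of M W \<in> monotone_graph_limits \<longleftrightarrow> (\<lambda>\<nu>. Omega0 (G \<nu>)) \<longlonglongrightarrow> 0"
proof -
  let ?U = unit_interval and ?n = "\<lambda>\<nu>. real (card (pverts (G \<nu>)))"
  note G = assms(1) and M = assms(3) and U = prob_space_unit_interval
  have Wb: "bounded_kernel M W" by (rule is_kernel_bounded[OF assms(4)])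
  have fin: "finite (pverts (G \<nu>))" for \<nu>
  proof -
    interpret pair_graph "G \<nu>" by (rule G)
    show ?thesis by simp
  qed
  obtain l where l: "\<And>\<nu>. labelling (G \<nu>) (l \<nu>)"
    and conv: "(\<lambda>\<nu>. cut_dist ?U (graph_kernel (G \<nu>) (l \<nu>)) M W) \<longlonglongrightarrow> 0"
    using assms(5) unfolding graphs_converge_to_def by blast
  let ?\<delta> = "\<lambda>\<nu>. cut_dist ?U (graph_kernel (G \<nu>) (l \<nu>)) M W"
  have "eventually (\<lambda>\<nu>. card (pverts (G \<nu>)) \<ge> 1) sequentially"
    using assms(2) by (simp add: filterlim_at_top)
  \<comment> \<open>A graph without vertices has no probability measure on its vertex set, so a
    finite initial segment is set aside.\<close>
  then obtain N where N: "\<And>\<nu>. \<nu> \<ge> N \<Longrightarrow> pverts (G \<nu>) \<noteq> {}"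
    unfolding eventually_sequentially by (metis card.empty not_one_le_zero)
  have inv: "(\<lambda>\<nu>. 1 / ?n \<nu>) \<longlonglongrightarrow> 0"
    using filterlim_compose[OF filterlim_real_sequentially assms(2)] tendsto_inverse_0_at_top
    by (auto simp: inverse_eq_divide[symmetric])
  have vs: "cut_dist (vertex_space (G \<nu>)) (adjacency (G \<nu>)) M W \<le> ?\<delta> \<nu>" if "\<nu> \<ge> N" for \<nu>
  proof -
    note ne = N[OF that]
    note P = prob_space_vertex_space[OF fin ne] and K = bounded_kernel_vertex_space[OF fin, of \<nu> "adjacency (G \<nu>)"]
      and gk = bounded_kernel_graph_kernel[OF l fin ne]
    show ?thesis
      using cut_dist_triangle[OF P U M K gk Wb] cut_dist_commute[OF U P gk K] cut_dist_graph_kernel[OF l fin ne] by simp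
  qed
  show ?thesis
  proof
    assume "graph_limit_of M W \<in> monotone_graph_limits"
    then obtain V where V: "monotone_kernel V" "graph_limit_of M W = graph_limit_of ?U V"
      by (auto simp: monotone_graph_limits_def)
    have VK: "is_kernel ?U V" using V(1) by (simp add: monotone_kernel_def)
    note Vb = is_kernel_bounded[OF VK]
    \<comment> \<open>A kernel belongs to its own class. Equality of the two classes therefore puts
      \<open>V\<close> at distance 0 from \<open>W\<close>.\<close>
    have "V \<in> graph_limit_of ?U V" using VK cut_dist_self[OF U Vb] by (simp add: graph_limit_of_def)
    then have "V \<in> graph_limit_of M W" using V(2) by simp
    then have 0: "cut_dist M W ?U V = 0" by (simp add: graph_limit_of_def)
    \<comment> \<open>The extra 1/n in the bracket makes the bound on the distance strict, as
      choosing a coupling requires.\<close>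
    have "Omega0 (G \<nu>) \<le> 4 * (?\<delta> \<nu> + 1 / ?n \<nu>) + 1 / ?n \<nu>" if \<nu>: "\<nu> \<ge> N" for \<nu>
    proof -
      have "card (pverts (G \<nu>)) > 0" using N[OF \<nu>] fin by (simp add: card_gt_0_iff)
      then have "0 < 1 / ?n \<nu>" by simp
      moreover have "cut_dist (vertex_space (G \<nu>)) (adjacency (G \<nu>)) ?U V \<le> ?\<delta> \<nu>"
        using cut_dist_triangle[OF prob_space_vertex_space[OF fin N[OF \<nu>]] M U bounded_kernel_vertex_space[OF fin, of \<nu> "adjacency (G \<nu>)"] Wb Vb]
          0 vs[OF \<nu>] by simp
      ultimately have "cut_dist (vertex_space (G \<nu>)) (adjacency (G \<nu>)) ?U V < ?\<delta> \<nu> + 1 / ?n \<nu>" by linarith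
      then show ?thesis by (rule Omega0_le_cut_dist[OF G N[OF \<nu>] V(1)])
    qed
    then have ub: "eventually (\<lambda>\<nu>. Omega0 (G \<nu>) \<le> 4 * (?\<delta> \<nu> + 1 / ?n \<nu>) + 1 / ?n \<nu>) sequentially"
      unfolding eventually_sequentially by blast
    have "(\<lambda>\<nu>. 4 * (?\<delta> \<nu> + 1 / ?n \<nu>) + 1 / ?n \<nu>) \<longlonglongrightarrow> 4 * (0 + 0) + 0"
      by (intro tendsto_intros conv inv)
    then show "(\<lambda>\<nu>. Omega0 (G \<nu>)) \<longlonglongrightarrow> 0"
      using ub Omega0_nonneg[OF fin] by (intro tendsto_sandwich[OF _ ub tendsto_const]) auto
  next
    assume \<Omega>: "(\<lambda>\<nu>. Omega0 (G \<nu>)) \<longlonglongrightarrow> 0"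
    have "\<forall>\<nu>. \<exists>H. is_kernel ?U H \<and> almost_monotone H (Omega0 (G (\<nu> + N)) + 1 / ?n (\<nu> + N)) \<and>
      (\<forall>V. bounded_kernel ?U V \<longrightarrow>
       cut_dist (vertex_space (G (\<nu> + N))) (adjacency (G (\<nu> + N))) ?U V \<le> cut_norm ?U (\<lambda>x y. H x y - V x y))"
    proof
      fix \<nu>
      have "pverts (G (\<nu> + N)) \<noteq> {}" by (rule N) simp
      from ex_almost_monotone_graph_kernel[OF G this]
      show "\<exists>H. is_kernel ?U H \<and> almost_monotone H (Omega0 (G (\<nu> + N)) + 1 / ?n (\<nu> + N)) \<and>
        (\<forall>V. bounded_kernel ?U V \<longrightarrow>
         cut_dist (vertex_space (G (\<nu> + N))) (adjacency (G (\<nu> + N))) ?U V \<le> cut_norm ?U (\<lambda>x y. H x y - V x y))"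
        by blast
    qed
    from choice[OF this] obtain H where H: "\<And>\<nu>. is_kernel ?U (H \<nu>)"
      "\<And>\<nu>. almost_monotone (H \<nu>) (Omega0 (G (\<nu> + N)) + 1 / ?n (\<nu> + N))"
      "\<And>\<nu> V. bounded_kernel ?U V \<Longrightarrow>
       cut_dist (vertex_space (G (\<nu> + N))) (adjacency (G (\<nu> + N))) ?U V \<le> cut_norm ?U (\<lambda>x y. H \<nu> x y - V x y)"
      by blast
    have "(\<lambda>\<nu>. Omega0 (G (\<nu> + N)) + 1 / ?n (\<nu> + N)) \<longlonglongrightarrow> 0 + 0"
      by (intro tendsto_add LIMSEQ_ignore_initial_segment[OF \<Omega>] LIMSEQ_ignore_initial_segment[OF inv])
    then obtain \<rho> V where \<rho>: "strict_mono \<rho>" and V: "monotone_kernel V"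
      and lim: "(\<lambda>\<nu>. cut_norm ?U (\<lambda>x y. H (\<rho> \<nu>) x y - V x y)) \<longlonglongrightarrow> 0"
      using almost_monotone_compactness[of H, OF H(1,2)] by auto
    have Vb: "bounded_kernel ?U V" using V by (simp add: monotone_kernel_def is_kernel_bounded)
    \<comment> \<open>The left-hand side does not depend on \<nu>, while the right-hand side tends
      to 0. Convergence along a subsequence is thus enough to identify the given limit with that of
      \<open>V\<close>.\<close>
    have le: "cut_dist M W ?U V \<le> ?\<delta> (\<rho> \<nu> + N) + cut_norm ?U (\<lambda>x y. H (\<rho> \<nu>) x y - V x y)" for \<nu>
    proof -
      let ?\<mu> = "\<rho> \<nu> + N"
      have \<mu>: "?\<mu> \<ge> N" by simp
      note P = prob_space_vertex_space[OF fin N[OF \<mu>]] and K = bounded_kernel_vertex_space[OF fin, of ?\<mu> "adjacency (G ?\<mu>)"]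
      show ?thesis
        using cut_dist_triangle[OF M P U Wb K Vb] cut_dist_commute[OF P M K Wb] vs[OF \<mu>] H(3)[OF Vb, of "\<rho> \<nu>"] by simp
    qed
    have "(\<lambda>\<nu>. ?\<delta> (\<rho> \<nu> + N)) \<longlonglongrightarrow> 0"
      using LIMSEQ_subseq_LIMSEQ[OF LIMSEQ_ignore_initial_segment[OF conv, of N] \<rho>] by (simp add: comp_def)
    from tendsto_add[OF this lim]
    have "cut_dist M W ?U V \<le> 0" using le by (intro LIMSEQ_le_const[where a = "cut_dist M W ?U V"]) auto
    then have "cut_dist M W ?U V = 0" using cut_dist_nonneg[OF M U Wb Vb] by simp
    from graph_limit_of_eqI[OF M U Wb Vb this] V
    show "graph_limit_of M W \<in> monotone_graph_limits" by (auto simp: monotone_graph_limits_def)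
  qed
qed

end
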